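(* Suppose that $A$ is a finitely generated virtually abelian group and $N \lhd A$ is a normal subgroup with an automorphism $\xi \in \mathrm{Aut}(N)$. Let $G$ be the HNN-extension $$G = \langle A, t \mid t^{-1} a t = \xi(a), \text{ for all } a \in N \rangle.$$ Then $G$ has (LR) if and only if the natural images of $A$ and $\xi$ generate a finite subgroup in $\mathrm{Out}(N)$. In particular, this holds if $A$ is abelian and $\xi$ has finite order.
   Context: A subgroup $H$ of a group $G$ is a virtual retract of $G$ if there is a finite index subgroup $K$ of $G$ such that $H \subseteq K$ and there is a homomorphism $\rho: K \to H$ whose restriction to $H$ is the identity map. A group $G$ has property (LR) if every finitely generated subgroup of $G$ is a virtual retract of $G$. $\mathrm{Out}(N) = \mathrm{Aut}(N)/\mathrm{Inn}(N)$; the natural image of $A$ in $\mathrm{Out}(N)$ is the image of the composition of the conjugation action $A \to \mathrm{Aut}(N)$ with the quotient map $\mathrm{Aut}(N) \to \mathrm{Out}(N)$, and the natural image of $\xi$ is its image under this quotient map. *)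

theory Defs
  imports "HOL-Algebra.Algebra"
begin

section \<open>Finiteness properties, virtual retracts and property (LR)\<close>

definition finitely_generated_in :: "('a, 'b) monoid_scheme \<Rightarrow> 'a set \<Rightarrow> bool" where
  "finitely_generated_in G H \<longleftrightarrow> (\<exists>S. finite S \<and> S \<subseteq> carrier G \<and> generate G S = H)"

definition finite_index :: "('a, 'b) monoid_scheme \<Rightarrow> 'a set \<Rightarrow> bool" where
  "finite_index G H \<longleftrightarrow> subgroup H G \<and> finite (rcosets\<^bsub>G\<^esub> H)"

definition virtually_abelian :: "('a, 'b) monoid_scheme \<Rightarrow> bool" where
  "virtually_abelian G \<longleftrightarrow> (\<exists>H. finite_index G H \<and> comm_group (G\<lparr>carrier := H\<rparr>))"

definition virtual_retract :: "('a, 'b) monoid_scheme \<Rightarrow> 'a set \<Rightarrow> bool" where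
  "virtual_retract G H \<longleftrightarrow>
     subgroup H G \<and>
     (\<exists>K. finite_index G K \<and> H \<subseteq> K \<and>
        (\<exists>\<rho> \<in> hom (G\<lparr>carrier := K\<rparr>) (G\<lparr>carrier := H\<rparr>). \<forall>h\<in>H. \<rho> h = h))"

definition property_LR :: "('a, 'b) monoid_scheme \<Rightarrow> bool" where
  "property_LR G \<longleftrightarrow>
     (\<forall>H. subgroup H G \<and> finitely_generated_in G H \<longrightarrow> virtual_retract G H)"


section \<open>Outer automorphisms\<close>

definition conj_map :: "('a, 'b) monoid_scheme \<Rightarrow> 'a set \<Rightarrow> 'a \<Rightarrow> 'a \<Rightarrow> 'a" where
  "conj_map A N a = (\<lambda>x\<in>N. a \<otimes>\<^bsub>A\<^esub> x \<otimes>\<^bsub>A\<^esub> inv\<^bsub>A\<^esub> a)"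

definition Inn :: "('a, 'b) monoid_scheme \<Rightarrow> ('a \<Rightarrow> 'a) set" where
  "Inn G = conj_map G (carrier G) ` carrier G"

definition Out :: "('a, 'b) monoid_scheme \<Rightarrow> ('a \<Rightarrow> 'a) set monoid" where
  "Out G = AutoGroup G Mod Inn G"

definition out_class :: "('a, 'b) monoid_scheme \<Rightarrow> ('a \<Rightarrow> 'a) \<Rightarrow> ('a \<Rightarrow> 'a) set" where
  "out_class G f = Inn G #>\<^bsub>AutoGroup G\<^esub> f"

lemma (in normal) conj_map_in_auto:
  assumes a: "a \<in> carrier G"
  shows "conj_map G H a \<in> auto (G\<lparr>carrier := H\<rparr>)"
proof -
  have sub: "x \<in> carrier G" if "x \<in> H" for x
    using that subset by blast
  have cl: "a \<otimes> x \<otimes> inv a \<in> H" if "x \<in> H" for x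
    using inv_op_closed2[OF a that] .
  have cl': "inv a \<otimes> x \<otimes> a \<in> H" if "x \<in> H" for x
    using inv_op_closed1[OF a that] .
  have "bij_betw (\<lambda>x\<in>H. a \<otimes> x \<otimes> inv a) H H"
  proof (rule bij_betw_byWitness[where f' = "\<lambda>x. inv a \<otimes> x \<otimes> a"])
    show "\<forall>x\<in>H. inv a \<otimes> (\<lambda>x\<in>H. a \<otimes> x \<otimes> inv a) x \<otimes> a = x"
      using a sub by (simp add: m_assoc inv_solve_left')
    show "\<forall>x\<in>H. (\<lambda>x\<in>H. a \<otimes> x \<otimes> inv a) (inv a \<otimes> x \<otimes> a) = x"
      using a sub cl' by (simp add: m_assoc) (simp add: m_assoc[symmetric])
  qed (use cl cl' in auto)
  moreover have "(\<lambda>x\<in>H. a \<otimes> x \<otimes> inv a) \<in> hom (G\<lparr>carrier := H\<rparr>) (G\<lparr>carrier := H\<rparr>)"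
  proof (rule homI)
    fix x y assume xy: "x \<in> carrier (G\<lparr>carrier := H\<rparr>)" "y \<in> carrier (G\<lparr>carrier := H\<rparr>)"
    have "inv a \<otimes> (a \<otimes> (y \<otimes> inv a)) = y \<otimes> inv a"
      using a sub xy by (simp add: m_assoc[symmetric])
    then show "(\<lambda>x\<in>H. a \<otimes> x \<otimes> inv a) (x \<otimes>\<^bsub>G\<lparr>carrier := H\<rparr>\<^esub> y) =
        (\<lambda>x\<in>H. a \<otimes> x \<otimes> inv a) x \<otimes>\<^bsub>G\<lparr>carrier := H\<rparr>\<^esub> (\<lambda>x\<in>H. a \<otimes> x \<otimes> inv a) y"
      using a sub xy by (simp add: m_assoc)
  qed (use cl in auto)
  ultimately show ?thesis
    unfolding auto_def conj_map_def Bij_def by simp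
qed

lemma (in group) Inn_normal: "Inn G \<lhd> AutoGroup G"
proof -
  interpret S: normal "carrier G" G
    using subgroup_self by (intro normal_invI) auto
  interpret AG: group "AutoGroup G" by (rule AutoGroup)
  let ?c = "conj_map G (carrier G)"
  have mult: "f \<otimes>\<^bsub>AutoGroup G\<^esub> g = compose (carrier G) f g"
    if "f \<in> auto G" "g \<in> auto G" for f g
    using that by (simp add: AutoGroup_def BijGroup_def auto_def)
  have carr: "carrier (AutoGroup G) = auto G"
    by (simp add: AutoGroup_def)
  have c_auto: "?c a \<in> auto G" if "a \<in> carrier G" for a
    using S.conj_map_in_auto[OF that] by simp
  have c_mult: "?c a \<otimes>\<^bsub>AutoGroup G\<^esub> ?c b = ?c (a \<otimes> b)"
    if "a \<in> carrier G" "b \<in> carrier G" for a b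
    unfolding mult[OF c_auto[OF that(1)] c_auto[OF that(2)]]
    using that by (auto simp: compose_def conj_map_def fun_eq_iff m_assoc inv_mult_group)
  have c_hom: "group_hom G (AutoGroup G) ?c"
    by (auto simp: group_hom_def group_hom_axioms_def hom_def carr c_auto c_mult AG.is_group is_group)
  interpret c: group_hom G "AutoGroup G" ?c by (rule c_hom)
  have sub: "subgroup (Inn G) (AutoGroup G)"
    unfolding Inn_def by (rule c.img_is_subgroup)
  have conj: "f \<otimes>\<^bsub>AutoGroup G\<^esub> ?c a \<otimes>\<^bsub>AutoGroup G\<^esub> inv\<^bsub>AutoGroup G\<^esub> f = ?c (f a)"
    if f: "f \<in> auto G" and a: "a \<in> carrier G" for f a
  proof -
    have fh: "f \<in> hom G G" and fc: "\<And>x. x \<in> carrier G \<Longrightarrow> f x \<in> carrier G"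
      using f by (auto simp: auto_def hom_def)
    interpret f: group_hom G G f
      using fh by (simp add: group_hom_def group_hom_axioms_def is_group)
    have "f \<otimes>\<^bsub>AutoGroup G\<^esub> ?c a = ?c (f a) \<otimes>\<^bsub>AutoGroup G\<^esub> f"
      unfolding mult[OF f c_auto[OF a]] mult[OF c_auto[OF fc[OF a]] f]
      using a fc by (auto simp: compose_def conj_map_def fun_eq_iff)
    then show ?thesis
      using f c_auto[OF fc[OF a]] AG.inv_solve_right[of "?c (f a)" "f \<otimes>\<^bsub>AutoGroup G\<^esub> ?c a" f]
        AG.m_closed[of f "?c a"] c_auto[OF a]
      by (simp add: carr)
  qed
  show ?thesis
    unfolding AG.normal_inv_iff
  proof (intro conjI sub ballI)
    fix f h assume "f \<in> carrier (AutoGroup G)" "h \<in> Inn G"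
    then obtain a where a: "a \<in> carrier G" "h = ?c a" and f: "f \<in> auto G"
      by (auto simp: Inn_def carr)
    have "f a \<in> carrier G" using f a by (auto simp: auto_def hom_def)
    then show "f \<otimes>\<^bsub>AutoGroup G\<^esub> h \<otimes>\<^bsub>AutoGroup G\<^esub> inv\<^bsub>AutoGroup G\<^esub> f \<in> Inn G"
      using conj[OF f a(1)] a(2) by (simp add: Inn_def)
  qed
qed


section \<open>HNN-extensions\<close>

text \<open>The group \<open>\<langle>A, t | t\<^sup>-\<^sup>1 a t = \<xi>(a), a \<in> N\<rangle>\<close> consists of the words in the
  elements of \<open>A\<close> and the letters \<open>t\<close>, \<open>t\<^sup>-\<^sup>1\<close>, modulo the congruence generated by the
  multiplication table of \<open>A\<close>, by \<open>t t\<^sup>-\<^sup>1 = t\<^sup>-\<^sup>1 t = 1\<close> and by the defining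
  relations. Formal inverses of the letters from \<open>A\<close> are not needed, as these
  letters are inverted by the multiplication table.\<close>

datatype 'a hnn_letter = Base 'a | Stable | Stable_inv

definition hnn_words :: "('a, 'b) monoid_scheme \<Rightarrow> 'a hnn_letter list set" where
  "hnn_words A = lists (Base ` carrier A \<union> {Stable, Stable_inv})"

inductive hnn_eq ::
  "('a, 'b) monoid_scheme \<Rightarrow> 'a set \<Rightarrow> ('a \<Rightarrow> 'a) \<Rightarrow> 'a hnn_letter list \<Rightarrow> 'a hnn_letter list \<Rightarrow> bool"
  for A N \<xi>
where
  refl: "w \<in> hnn_words A \<Longrightarrow> hnn_eq A N \<xi> w w"
| sym: "hnn_eq A N \<xi> v w \<Longrightarrow> hnn_eq A N \<xi> w v"
| trans: "hnn_eq A N \<xi> u v \<Longrightarrow> hnn_eq A N \<xi> v w \<Longrightarrow> hnn_eq A N \<xi> u w"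
| cong: "hnn_eq A N \<xi> u u' \<Longrightarrow> hnn_eq A N \<xi> v v' \<Longrightarrow> hnn_eq A N \<xi> (u @ v) (u' @ v')"
| base_one: "hnn_eq A N \<xi> [Base \<one>\<^bsub>A\<^esub>] []"
| base_mult: "a \<in> carrier A \<Longrightarrow> b \<in> carrier A \<Longrightarrow>
    hnn_eq A N \<xi> [Base a, Base b] [Base (a \<otimes>\<^bsub>A\<^esub> b)]"
| stable_inv: "hnn_eq A N \<xi> [Stable, Stable_inv] []"
| inv_stable: "hnn_eq A N \<xi> [Stable_inv, Stable] []"
| hnn_rel: "a \<in> N \<Longrightarrow> hnn_eq A N \<xi> [Stable_inv, Base a, Stable] [Base (\<xi> a)]"

definition hnn_class ::
  "('a, 'b) monoid_scheme \<Rightarrow> 'a set \<Rightarrow> ('a \<Rightarrow> 'a) \<Rightarrow> 'a hnn_letter list \<Rightarrow> 'a hnn_letter list set" where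
  "hnn_class A N \<xi> w = {v. hnn_eq A N \<xi> w v}"

definition HNN ::
  "('a, 'b) monoid_scheme \<Rightarrow> 'a set \<Rightarrow> ('a \<Rightarrow> 'a) \<Rightarrow> 'a hnn_letter list set monoid" where
  "HNN A N \<xi> =
     \<lparr>carrier = hnn_class A N \<xi> ` hnn_words A,
      monoid.mult = (\<lambda>U V. {w. \<exists>u\<in>U. \<exists>v\<in>V. hnn_eq A N \<xi> (u @ v) w}),
      one = hnn_class A N \<xi> []\<rparr>"

lemma hnn_class_eq_iff:
  assumes "v \<in> hnn_words A"
  shows "hnn_class A N \<xi> u = hnn_class A N \<xi> v \<longleftrightarrow> hnn_eq A N \<xi> u v"
  using assms unfolding hnn_class_def
  by (auto intro: hnn_eq.refl hnn_eq.sym hnn_eq.trans)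

lemma HNN_mult:
  assumes "u \<in> hnn_words A" "v \<in> hnn_words A"
  shows "hnn_class A N \<xi> u \<otimes>\<^bsub>HNN A N \<xi>\<^esub> hnn_class A N \<xi> v = hnn_class A N \<xi> (u @ v)"
  using assms unfolding HNN_def hnn_class_def
  by (auto intro: hnn_eq.refl hnn_eq.trans hnn_eq.cong)

lemma hnn_words_inverse:
  assumes "group A" "w \<in> hnn_words A"
  shows "\<exists>v\<in>hnn_words A. hnn_eq A N \<xi> (v @ w) []"
  using assms(2)
proof (induction w)
  case Nil
  then show ?case by (intro bexI[of _ "[]"]) (auto simp: hnn_words_def intro: hnn_eq.refl)
next
  case (Cons x w)
  interpret group A by fact
  from Cons obtain v where v: "v \<in> hnn_words A" "hnn_eq A N \<xi> (v @ w) []"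
    and w: "w \<in> hnn_words A" and x: "x \<in> Base ` carrier A \<union> {Stable, Stable_inv}"
    by (auto simp: hnn_words_def)
  have "\<exists>y \<in> Base ` carrier A \<union> {Stable, Stable_inv}. hnn_eq A N \<xi> [y, x] []"
  proof (cases x)
    case (Base a)
    with x have a: "a \<in> carrier A" by auto
    have "hnn_eq A N \<xi> [Base (inv\<^bsub>A\<^esub> a), Base a] [Base \<one>\<^bsub>A\<^esub>]"
      using hnn_eq.base_mult[of "inv\<^bsub>A\<^esub> a" A a N \<xi>] a by simp
    then have "hnn_eq A N \<xi> [Base (inv\<^bsub>A\<^esub> a), x] []"
      unfolding Base by (rule hnn_eq.trans) (rule hnn_eq.base_one)
    with a show ?thesis by auto
  qed (auto intro: hnn_eq.intros)
  then obtain y where y: "y \<in> Base ` carrier A \<union> {Stable, Stable_inv}"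
    "hnn_eq A N \<xi> [y, x] []" by blast
  have "hnn_eq A N \<xi> (v @ ([y, x] @ w)) (v @ ([] @ w))"
    by (intro hnn_eq.cong hnn_eq.refl v w y)
  then have "hnn_eq A N \<xi> ((v @ [y]) @ (x # w)) []"
    using v(2) by (auto intro: hnn_eq.trans)
  moreover have "v @ [y] \<in> hnn_words A"
    using v(1) y(1) by (auto simp: hnn_words_def)
  ultimately show ?case by blast
qed

lemma HNN_group:
  assumes "group A"
  shows "group (HNN A N \<xi>)"
proof (rule groupI)
  have words: "[] \<in> hnn_words A"
      "\<And>u v. u \<in> hnn_words A \<Longrightarrow> v \<in> hnn_words A \<Longrightarrow> u @ v \<in> hnn_words A"
    by (auto simp: hnn_words_def)
  have carr: "carrier (HNN A N \<xi>) = hnn_class A N \<xi> ` hnn_words A"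
    and one: "\<one>\<^bsub>HNN A N \<xi>\<^esub> = hnn_class A N \<xi> []"
    by (simp_all add: HNN_def)
  show "\<one>\<^bsub>HNN A N \<xi>\<^esub> \<in> carrier (HNN A N \<xi>)"
    unfolding one carr using words by blast
  fix U assume "U \<in> carrier (HNN A N \<xi>)"
  then obtain u where u: "u \<in> hnn_words A" "U = hnn_class A N \<xi> u"
    by (auto simp: carr)
  show "\<one>\<^bsub>HNN A N \<xi>\<^esub> \<otimes>\<^bsub>HNN A N \<xi>\<^esub> U = U"
    by (simp add: one u words HNN_mult)
  obtain v where "v \<in> hnn_words A" "hnn_eq A N \<xi> (v @ u) []"
    using hnn_words_inverse[OF assms u(1)] by blast
  then show "\<exists>V\<in>carrier (HNN A N \<xi>). V \<otimes>\<^bsub>HNN A N \<xi>\<^esub> U = \<one>\<^bsub>HNN A N \<xi>\<^esub>"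
    using u words by (auto simp: carr one HNN_mult hnn_class_eq_iff)
  fix V assume "V \<in> carrier (HNN A N \<xi>)"
  then obtain v where v: "v \<in> hnn_words A" "V = hnn_class A N \<xi> v"
    by (auto simp: carr)
  show "U \<otimes>\<^bsub>HNN A N \<xi>\<^esub> V \<in> carrier (HNN A N \<xi>)"
    using u v words by (simp add: carr HNN_mult)
  fix W assume "W \<in> carrier (HNN A N \<xi>)"
  then obtain w where w: "w \<in> hnn_words A" "W = hnn_class A N \<xi> w"
    by (auto simp: carr)
  show "U \<otimes>\<^bsub>HNN A N \<xi>\<^esub> V \<otimes>\<^bsub>HNN A N \<xi>\<^esub> W = U \<otimes>\<^bsub>HNN A N \<xi>\<^esub> (V \<otimes>\<^bsub>HNN A N \<xi>\<^esub> W)"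
    using u v w words by (simp add: HNN_mult)
qed

end

theory Submission
  imports Defs
begin

text \<open>Since \<open>N\<close> is normal in \<open>G\<close>, the image of \<open>G\<close> in \<open>Out(N)\<close> is finite if and only if \<open>N C\<^sub>G(N)\<close> has
  finite index in \<open>G\<close>. A retraction of a finite index subgroup \<open>K\<close> onto \<open>N\<close> has a kernel that is
  normal in \<open>K\<close> and meets \<open>N\<close> trivially, hence centralizes \<open>N\<close>; so \<open>K\<close> is contained in \<open>N C\<^sub>G(N)\<close>.

  Conversely, suppose that \<open>N C\<^sub>G(N)\<close> has finite index, and let \<open>H\<close> be finitely generated. By an
  averaging argument \<open>N\<close> contains a subgroup \<open>M\<close> that is normalized by \<open>H\<close>, meets \<open>H\<close> trivially and for
  which \<open>M H\<close> has finite index in \<open>N H\<close>. So \<open>H\<close> is a virtual retract of \<open>N H\<close>, and one may assume that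
  \<open>N \<subseteq> H\<close>. A virtual retraction onto \<open>H\<close> amounts to a set \<open>Y\<close> with commuting actions of \<open>G\<close> from the
  left and of \<open>H\<close> from the right, the latter free with finitely many orbits, and a point \<open>y\<close> with
  \<open>h y = y h\<close> for all \<open>h \<in> H\<close>. It is built as in Marshall Hall's theorem: take the finitely many
  double cosets \<open>A q H\<close> met by the suffixes of words for generators of \<open>H\<close>, collapse each of them to
  finitely many \<open>H\<close>-orbits by means of a virtual retraction of \<open>A\<close> onto \<open>A \<inter> q H q\<inverse>\<close> that separates
  these suffixes, and extend the partial action of \<open>t\<close> to a permutation. The defining relations
  require that \<open>t\<close> respects the coset of \<open>C\<^sub>G(N) H\<close> attached to each orbit; taking suitably many
  copies of the orbits makes all these finitely many cosets equally frequent, so the extension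
  exists.\<close>

section \<open>Coverings by finitely many cosets\<close>

text \<open>The obstacle is the defining relation. If \<open>N \<subseteq> H\<close>, then on a
  point coming from \<open>x\<close> an element \<open>n\<close> of \<open>N\<close> acts as the
  right translation by \<open>inv x \<otimes> n \<otimes> x\<close>. So a bijection \<tau> that
  commutes with \<open>H\<close> satisfies the relation once it sends points of \<open>x\<close> to
  points of some \<open>x'\<close> in \<open>cent G N \<otimes> t \<otimes> x\<close>. Up to
  translation by \<open>H\<close> this prescribes only a coset of \<open>cent G N <#> H\<close>.
  There are finitely many of them, again because \<open>N \<subseteq> H\<close>: a factor from
  \<open>N\<close> can be moved to the right and absorbed, so the finite index of
  \<open>N <#> cent G N\<close> bounds their number. Collapsing a double coset must not blur these
  cosets. It does not, because the subgroup \<open>M\<close> that is divided out is normalized by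
  \<open>A \<inter> g H (inv g)\<close>, which contains \<open>N\<close>, and meets it trivially:
  commutators of \<open>M\<close> and \<open>N\<close> lie in both. Maschke's averaging cannot
  divide by a group order in an abelian group. It is therefore carried out in torsion-free groups,
  where a power map has trivial kernel, and complements are obtained only up to finite
  index.\<close>

definition fin_cover :: "('a, 'b) monoid_scheme \<Rightarrow> 'a set \<Rightarrow> 'a set \<Rightarrow> bool" where
  "fin_cover G K P \<longleftrightarrow> (\<exists>T. finite T \<and> T \<subseteq> carrier G \<and> P \<subseteq> K <#>\<^bsub>G\<^esub> T)"

lemma fin_cover_mono:
  assumes "fin_cover G K P" "K \<subseteq> K'" "P' \<subseteq> P"
  shows "fin_cover G K' P'"
  using assms unfolding fin_cover_def by (meson mono_set_mult order.refl order.trans)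

context group
begin

text \<open>Cancellation in right-nested products, the normal form to which \<open>m_assoc\<close>
  rewrites.\<close>

lemma mult_inv_cancel [simp]:
  assumes "x \<in> carrier G" "y \<in> carrier G"
  shows "x \<otimes> (inv x \<otimes> y) = y" "inv x \<otimes> (x \<otimes> y) = y"
  using assms by (simp_all flip: m_assoc)

text \<open>Picking one element from each fibre of \<open>f\<close> gives the translates. In the
  applications \<open>f\<close> records a coset or an orbit, and \<open>K\<close> contains the
  quotients of elements with the same record.\<close>

lemma fin_coverI_map:
  assumes "P \<subseteq> carrier G" "finite (f ` P)"
    and "\<And>x y. \<lbrakk>x \<in> P; y \<in> P; f x = f y\<rbrakk> \<Longrightarrow> x \<otimes> inv y \<in> K"
  shows "fin_cover G K P"
proof -
  define T where "T = inv_into P f ` f ` P"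
  have T: "T \<subseteq> P" unfolding T_def by (auto intro: inv_into_into)
  have "P \<subseteq> K <#> T"
  proof
    fix x assume x: "x \<in> P"
    define t where "t = inv_into P f (f x)"
    have t: "t \<in> P" "f t = f x" "t \<in> T"
      using x inv_into_into[of "f x" f P] f_inv_into_f[of "f x" f P] unfolding t_def T_def by simp_all
    then have "x \<otimes> inv t \<in> K" using assms(3)[of x t] x by simp
    moreover have "x \<in> carrier G" "t \<in> carrier G" using x t(1) assms(1) by blast+
    then have "x = (x \<otimes> inv t) \<otimes> t" by (simp add: m_assoc)
    ultimately show "x \<in> K <#> T" using t unfolding set_mult_def by blast
  qed
  moreover have "finite T" unfolding T_def by (rule finite_imageI) (rule assms(2))
  moreover have "T \<subseteq> carrier G" using T assms(1) by (rule order.trans)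
  ultimately show ?thesis unfolding fin_cover_def by (intro exI[of _ T] conjI)
qed

text \<open>The translates can be moved into \<open>P\<close>: whenever a coset
  \<open>K #> t\<close> meets \<open>P\<close>, replace \<open>t\<close> by a point where it
  does.\<close>

lemma fin_coverE:
  assumes "fin_cover G K P" "subgroup K G" "P \<subseteq> carrier G"
  obtains T where "finite T" "T \<subseteq> P" "P \<subseteq> K <#> T"
proof -
  obtain T where T: "finite T" "T \<subseteq> carrier G" "P \<subseteq> K <#> T"
    using assms(1) unfolding fin_cover_def by blast
  interpret K: subgroup K G by fact
  define c where "c t = (SOME x. x \<in> P \<and> x \<in> K #> t)" for t
  define T' where "T' = c ` {t \<in> T. \<exists>x. x \<in> P \<and> x \<in> K #> t}"
  have c: "c t \<in> P \<and> c t \<in> K #> t" if "\<exists>x. x \<in> P \<and> x \<in> K #> t" for t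
    unfolding c_def by (rule someI_ex[OF that])
  have "P \<subseteq> K <#> T'"
  proof
    fix x assume x: "x \<in> P"
    then obtain k t where kt: "k \<in> K" "t \<in> T" "x = k \<otimes> t"
      using T(3) unfolding set_mult_def by blast
    then have ex: "\<exists>x. x \<in> P \<and> x \<in> K #> t" using x unfolding r_coset_def by blast
    with c obtain k' where k': "k' \<in> K" "c t = k' \<otimes> t" unfolding r_coset_def by blast
    have "x = (k \<otimes> inv k') \<otimes> c t" "k \<otimes> inv k' \<in> K"
      using kt k' T(2) by (auto simp: m_assoc)
    moreover have "c t \<in> T'" using ex kt unfolding T'_def by blast
    ultimately show "x \<in> K <#> T'" unfolding set_mult_def by blast
  qed
  moreover have "T' \<subseteq> P" "finite T'" using c T(1) unfolding T'_def by auto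
  ultimately show thesis using that by blast
qed

lemma fin_cover_rcosets:
  assumes "fin_cover G K P" "subgroup K G" "P \<subseteq> carrier G"
  shows "finite ((\<lambda>x. K #> x) ` P)"
proof -
  obtain T where T: "finite T" "T \<subseteq> P" "P \<subseteq> K <#> T" using fin_coverE[OF assms] .
  have "(\<lambda>x. K #> x) ` P \<subseteq> (\<lambda>x. K #> x) ` T"
  proof
    fix y assume "y \<in> (\<lambda>x. K #> x) ` P"
    then obtain x where x: "x \<in> P" "y = K #> x" by blast
    then obtain k t where kt: "k \<in> K" "t \<in> T" "x = k \<otimes> t"
      using T(3) unfolding set_mult_def by blast
    then have "x \<in> K #> t" unfolding r_coset_def by blast
    then have "K #> x = K #> t"
      using repr_independence[of x K t] T(2) kt assms(2,3) by blast
    then show "y \<in> (\<lambda>x. K #> x) ` T" using x kt by blast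
  qed
  then show ?thesis using T(1) by (meson finite_imageI finite_subset)
qed

text \<open>Coverings extend finite index to a relation between subsets of one ambient group. No
  change of the carrier is built in, and a product set such as \<open>M <#> K\<close> can be
  compared with another before it is known to be a subgroup.\<close>

lemma finite_index_iff:
  "finite_index G K \<longleftrightarrow> subgroup K G \<and> fin_cover G K (carrier G)"
proof (intro iffI)
  assume F: "finite_index G K"
  then have K: "subgroup K G" unfolding finite_index_def by simp
  have eq: "rcosets K = (\<lambda>x. K #> x) ` carrier G" unfolding RCOSETS_def by blast
  have "fin_cover G K (carrier G)"
  proof (rule fin_coverI_map[where f = "\<lambda>x. K #> x"])
    show "finite ((#>) K ` carrier G)" using F unfolding finite_index_def eq by simp
    fix x y assume xy: "x \<in> carrier G" "y \<in> carrier G" "K #> x = K #> y"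
    then have "x \<in> K #> y" using rcos_self[OF xy(1) K] by simp
    then show "x \<otimes> inv y \<in> K" 
      using xy subgroup.mem_carrier[OF K] by (auto simp: r_coset_def m_assoc)
  qed auto
  with K show "subgroup K G \<and> fin_cover G K (carrier G)" by simp
next
  assume K: "subgroup K G \<and> fin_cover G K (carrier G)"
  have eq: "rcosets K = (\<lambda>x. K #> x) ` carrier G" unfolding RCOSETS_def by blast
  from K show "finite_index G K" unfolding finite_index_def eq using fin_cover_rcosets by blast
qed

lemma fin_cover_trans:
  assumes "fin_cover G K L" "fin_cover G L P" "subgroup K G" 
  shows "fin_cover G K P"
proof -
  from assms obtain S T where S: "finite S" "S \<subseteq> carrier G" "L \<subseteq> K <#> S"
    and T: "finite T" "T \<subseteq> carrier G" "P \<subseteq> L <#> T" unfolding fin_cover_def by blast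
  have "P \<subseteq> K <#> (S <#> T)"
    using S(3) T(3) set_mult_assoc[of K S T] subgroup.subset[OF assms(3)] S(2) T(2)
    by (metis (no_types, lifting) mono_set_mult order.trans subset_refl)
  moreover have "finite (S <#> T)" "S <#> T \<subseteq> carrier G"
    using S T by (auto simp: set_mult_def)
  ultimately show ?thesis unfolding fin_cover_def by blast
qed

lemma fin_cover_Int:
  assumes "fin_cover G K P" "subgroup K G" "subgroup L G" "L \<subseteq> P" "P \<subseteq> carrier G"
  shows "fin_cover G (K \<inter> L) L"
proof (rule fin_coverI_map[where f = "\<lambda>x. K #> x"])
  show "L \<subseteq> carrier G" using assms by (simp add: subgroup.subset)
  show "finite ((#>) K ` L)" using fin_cover_rcosets[OF assms(1,2,5)] assms(4)
    by (meson finite_subset image_mono)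
  fix x y assume xy: "x \<in> L" "y \<in> L" "K #> x = K #> y"
  have c: "x \<in> carrier G" "y \<in> carrier G" using xy assms by auto
  then have "x \<in> K #> y" using rcos_self[of x K] assms(2) xy by simp
  then have "x \<otimes> inv y \<in> K" 
    using c subgroup.mem_carrier[OF assms(2)] by (auto simp: r_coset_def m_assoc)
  then show "x \<otimes> inv y \<in> K \<inter> L" using xy assms(3) by (simp add: subgroup_def)
qed

text \<open>By pigeonhole two of the powers with exponents \<open>0\<close> to \<open>card C\<close>
  lie in one coset, so \<open>x [^] d \<in> K\<close> for some positive
  \<open>d \<le> card C\<close>. As \<open>K\<close> is not assumed normal, \<open>d\<close> depends
  on \<open>x\<close> and may fail to divide the index; the factorial is a multiple of all
  candidates.\<close>

lemma fin_cover_power: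
  assumes "fin_cover G K P" "subgroup K G" "subgroup P G"
  obtains n :: nat where "n > 0" "\<And>x. x \<in> P \<Longrightarrow> x [^] n \<in> K"
proof -
  interpret K: subgroup K G by fact
  interpret P: subgroup P G by fact
  define C where "C = (\<lambda>x. K #> x) ` P"
  have fin: "finite C" unfolding C_def by (rule fin_cover_rcosets[OF assms(1,2) P.subset])
  have "x [^] (fact (card C) :: nat) \<in> K" if x: "x \<in> P" for x
  proof -
    have xG: "x \<in> carrier G" using x P.subset by blast
    have xp: "x [^] i \<in> P" for i :: nat by (induction i) (use x in auto)
    have "\<not> inj_on (\<lambda>i. K #> (x [^] i)) {0..card C}"
    proof
      assume "inj_on (\<lambda>i. K #> (x [^] i)) {0..card C}"
      then have "card {0..card C} \<le> card C"
        by (rule card_inj_on_le) (use xp fin in \<open>auto simp: C_def\<close>)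
      then show False by simp
    qed
    then obtain i' j' where ij': "i' \<le> card C" "j' \<le> card C" "i' \<noteq> j'" "K #> (x [^] i') = K #> (x [^] j')"
      unfolding inj_on_def by auto
    obtain i j where ij: "i < j" "j \<le> card C" "K #> (x [^] i) = K #> (x [^] j)"
    proof (cases "i' < j'")
      case True
      with ij' that[of i' j'] show thesis by simp
    next
      case False
      with ij' that[of j' i'] show thesis by simp
    qed
    define d where "d = j - i"
    have d: "0 < d" "d \<le> card C" "j = d + i" using ij unfolding d_def by auto
    have "x [^] j \<in> K #> (x [^] i)" using rcos_self[of "x [^] j" K] ij xG assms(2) by simp
    then obtain k where "k \<in> K" "x [^] j = k \<otimes> x [^] i" unfolding r_coset_def by blast
    moreover have "x [^] j = x [^] d \<otimes> x [^] i" using d xG by (simp add: nat_pow_mult)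
    ultimately have "x [^] d \<in> K" using xG by simp
    moreover have "d dvd fact (card C)" using d by (simp add: dvd_fact)
    then obtain e where "fact (card C) = d * e" by blast
    then have "x [^] (fact (card C) :: nat) = (x [^] d) [^] e"
      using xG by (simp add: nat_pow_pow)
    moreover have "y [^] e \<in> K" if "y \<in> K" for y and e :: nat 
      using that by (induction e) auto
    ultimately show ?thesis by simp
  qed
  then show thesis using that[of "fact (card C)"] by simp
qed

lemma fin_cover_mult_left:
  assumes "fin_cover G K P" "K \<subseteq> carrier G" "P \<subseteq> carrier G" "M \<subseteq> carrier G"
  shows "fin_cover G (M <#> K) (M <#> P)"
proof -
  from assms obtain T where T: "finite T" "T \<subseteq> carrier G" "P \<subseteq> K <#> T"
    unfolding fin_cover_def by blast
  then have "M <#> P \<subseteq> M <#> K <#> T"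
    using set_mult_assoc[of M K T] assms by (simp add: mono_set_mult)
  then show ?thesis using T unfolding fin_cover_def by blast
qed

end

section \<open>Finitely generated abelian groups\<close>

text \<open>Commutativity is stated in the ambient group, so that products, powers and inverses are
  always those of \<open>G\<close>.\<close>

definition abelian_sub :: "('a, 'b) monoid_scheme \<Rightarrow> 'a set \<Rightarrow> bool" where
  "abelian_sub G B \<longleftrightarrow> subgroup B G \<and> (\<forall>x\<in>B. \<forall>y\<in>B. x \<otimes>\<^bsub>G\<^esub> y = y \<otimes>\<^bsub>G\<^esub> x)"

context group
begin

lemma subgroup_generate_self:
  assumes "subgroup H G"
  shows "generate G H = H"
  using generate_subgroup_incl[OF subset_refl assms] generate.incl[of _ H G] by blast

lemma subgroup_nat_pow_closed:
  assumes "subgroup H G" "h \<in> H"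
  shows "h [^] (n::nat) \<in> H"
  using subgroup_int_pow_closed[OF assms, of "int n"] by (simp add: int_pow_int)

lemma abelian_subD:
  assumes "abelian_sub G B"
  shows "subgroup B G" "x \<in> B \<Longrightarrow> x \<in> carrier G" 
    "\<lbrakk>x \<in> B; y \<in> B\<rbrakk> \<Longrightarrow> x \<otimes> y = y \<otimes> x"
  using assms unfolding abelian_sub_def by (auto simp: subgroup.mem_carrier)

lemma abelian_sub_subset:
  assumes "abelian_sub G B" "subgroup Y G" "Y \<subseteq> B"
  shows "abelian_sub G Y"
  using assms unfolding abelian_sub_def by blast

lemma abelian_sub_generate:
  assumes "abelian_sub G B" "S \<subseteq> B"
  shows "generate G S \<subseteq> B" "subgroup (generate G S) G" "abelian_sub G (generate G S)"
proof -
  show 1: "generate G S \<subseteq> B" using assms abelian_subD(1) generate_subgroup_incl by blast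
  show 2: "subgroup (generate G S) G"
    using assms abelian_subD(2) by (intro generate_is_subgroup) blast
  show "abelian_sub G (generate G S)" using abelian_sub_subset[OF assms(1) 2 1] .
qed

lemma abelian_pow_distrib:
  assumes "abelian_sub G B" "x \<in> B" "y \<in> B"
  shows "(x \<otimes> y) [^] (n::nat) = x [^] n \<otimes> y [^] n" "(x \<otimes> y) [^] (k::int) = x [^] k \<otimes> y [^] k"
  using assms abelian_subD[OF assms(1)] by (auto intro!: pow_mult_distrib int_pow_mult_distrib)

lemma mult_middle4:
  assumes "abelian_sub G B" "a \<in> B" "b \<in> B" "c \<in> B" "d \<in> B"
  shows "(a \<otimes> b) \<otimes> (c \<otimes> d) = (a \<otimes> c) \<otimes> (b \<otimes> d)"
proof -
  note D = abelian_subD[OF assms(1)]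
  have "(a \<otimes> b) \<otimes> (c \<otimes> d) = a \<otimes> ((b \<otimes> c) \<otimes> d)" using assms D(2) by (simp add: m_assoc)
  also have "b \<otimes> c = c \<otimes> b" using assms D(3) by blast
  finally show ?thesis using assms D(2) by (simp add: m_assoc)
qed

text \<open>The normal form behind the inductions over a finite generating set: adding a generator
  \<open>s\<close> adds one integer exponent.\<close>

lemma generate_insert_abelian:
  assumes B: "abelian_sub G B" and s: "s \<in> B" and S: "S \<subseteq> B"
  shows "generate G (insert s S) = {s [^] (k::int) \<otimes> y | k y. y \<in> generate G S}" (is "_ = ?R")
proof
  note D = abelian_subD[OF B]
  interpret B: subgroup B G by (rule D(1))
  have V: "generate G S \<subseteq> B" "subgroup (generate G S) G" using abelian_sub_generate[OF B S] by auto
  interpret V: subgroup "generate G S" G by (rule V(2))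
  have sk: "s [^] (k::int) \<in> B" for k by (rule subgroup_int_pow_closed[OF D(1) s])
  have sub: "subgroup ?R G"
  proof (rule subgroupI)
    show "?R \<subseteq> carrier G" using s D(2) by auto
    show "?R \<noteq> {}" using V.one_closed by blast
    fix a assume "a \<in> ?R"
    then obtain k :: int and y where a: "a = s [^] k \<otimes> y" "y \<in> generate G S" by blast
    have "inv a = s [^] (-k) \<otimes> inv y"
      using a V(1) s D(2,3) sk by (simp add: subset_iff inv_mult_group int_pow_neg)
    then show "inv a \<in> ?R" using a V.m_inv_closed by blast
    fix b assume "b \<in> ?R"
    then obtain l :: int and z where b: "b = s [^] l \<otimes> z" "z \<in> generate G S" by blast
    have "a \<otimes> b = (s [^] k \<otimes> s [^] l) \<otimes> (y \<otimes> z)"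
      unfolding a b using mult_middle4[OF B sk _ sk] a b V(1) by blast
    also have "\<dots> = s [^] (k + l) \<otimes> (y \<otimes> z)" using s D(2) by (simp add: int_pow_mult)
    finally show "a \<otimes> b \<in> ?R" using a b V.m_closed by blast
  qed
  have "s = s [^] (1::int) \<otimes> \<one>" using s D(2) by simp
  then have "s \<in> ?R" using V.one_closed by blast
  moreover have "y \<in> ?R" if "y \<in> S" for y
  proof -
    have "y = s [^] (0::int) \<otimes> y" using that S D(2) by auto
    then show ?thesis using generate.incl[OF that, of G] by blast
  qed
  ultimately show "generate G (insert s S) \<subseteq> ?R" using generate_subgroup_incl[OF _ sub] by blast
  have W: "subgroup (generate G (insert s S)) G" using abelian_sub_generate[OF B] s S by simp
  have "s \<in> generate G (insert s S)" by (simp add: generate.incl)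
  then have "s [^] (k::int) \<in> generate G (insert s S)" for k by (rule subgroup_int_pow_closed[OF W])
  moreover have "generate G S \<subseteq> generate G (insert s S)" by (rule mono_generate) auto
  ultimately show "?R \<subseteq> generate G (insert s S)" using subgroup.m_closed[OF W] by blast
qed

text \<open>Induction over the generators. The exponents with which \<open>s\<close> occurs in
  elements of \<open>H\<close> form a subgroup of the integers. If it is nonzero, an element
  \<open>h\<close> with the least positive exponent, together with generators of
  \<open>H \<inter> generate G S\<close>, generates \<open>H\<close>; otherwise \<open>H\<close>
  lies in \<open>generate G S\<close>.\<close>

lemma finitely_generated_abelian_subgroup:
  assumes B: "abelian_sub G B" and "finite S" "S \<subseteq> B" "subgroup H G" "H \<subseteq> generate G S"
  shows "finitely_generated_in G H"
  using assms(2-)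
proof (induction S arbitrary: H rule: finite_induct)
  case empty
  then have "H = {\<one>}" using generate_empty subgroup.one_closed by blast
  then show ?case unfolding finitely_generated_in_def 
    by (intro exI[of _ "{}"]) (simp add: generate_empty)
next
  case (insert s S)
  note D = abelian_subD[OF B]
  have s: "s \<in> B" and S: "S \<subseteq> B" using insert.prems by auto
  note gi = generate_insert_abelian[OF B s S]
  have V: "generate G S \<subseteq> B" "subgroup (generate G S) G" using abelian_sub_generate[OF B S] by auto
  interpret V: subgroup "generate G S" G by (rule V(2))
  interpret H: subgroup H G by (rule insert.prems)
  have HX: "H \<subseteq> B" using insert.prems abelian_sub_generate[OF B, of "insert s S"] by blast
  have sub: "subgroup (H \<inter> generate G S) G" using insert.prems V by (simp add: subgroups_Inter_pair)
  from insert.IH[OF S this] obtain T where T: "finite T" "T \<subseteq> carrier G" "generate G T = H \<inter> generate G S"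
    unfolding finitely_generated_in_def by auto
  have TH: "T \<subseteq> H" using T(3) generate.incl[of _ T G] by blast
  show ?case
  proof (cases "\<exists>d::nat. d > 0 \<and> (\<exists>y \<in> generate G S. s [^] d \<otimes> y \<in> H)")
    case True
    define d where "d = (LEAST d::nat. d > 0 \<and> (\<exists>y \<in> generate G S. s [^] d \<otimes> y \<in> H))"
    from LeastI_ex[OF True] obtain y where d: "d > 0" "y \<in> generate G S" "s [^] d \<otimes> y \<in> H"
      unfolding d_def[symmetric] by blast
    define h where "h = s [^] d \<otimes> y"
    have min: "\<not> (\<exists>y \<in> generate G S. s [^] e \<otimes> y \<in> H)" if "0 < e" "e < d" for e :: nat
      using not_less_Least[of e "\<lambda>d. d > 0 \<and> (\<exists>y \<in> generate G S. s [^] d \<otimes> y \<in> H)"] that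
      unfolding d_def[symmetric] by blast
    have hH: "h \<in> H" using d unfolding h_def by simp
    have gen: "subgroup (generate G (insert h T)) G" 
      using hH T TH by (intro generate_is_subgroup) auto
    have "H \<subseteq> generate G (insert h T)"
    proof
      fix x assume x: "x \<in> H"
      then obtain k :: int and z where z: "x = s [^] k \<otimes> z" "z \<in> generate G S"
        using insert.prems gi by blast
      \<comment> \<open>Dividing the exponent by \<open>d\<close> leaves a remainder smaller than
        \<open>d\<close>. It vanishes by minimality, so \<open>x \<otimes> h [^] (-q)\<close> has no
        \<open>s\<close>-part left.\<close>
      define q r where "q = k div int d" and "r = k mod int d"
      have k: "k = int d * q + r" "0 \<le> r" "r < int d" unfolding q_def r_def using d by auto
      have hq: "h [^] (-q) \<in> H" by (rule subgroup_int_pow_closed[OF insert.prems(2) hH])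
      have sd: "s [^] d \<in> B" by (rule subgroup_nat_pow_closed[OF D(1) s])
      have yq: "y [^] (-q) \<in> generate G S" by (rule subgroup_int_pow_closed[OF V(2) d(2)])
      have "h [^] (-q) = (s [^] d) [^] (-q) \<otimes> y [^] (-q)"
        unfolding h_def using abelian_pow_distrib[OF B sd] d V(1) by blast
      also have "(s [^] d) [^] (-q) = s [^] (- (int d * q))"
        using s D(2) by (simp add: int_pow_pow flip: int_pow_int)
      finally have "x \<otimes> h [^] (-q) = (s [^] k \<otimes> z) \<otimes> (s [^] (- (int d * q)) \<otimes> y [^] (-q))"
        using z by simp
      also have "\<dots> = (s [^] k \<otimes> s [^] (- (int d * q))) \<otimes> (z \<otimes> y [^] (-q))"
        using z yq V(1) subgroup_int_pow_closed[OF D(1) s] by (intro mult_middle4[OF B]) auto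
      also have "s [^] k \<otimes> s [^] (- (int d * q)) = s [^] r"
        using s D(2) k by (simp flip: int_pow_mult)
      also have "s [^] r = s [^] (nat r)" using k int_pow_int[of G s "nat r"] by simp
      finally have e: "x \<otimes> h [^] (-q) = s [^] (nat r) \<otimes> (z \<otimes> y [^] (-q))" .
      have zy: "z \<otimes> y [^] (-q) \<in> generate G S" using z yq by simp
      have "x \<otimes> h [^] (-q) \<in> H" using x hq by simp
      with e zy have "\<exists>y \<in> generate G S. s [^] (nat r) \<otimes> y \<in> H" by metis
      with min[of "nat r"] k have "nat r = 0" by linarith
      with e zy have "x \<otimes> h [^] (-q) = z \<otimes> y [^] (-q)" using V.mem_carrier by simp
      with \<open>x \<otimes> h [^] (-q) \<in> H\<close> zy have "x \<otimes> h [^] (-q) \<in> generate G T" using T by simp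
      then have 1: "x \<otimes> h [^] (-q) \<in> generate G (insert h T)" using mono_generate[of T "insert h T"] by auto
      have 2: "h [^] q \<in> generate G (insert h T)"
        by (rule subgroup_int_pow_closed[OF gen]) (simp add: generate.incl)
      have "x = (x \<otimes> h [^] (-q)) \<otimes> h [^] q" using x hH by (simp add: m_assoc flip: int_pow_mult)
      then show "x \<in> generate G (insert h T)" using subgroup.m_closed[OF gen 1 2] by simp
    qed
    moreover have "generate G (insert h T) \<subseteq> H" using hH TH by (intro generate_subgroup_incl insert.prems) auto
    ultimately show ?thesis unfolding finitely_generated_in_def 
      by (intro exI[of _ "insert h T"]) (use T hH in auto)
  next
    case False
    have "H \<subseteq> generate G S"
    proof
      fix x assume x: "x \<in> H"
      then obtain k :: int and z where z: "x = s [^] k \<otimes> z" "z \<in> generate G S"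
        using insert.prems gi by blast
      have "k \<le> 0"
      proof (rule ccontr)
        assume "\<not> k \<le> 0"
        then have "nat k > 0" "s [^] k = s [^] nat k" using int_pow_int[of G s "nat k"] by auto
        then show False using False z x by metis
      qed
      \<comment> \<open>The case assumption speaks of positive exponents; a negative one becomes
        positive in \<open>inv x\<close>.\<close>
      moreover have "k \<ge> 0"
      proof (rule ccontr)
        assume k: "\<not> k \<ge> 0"
        have "inv x = s [^] (-k) \<otimes> inv z"
          using z V(1) s D(2,3) subgroup_int_pow_closed[OF D(1) s] by (simp add: subset_iff inv_mult_group int_pow_neg)
        moreover have "s [^] (-k) = s [^] nat (-k)" using k int_pow_int[of G s "nat (-k)"] by auto
        moreover have "inv x \<in> H" "inv z \<in> generate G S" "nat (-k) > 0" using x z k by auto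
        ultimately show False using False by metis
      qed
      ultimately show "x \<in> generate G S" using z V.mem_carrier by simp
    qed
    then show ?thesis using T unfolding finitely_generated_in_def by blast
  qed
qed

text \<open>If \<open>s\<^sup>k\<close> already lies in the domain of \<open>p\<close>, then \<open>x \<mapsto> p (x\<^sup>k)\<close> extends \<open>p\<close>, up to a power,
  to the subgroup generated by the domain and \<open>s\<close>.\<close>

lemma abelian_power_retraction:
  assumes B: "abelian_sub G B" and U: "subgroup U G" "U \<subseteq> B" and "finite S" "S \<subseteq> B"
  shows "\<exists>p m. m > (0::nat) \<and> (\<forall>u\<in>U. p u = u [^] m) \<and> 
    (\<forall>x\<in>generate G (U \<union> S). p x \<in> U \<and> (\<forall>y\<in>generate G (U \<union> S). p (x \<otimes> y) = p x \<otimes> p y))"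
  using assms(4,5)
proof (induction S rule: finite_induct)
  case empty
  have "generate G (U \<union> {}) = U" using subgroup_generate_self[OF U(1)] by simp
  then show ?case using subgroup.m_closed[OF U(1)] subgroup.mem_carrier[OF U(1)]
    by (intro exI[of _ "\<lambda>x. x"] exI[of _ 1]) auto
next
  case (insert s S)
  note D = abelian_subD[OF B]
  have s: "s \<in> B" and S: "S \<subseteq> B" using insert.prems by auto
  define V where "V = generate G (U \<union> S)"
  have V: "V \<subseteq> B" "subgroup V G" using abelian_sub_generate[OF B, of "U \<union> S"] S U unfolding V_def by auto
  interpret V: subgroup V G by (rule V(2))
  have gi: "generate G (U \<union> insert s S) = {s [^] (k::int) \<otimes> y | k y. y \<in> V}"
    using generate_insert_abelian[OF B s, of "U \<union> S"] S U by (simp add: V_def)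
  have sk: "s [^] (k::int) \<in> B" for k by (rule subgroup_int_pow_closed[OF D(1) s])
  from insert.IH[OF S] obtain p m where p: "m > (0::nat)" "\<And>u. u \<in> U \<Longrightarrow> p u = u [^] m"
    "\<And>x. x \<in> V \<Longrightarrow> p x \<in> U" "\<And>x y. \<lbrakk>x \<in> V; y \<in> V\<rbrakk> \<Longrightarrow> p (x \<otimes> y) = p x \<otimes> p y"
    unfolding V_def[symmetric] by blast
  have UV: "U \<subseteq> V" unfolding V_def using generate.incl[of _ "U \<union> S" G] by blast
  show ?case
  proof (cases "\<exists>k::nat. k > 0 \<and> s [^] k \<in> V")
    case True
    then obtain k :: nat where k: "k > 0" "s [^] k \<in> V" by blast
    have pow: "x \<in> B \<and> x [^] k \<in> V" if x: "x \<in> generate G (U \<union> insert s S)" for x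
    proof -
      obtain j :: int and y where y: "x = s [^] j \<otimes> y" "y \<in> V" using x gi by blast
      have "x [^] k = (s [^] j) [^] k \<otimes> y [^] k"
        unfolding y(1) using abelian_pow_distrib(1)[OF B sk] y V(1) by blast
      also have "(s [^] j) [^] k = (s [^] k) [^] j"
        using s D(2) int_pow_pow[of s j "int k"] int_pow_pow[of s "int k" j]
        by (simp add: int_pow_int mult.commute)
      finally have "x [^] k = (s [^] k) [^] j \<otimes> y [^] k" .
      moreover have "(s [^] k) [^] j \<in> V" by (rule subgroup_int_pow_closed[OF V(2) k(2)])
      moreover have "y [^] k \<in> V" by (rule subgroup_nat_pow_closed[OF V(2) y(2)])
      ultimately show ?thesis using y V(1) sk subgroup.m_closed[OF D(1)] by auto
    qed
    show ?thesis
    proof (intro exI[of _ "\<lambda>x. p (x [^] k)"] exI[of _ "k * m"] conjI ballI)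
      show "0 < k * m" using p k by simp
      show "p (u [^] k) = u [^] (k * m)" if "u \<in> U" for u
        using p(2)[OF subgroup_nat_pow_closed[OF U(1) that]] that U D(2) by (auto simp: nat_pow_pow)
      show "p (x [^] k) \<in> U" if "x \<in> generate G (U \<union> insert s S)" for x
        using pow[OF that] p(3) by simp
      show "p ((x \<otimes> y) [^] k) = p (x [^] k) \<otimes> p (y [^] k)" 
        if "x \<in> generate G (U \<union> insert s S)" "y \<in> generate G (U \<union> insert s S)" for x y
        using pow[OF that(1)] pow[OF that(2)] abelian_pow_distrib(1)[OF B, of x y k] p(4) by simp
    qed
  next
    case False
    \<comment> \<open>Here the product of the powers of \<open>s\<close> with \<open>V\<close> is
      direct: an equality of two such products gives a power of \<open>s\<close> in
      \<open>V\<close>, hence equal exponents. The extension may therefore ignore \<open>s\<close>,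
      composing \<open>p\<close> with the projection \<open>c\<close> to \<open>V\<close>.\<close>
    have uniq: "y = y'" if "s [^] (j::int) \<otimes> y = s [^] j' \<otimes> y'" "y \<in> V" "y' \<in> V" for j j' :: int and y y'
    proof -
      have c: "y \<in> carrier G" "y' \<in> carrier G" "s \<in> carrier G" using that s D(2) by auto
      have "s [^] (j - j') = s [^] (-j') \<otimes> (s [^] j \<otimes> y) \<otimes> inv y"
        using c by (simp add: m_assoc flip: int_pow_mult)
      also have "\<dots> = y' \<otimes> inv y" unfolding that(1) using c
        by (simp add: m_assoc int_pow_neg)
      finally have e: "s [^] (j - j') = y' \<otimes> inv y" .
      then have 1: "s [^] (j - j') \<in> V" using that by simp
      then have "inv (s [^] (j - j')) \<in> V" by simp
      then have 2: "s [^] (j' - j) \<in> V" using c int_pow_neg[of s "j - j'"] by simp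
      have "j - j' \<le> 0"
      proof (rule ccontr)
        assume "\<not> j - j' \<le> 0"
        then have "nat (j-j') > 0" "s [^] (j - j') = s [^] nat (j-j')" using int_pow_int[of G s "nat (j-j')"] by auto
        then show False using False 1 by metis
      qed
      moreover have "j' - j \<le> 0"
      proof (rule ccontr)
        assume "\<not> j' - j \<le> 0"
        then have "nat (j'-j) > 0" "s [^] (j' - j) = s [^] nat (j'-j)" using int_pow_int[of G s "nat (j'-j)"] by auto
        then show False using False 2 by metis
      qed
      ultimately have "j = j'" by simp
      then show "y = y'" using that(1) c by simp
    qed
    define c where "c x = (THE y. y \<in> V \<and> (\<exists>j::int. x = s [^] j \<otimes> y))" for x
    have c: "c (s [^] j \<otimes> y) = y" if "y \<in> V" for j :: int and y
      unfolding c_def by (rule the_equality) (use that uniq in blast)+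
    show ?thesis
    proof (intro exI[of _ "\<lambda>x. p (c x)"] exI[of _ m] conjI ballI)
      show "0 < m" using p by simp
      show "p (c u) = u [^] m" if "u \<in> U" for u
        using c[of u 0] p(2) that UV by auto
      show "p (c x) \<in> U" if "x \<in> generate G (U \<union> insert s S)" for x
        using that gi c p(3) by auto
      show "p (c (x \<otimes> x')) = p (c x) \<otimes> p (c x')" 
        if x: "x \<in> generate G (U \<union> insert s S)" and x': "x' \<in> generate G (U \<union> insert s S)" for x x'
      proof -
        obtain j :: int and y where y: "x = s [^] j \<otimes> y" "y \<in> V" using x gi by blast
        obtain j' :: int and y' where y': "x' = s [^] j' \<otimes> y'" "y' \<in> V" using x' gi by blast
        have "x \<otimes> x' = (s [^] j \<otimes> s [^] j') \<otimes> (y \<otimes> y')"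
          unfolding y y' using mult_middle4[OF B sk _ sk] y y' V(1) by blast
        also have "\<dots> = s [^] (j + j') \<otimes> (y \<otimes> y')" using s D(2) by (simp add: int_pow_mult)
        finally show ?thesis using y y' c p(4) by simp
      qed
    qed
  qed
qed

lemma subgroup_powers:
  assumes B: "abelian_sub G B"
  shows "subgroup ((\<lambda>x. x [^] (r::nat)) ` B) G"
proof (rule subgroupI)
  note D = abelian_subD[OF B]
  show "(\<lambda>x. x [^] r) ` B \<subseteq> carrier G" using D by auto
  show "(\<lambda>x. x [^] r) ` B \<noteq> {}" using subgroup.one_closed[OF D(1)] by blast
  fix a assume "a \<in> (\<lambda>x. x [^] r) ` B"
  then obtain x where x: "a = x [^] r" "x \<in> B" by blast
  then have "inv a = (inv x) [^] r" using D(2) by (auto simp: nat_pow_inv)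
  then show "inv a \<in> (\<lambda>x. x [^] r) ` B" using x subgroup.m_inv_closed[OF D(1)] by blast
  fix b assume "b \<in> (\<lambda>x. x [^] r) ` B"
  then obtain y where y: "b = y [^] r" "y \<in> B" by blast
  have "a \<otimes> b = (x \<otimes> y) [^] r" 
    using abelian_pow_distrib(1)[OF B x(2) y(2)] x y by simp
  then show "a \<otimes> b \<in> (\<lambda>x. x [^] r) ` B" using x y subgroup.m_closed[OF D(1)] by blast
qed

text \<open>Representatives modulo \<open>r\<close>-th powers are the products of
  \<open>s [^] i\<close> with \<open>i < r\<close> and the representatives found for the remaining
  generators.\<close>

lemma fin_cover_powers:
  assumes B: "abelian_sub G B" and r: "r > (0::nat)" and "finite S" "S \<subseteq> B"
  shows "fin_cover G ((\<lambda>x. x [^] r) ` generate G S) (generate G S)"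
  using assms(3,4)
proof (induction S rule: finite_induct)
  case empty
  then show ?case unfolding fin_cover_def
    by (intro exI[of _ "{\<one>}"]) (auto simp: generate_empty set_mult_def)
next
  case (insert s S)
  note D = abelian_subD[OF B]
  have s: "s \<in> B" and S: "S \<subseteq> B" using insert.prems by auto
  note gi = generate_insert_abelian[OF B s S]
  have V: "generate G S \<subseteq> B" "subgroup (generate G S) G" using abelian_sub_generate[OF B S] by auto
  have sk: "s [^] (k::int) \<in> B" for k by (rule subgroup_int_pow_closed[OF D(1) s])
  obtain T where T: "finite T" "T \<subseteq> generate G S" "generate G S \<subseteq> (\<lambda>x. x [^] r) ` generate G S <#> T"
  proof -
    have "subgroup ((\<lambda>x. x [^] r) ` generate G S) G"
      using subgroup_powers[OF abelian_sub_generate(3)[OF B S]] .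
    from fin_coverE[OF insert.IH[OF S] this subgroup.subset[OF V(2)]] that show thesis by blast
  qed
  define T' where "T' = (\<lambda>(i::nat, t). s [^] i \<otimes> t) ` ({..<r} \<times> T)"
  have "generate G (insert s S) \<subseteq> (\<lambda>x. x [^] r) ` generate G (insert s S) <#> T'"
  proof
    fix x assume "x \<in> generate G (insert s S)"
    then obtain k :: int and y where y: "x = s [^] k \<otimes> y" "y \<in> generate G S" using gi by blast
    then obtain z t where z: "z \<in> generate G S" "t \<in> T" "y = z [^] r \<otimes> t"
      using T(3) unfolding set_mult_def by blast
    define q i where "q = k div int r" and "i = nat (k mod int r)"
    have k: "k = q * int r + int i" "i < r" unfolding q_def i_def using r by (auto simp: nat_less_iff)
    have c: "s \<in> carrier G" "z \<in> carrier G" "t \<in> carrier G" "z \<in> B" "t \<in> B" using s z T(2) V(1) D(2) by auto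
    have zr: "z [^] r \<in> B" "s [^] i \<in> B" using c s by (auto intro!: subgroup_nat_pow_closed[OF D(1)])
    have "x = s [^] k \<otimes> (z [^] r \<otimes> t)" using y z by simp
    also have "s [^] k = s [^] (q * int r) \<otimes> s [^] i"
      using c unfolding k(1) by (simp add: int_pow_mult flip: int_pow_int)
    also have "s [^] (q * int r) = (s [^] q) [^] r" 
      using c by (simp add: int_pow_pow flip: int_pow_int)
    also have "((s [^] q) [^] r \<otimes> s [^] i) \<otimes> (z [^] r \<otimes> t) = ((s [^] q) [^] r \<otimes> z [^] r) \<otimes> (s [^] i \<otimes> t)"
      using c zr sk by (intro mult_middle4[OF B]) (auto intro!: subgroup_nat_pow_closed[OF D(1)])
    also have "(s [^] q) [^] r \<otimes> z [^] r = (s [^] q \<otimes> z) [^] r" 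
      using abelian_pow_distrib(1)[OF B sk c(4)] by simp
    finally have "x = (s [^] q \<otimes> z) [^] r \<otimes> (s [^] i \<otimes> t)" .
    moreover have "s [^] q \<otimes> z \<in> generate G (insert s S)" unfolding gi using z by blast
    moreover have "s [^] i \<otimes> t \<in> T'" unfolding T'_def using z k by auto
    ultimately show "x \<in> (\<lambda>x. x [^] r) ` generate G (insert s S) <#> T'"
      unfolding set_mult_def by blast
  qed
  moreover have "finite T'" unfolding T'_def using T by simp
  moreover have "T' \<subseteq> carrier G" unfolding T'_def using T V s D by auto
  ultimately show ?case unfolding fin_cover_def by blast
qed

end

section \<open>Torsion, finite generation and the avoidance of finite sets by powers\<close>

context group
begin

text \<open>The torsion subgroup \<open>R\<close> is finitely generated like every subgroup of
  \<open>B\<close>, so the product of the exponents of its finitely many generators annihilates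
  it.\<close>

lemma abelian_torsion_exponent:
  assumes B: "abelian_sub G B" and fg: "finitely_generated_in G B"
  obtains e :: nat where "e > 0" "\<And>x n. \<lbrakk>x \<in> B; n > (0::nat); x [^] n = \<one>\<rbrakk> \<Longrightarrow> x [^] e = \<one>"
proof -
  note D = abelian_subD[OF B]
  define R where "R = {x \<in> B. \<exists>n::nat. n > 0 \<and> x [^] n = \<one>}"
  obtain S where S: "finite S" "S \<subseteq> carrier G" "generate G S = B" 
    using fg unfolding finitely_generated_in_def by blast
  have SB: "S \<subseteq> B" using S(3) generate.incl[of _ S G] by blast
  have R: "subgroup R G"
  proof (rule subgroupI)
    show "R \<subseteq> carrier G" using D unfolding R_def by auto
    have "\<one> \<in> R" unfolding R_def using subgroup.one_closed[OF D(1)] by (auto intro: exI[of _ 1])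
    then show "R \<noteq> {}" by blast
    fix a assume "a \<in> R"
    then obtain n :: nat where a: "a \<in> B" "n > 0" "a [^] n = \<one>" unfolding R_def by blast
    have "(inv a) [^] n = \<one>" using a D(2) by (simp add: nat_pow_inv)
    then show "inv a \<in> R" unfolding R_def using a subgroup.m_inv_closed[OF D(1)] by blast
    fix b assume "b \<in> R"
    then obtain m :: nat where b: "b \<in> B" "m > 0" "b [^] m = \<one>" unfolding R_def by blast
    have "a [^] (n * m) = (a [^] n) [^] m" "b [^] (n * m) = (b [^] m) [^] n"
      using nat_pow_pow[OF D(2)[OF a(1)], of n m] nat_pow_pow[OF D(2)[OF b(1)], of m n] 
      by (simp_all add: mult.commute)
    then have "(a \<otimes> b) [^] (n * m) = (a [^] n) [^] m \<otimes> (b [^] m) [^] n"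
      using abelian_pow_distrib(1)[OF B a(1) b(1)] by metis
    also have "\<dots> = \<one>" using a b by simp
    finally have "(a \<otimes> b) [^] (n * m) = \<one>" .
    moreover have "n * m > 0" using a b by simp
    ultimately show "a \<otimes> b \<in> R" unfolding R_def using subgroup.m_closed[OF D(1) a(1) b(1)] by blast
  qed
  have "R \<subseteq> generate G S" using S(3) unfolding R_def by blast
  from finitely_generated_abelian_subgroup[OF B S(1) SB R this]
  obtain Q where Q: "finite Q" "Q \<subseteq> carrier G" "generate G Q = R" 
    unfolding finitely_generated_in_def by blast
  have QR: "Q \<subseteq> R" using Q(3) generate.incl[of _ Q G] by blast
  have "\<exists>n::nat. n > 0 \<and> x [^] n = \<one>" if "x \<in> Q" for x using that QR unfolding R_def by blast
  then obtain f :: "'a \<Rightarrow> nat" where f: "\<And>x. x \<in> Q \<Longrightarrow> f x > 0 \<and> x [^] f x = \<one>" by metis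
  define e where "e = (\<Prod>x\<in>Q. f x)"
  have e: "e > 0" unfolding e_def using f Q(1) by (simp add: prod_pos)
  define E where "E = {x \<in> B. x [^] e = \<one>}"
  have E: "subgroup E G"
  proof (rule subgroupI)
    show "E \<subseteq> carrier G" using D unfolding E_def by auto
    have "\<one> \<in> E" unfolding E_def using subgroup.one_closed[OF D(1)] by simp
    then show "E \<noteq> {}" by blast
    show "inv a \<in> E" if "a \<in> E" for a
      using that subgroup.m_inv_closed[OF D(1)] D(2) unfolding E_def by (simp add: nat_pow_inv)
    show "a \<otimes> b \<in> E" if "a \<in> E" "b \<in> E" for a b
      using that subgroup.m_closed[OF D(1)] abelian_pow_distrib(1)[OF B] unfolding E_def by simp
  qed
  have "Q \<subseteq> E"
  proof
    fix x assume x: "x \<in> Q"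
    have "e = f x * (\<Prod>x\<in>Q-{x}. f x)" unfolding e_def using x Q(1) by (simp add: prod.remove)
    then have "x [^] e = (x [^] f x) [^] (\<Prod>x\<in>Q-{x}. f x)" using x Q(2) by (simp add: nat_pow_pow subset_iff)
    then show "x \<in> E" using f[OF x] x QR unfolding E_def R_def by auto
  qed
  then have "R \<subseteq> E" using generate_subgroup_incl[OF _ E] Q(3) by blast
  then have "x [^] e = \<one>" if "x \<in> B" "n > (0::nat)" "x [^] n = \<one>" for x n
    using that unfolding R_def E_def by blast
  with e that show thesis by blast
qed

text \<open>The set of \<open>g\<close> that map all of \<open>Q\<close> into \<open>Q\<close> by
  right multiplication is closed under products, while \<open>Q\<close> itself need not be. Hence
  the induction proves the claim for all \<open>q\<close> at once.\<close>

lemma generate_right_induct: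
  assumes S: "S \<subseteq> carrier G" and Q: "Q \<subseteq> carrier G" "\<one> \<in> Q"
    and step: "\<And>q s. \<lbrakk>q \<in> Q; s \<in> S\<rbrakk> \<Longrightarrow> q \<otimes> s \<in> Q \<and> q \<otimes> inv s \<in> Q"
  shows "generate G S \<subseteq> Q"
proof
  fix g assume g: "g \<in> generate G S"
  then have "\<forall>q\<in>Q. q \<otimes> g \<in> Q"
  proof (induction rule: generate.induct)
    case one
    then show ?case using Q by auto
  next
    case (eng h1 h2)
    then have "h1 \<in> carrier G" "h2 \<in> carrier G" using generate_in_carrier[OF S] by auto
    with eng Q(1) show ?case by (metis m_assoc subsetD)
  qed (use step in auto)
  with Q generate_in_carrier[OF S g] show "g \<in> Q" by force
qed

text \<open>Schreier's argument: the elements \<open>t s u\<inverse>\<close> of \<open>K\<close>, for \<open>t\<close> and \<open>u\<close> in a transversal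
  and \<open>s\<close> a generator or its inverse, generate \<open>K\<close> up to transversal elements.\<close>

lemma finitely_generated_finite_index_subgroup:
  assumes P: "subgroup P G" "finitely_generated_in G P" and K: "subgroup K G" "K \<subseteq> P" "fin_cover G K P"
  shows "finitely_generated_in G K"
proof -
  interpret P: subgroup P G by fact
  interpret K: subgroup K G by fact
  obtain S where S: "finite S" "S \<subseteq> carrier G" "generate G S = P" 
    using P unfolding finitely_generated_in_def by blast
  have SP: "S \<subseteq> P" using S(3) generate.incl[of _ S G] by blast
  obtain T0 where T0: "finite T0" "T0 \<subseteq> P" "P \<subseteq> K <#> T0" using fin_coverE[OF K(3,1) P.subset] .
  \<comment> \<open>With \<open>\<one>\<close> in \<open>T\<close> the right multiplications by
    generators can start inside \<open>L <#> T\<close>.\<close>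
  define T where "T = insert \<one> T0"
  have T: "finite T" "T \<subseteq> P" "P \<subseteq> K <#> T" 
    using T0 order.trans[OF T0(3) mono_set_mult[OF subset_refl, of T0 T]] unfolding T_def by auto
  define S' where "S' = S \<union> m_inv G ` S"
  have S': "finite S'" "S' \<subseteq> P" using S(1) SP unfolding S'_def by auto
  \<comment> \<open>\<open>T \<inter> K\<close> belongs to the generators because writing
    \<open>k\<close> as \<open>l \<otimes> t\<close> leaves a \<open>t\<close> that lies in
    \<open>K\<close> but may differ from \<open>\<one>\<close>.\<close>
  define W where "W = ((\<lambda>(t, s, u). t \<otimes> s \<otimes> inv u) ` (T \<times> S' \<times> T) \<union> T) \<inter> K"
  have W: "finite W" "W \<subseteq> K" using T S' unfolding W_def by auto
  have Wc: "W \<subseteq> carrier G" using W(2) K.subset by blast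
  define L where "L = generate G W"
  have L: "L \<subseteq> K" "subgroup L G" unfolding L_def
    using generate_subgroup_incl[OF W(2) K(1)] generate_is_subgroup[OF Wc] by auto
  interpret L: subgroup L G by (rule L(2))
  have Tc: "t \<in> carrier G" if "t \<in> T" for t using that T P.subset by blast
  have step: "q \<otimes> s \<in> L <#> T" if q: "q \<in> L <#> T" and s: "s \<in> S'" for q s
  proof -
    obtain l t where lt: "l \<in> L" "t \<in> T" "q = l \<otimes> t" using q unfolding set_mult_def by blast
    have sP: "s \<in> P" using s S' by blast
    have "t \<otimes> s \<in> P" using lt sP T by blast
    then obtain k u where ku: "k \<in> K" "u \<in> T" "t \<otimes> s = k \<otimes> u" using T(3) unfolding set_mult_def by blast
    have "k = t \<otimes> s \<otimes> inv u" using ku lt Tc by (simp add: m_assoc)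
    then have "k \<in> W" using ku lt s unfolding W_def by force
    then have "k \<in> L" unfolding L_def by (rule generate.incl)
    moreover have "q \<otimes> s = (l \<otimes> k) \<otimes> u"
      using lt ku Tc sP by (simp add: m_assoc)
    ultimately show ?thesis using lt ku unfolding set_mult_def by blast
  qed
  have "generate G S \<subseteq> L <#> T"
  proof (rule generate_right_induct[OF S(2)])
    show "L <#> T \<subseteq> carrier G" using Tc by (auto simp: set_mult_def)
    have "\<one> = \<one> \<otimes> \<one>" by simp
    then show "\<one> \<in> L <#> T" unfolding set_mult_def T_def using L.one_closed by blast
    show "q \<otimes> s \<in> L <#> T \<and> q \<otimes> inv s \<in> L <#> T" if "q \<in> L <#> T" "s \<in> S" for q s
      using step[OF that(1)] that(2) unfolding S'_def by blast
  qed
  have "K \<subseteq> L"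
  proof
    fix k assume k: "k \<in> K"
    then have "k \<in> L <#> T" using \<open>generate G S \<subseteq> L <#> T\<close> S(3) K(2) by blast
    then obtain l t where lt: "l \<in> L" "t \<in> T" "k = l \<otimes> t" unfolding set_mult_def by blast
    then have "t = inv l \<otimes> k" using Tc by simp
    moreover have "l \<in> K" using L lt by blast
    ultimately have "t \<in> K" using k by simp
    then have "t \<in> W" using lt unfolding W_def by blast
    then have "t \<in> L" unfolding L_def by (rule generate.incl)
    then show "k \<in> L" using lt by simp
  qed
  then have "generate G W = K" using L(1) unfolding L_def by blast
  then show ?thesis unfolding finitely_generated_in_def using W Wc by blast
qed

lemma finitely_generated_finite_extension:
  assumes P: "subgroup P G" and K: "subgroup K G" "K \<subseteq> P" "fin_cover G K P" "finitely_generated_in G K"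
  shows "finitely_generated_in G P"
proof -
  obtain S where S: "finite S" "S \<subseteq> carrier G" "generate G S = K" 
    using K unfolding finitely_generated_in_def by blast
  have SK: "S \<subseteq> K" using S(3) generate.incl[of _ S G] by blast
  obtain T where T: "finite T" "T \<subseteq> P" "P \<subseteq> K <#> T" 
    using fin_coverE[OF K(3,1) subgroup.subset[OF P]] .
  have ST: "S \<union> T \<subseteq> carrier G" using S T subgroup.subset[OF P] by blast
  have "P \<subseteq> generate G (S \<union> T)"
  proof
    fix x assume "x \<in> P"
    then obtain k t where kt: "k \<in> K" "t \<in> T" "x = k \<otimes> t" using T(3) unfolding set_mult_def by blast
    have "k \<in> generate G (S \<union> T)" using kt S(3) mono_generate[of S "S \<union> T"] by blast
    moreover have "t \<in> generate G (S \<union> T)" using kt by (simp add: generate.incl)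
    ultimately show "x \<in> generate G (S \<union> T)" using kt by (simp add: generate.eng)
  qed
  moreover have "generate G (S \<union> T) \<subseteq> P" using SK K(2) T P by (intro generate_subgroup_incl) auto
  ultimately show ?thesis unfolding finitely_generated_in_def using S T ST 
    by (intro exI[of _ "S \<union> T"]) auto
qed

lemma virtually_abelianE:
  assumes "virtually_abelian G"
  obtains B where "abelian_sub G B" "fin_cover G B (carrier G)"
proof -
  obtain B where B: "finite_index G B" "comm_group (G\<lparr>carrier := B\<rparr>)"
    using assms unfolding virtually_abelian_def by blast
  interpret B: comm_group "G\<lparr>carrier := B\<rparr>" by fact
  show thesis
    by (rule that[of B]) (use B finite_index_iff B.m_comm in \<open>auto simp: abelian_sub_def\<close>)
qed

text \<open>Finitely generated virtually abelian groups are Noetherian: \<open>B\<close> is finitely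
  generated by Schreier's argument, its subgroup \<open>B \<inter> P\<close> by the abelian case,
  and \<open>P\<close> is a finite extension of \<open>B \<inter> P\<close>.\<close>

lemma finitely_generated_subgroup:
  assumes "finitely_generated_in G (carrier G)" "virtually_abelian G" "subgroup P G"
  shows "finitely_generated_in G P"
proof -
  obtain B where B: "abelian_sub G B" "fin_cover G B (carrier G)" using virtually_abelianE[OF assms(2)] .
  note D = abelian_subD[OF B(1)]
  have "finitely_generated_in G B"
    using finitely_generated_finite_index_subgroup[OF subgroup_self assms(1) D(1) _ B(2)] D(2) by blast
  then obtain S where S: "finite S" "S \<subseteq> carrier G" "generate G S = B" 
    unfolding finitely_generated_in_def by blast
  have SB: "S \<subseteq> B" using S(3) generate.incl[of _ S G] by blast
  have BP: "subgroup (B \<inter> P) G" using D(1) assms(3) by (rule subgroups_Inter_pair)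
  have "finitely_generated_in G (B \<inter> P)"
    using finitely_generated_abelian_subgroup[OF B(1) S(1) SB BP] S(3) by blast
  moreover have "fin_cover G (B \<inter> P) P"
    using fin_cover_Int[OF B(2) D(1) assms(3)] subgroup.subset[OF assms(3)] by blast
  ultimately show ?thesis using finitely_generated_finite_extension[OF assms(3) BP] by blast
qed

text \<open>If \<open>e\<close> annihilates the torsion of \<open>B\<close>, then a torsion element
  \<open>y [^] e\<close> comes from a torsion element \<open>y\<close> and is trivial.\<close>

lemma torsion_free_power_image:
  assumes B: "abelian_sub G B" and fg: "finitely_generated_in G B"
  obtains e :: nat where "e > 0" "\<And>x n. \<lbrakk>x \<in> (\<lambda>x. x [^] e) ` B; n > (0::nat); x [^] n = \<one>\<rbrakk> \<Longrightarrow> x = \<one>"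
proof -
  note D = abelian_subD[OF B]
  obtain e :: nat where e: "e > 0" "\<And>x n. \<lbrakk>x \<in> B; n > (0::nat); x [^] n = \<one>\<rbrakk> \<Longrightarrow> x [^] e = \<one>"
    using abelian_torsion_exponent[OF B fg] by blast
  have "x = \<one>" if x: "x \<in> (\<lambda>x. x [^] e) ` B" "n > 0" "x [^] n = \<one>" for x and n :: nat
  proof -
    obtain y where y: "y \<in> B" "x = y [^] e" using x by blast
    then have "y [^] (e * n) = \<one>" using x D(2) by (simp add: nat_pow_pow)
    then show "x = \<one>" using e(2)[OF y(1), of "e * n"] e(1) y x by simp
  qed
  with e that show thesis by blast
qed

text \<open>The subgroup generated by all \<open>k\<close>-th powers is preferred to an arbitrary one because it is
  characteristic.\<close>

lemma torsion_free_powers: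
  assumes P: "subgroup P G" and B: "abelian_sub G B" "B \<subseteq> P" "finitely_generated_in G B" "fin_cover G B P"
  obtains k :: nat where "generate G ((\<lambda>x. x [^] k) ` P) \<subseteq> B" 
    "\<And>x n. \<lbrakk>x \<in> generate G ((\<lambda>x. x [^] k) ` P); n > (0::nat); x [^] n = \<one>\<rbrakk> \<Longrightarrow> x = \<one>"
    "fin_cover G (generate G ((\<lambda>x. x [^] k) ` P)) P"
proof -
  note D = abelian_subD[OF B(1)]
  interpret P: subgroup P G by fact
  obtain e :: nat where e: "e > 0" "\<And>x n. \<lbrakk>x \<in> (\<lambda>x. x [^] e) ` B; n > (0::nat); x [^] n = \<one>\<rbrakk> \<Longrightarrow> x = \<one>"
    using torsion_free_power_image[OF B(1,3)] by blast
  obtain n :: nat where n: "n > 0" "\<And>x. x \<in> P \<Longrightarrow> x [^] n \<in> B" using fin_cover_power[OF B(4) D(1) P] by blast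
  \<comment> \<open>The exponent is a product: \<open>n\<close> carries \<open>P\<close> into
    \<open>B\<close>, and \<open>e\<close> then removes the torsion.\<close>
  have "(\<lambda>x. x [^] (n * e)) ` P \<subseteq> (\<lambda>x. x [^] e) ` B"
  proof
    fix y assume "y \<in> (\<lambda>x. x [^] (n * e)) ` P"
    then obtain x where x: "x \<in> P" "y = x [^] (n * e)" by blast
    then have "y = (x [^] n) [^] e" by (simp add: nat_pow_pow)
    then show "y \<in> (\<lambda>x. x [^] e) ` B" using n(2)[OF x(1)] by blast
  qed
  then have 1: "generate G ((\<lambda>x. x [^] (n * e)) ` P) \<subseteq> (\<lambda>x. x [^] e) ` B"
    using generate_subgroup_incl subgroup_powers[OF B(1)] by blast
  moreover have "(\<lambda>x. x [^] e) ` B \<subseteq> B" using subgroup_nat_pow_closed[OF D(1)] by blast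
  moreover have "fin_cover G (generate G ((\<lambda>x. x [^] (n * e)) ` P)) P"
  proof -
    obtain S where S: "finite S" "S \<subseteq> carrier G" "generate G S = B" 
      using B(3) unfolding finitely_generated_in_def by blast
    have SB: "S \<subseteq> B" using S(3) generate.incl[of _ S G] by blast
    have "n * e > 0" using n e by simp
    then have "fin_cover G ((\<lambda>x. x [^] (n * e)) ` B) B"
      using fin_cover_powers[OF B(1) _ S(1) SB] S(3) by blast
    moreover have "(\<lambda>x. x [^] (n * e)) ` B \<subseteq> generate G ((\<lambda>x. x [^] (n * e)) ` P)"
      using B(2) by (auto intro: generate.incl)
    ultimately have "fin_cover G (generate G ((\<lambda>x. x [^] (n * e)) ` P)) B" using fin_cover_mono by blast
    moreover have "subgroup (generate G ((\<lambda>x. x [^] (n * e)) ` P)) G"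
      by (rule generate_is_subgroup) auto
    ultimately show ?thesis using fin_cover_trans B(4) by blast
  qed
  ultimately show thesis using that e by (meson order.trans subsetD)
qed

text \<open>A nontrivial \<open>f\<close> is a \<open>k\<close>-th power only for \<open>k\<close>
  dividing one number \<open>m\<close>. Indeed, a retraction up to the power \<open>m\<close> onto
  the powers of \<open>f\<close> turns \<open>x [^] k = f\<close> into
  \<open>f [^] m = f [^] (j * k)\<close>, and torsion-freeness gives
  \<open>m = j * k\<close>.\<close>

lemma power_avoiding:
  assumes B: "abelian_sub G B" and fg: "finitely_generated_in G B"
    and tf: "\<And>x n. \<lbrakk>x \<in> B; n > (0::nat); x [^] n = \<one>\<rbrakk> \<Longrightarrow> x = \<one>"
    and F: "finite F" "F \<subseteq> B" "\<one> \<notin> F"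
  obtains k :: nat where "k > 0" "\<And>x. x \<in> B \<Longrightarrow> x [^] k \<notin> F"
proof -
  note D = abelian_subD[OF B]
  have "\<exists>m::nat. m > 0 \<and> (\<forall>k::nat. \<forall>x\<in>B. x [^] k = f \<longrightarrow> k dvd m)" if f: "f \<in> F" for f
  proof -
    obtain S where S: "finite S" "S \<subseteq> carrier G" "generate G S = B" 
      using fg unfolding finitely_generated_in_def by blast
    have SB: "S \<subseteq> B" using S(3) generate.incl[of _ S G] by blast
    have fB: "f \<in> B" using f F by blast
    define U where "U = generate G {f}"
    have U: "U \<subseteq> B" "subgroup U G" using abelian_sub_generate[OF B, of "{f}"] fB unfolding U_def by auto
    have "generate G (U \<union> S) = B"
      using S(3) mono_generate[of S "U \<union> S"] generate_subgroup_incl[OF _ D(1), of "U \<union> S"] U SB by blast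
    with abelian_power_retraction[OF B U(2,1) S(1) SB] obtain p m where p: "m > (0::nat)"
      "\<And>u. u \<in> U \<Longrightarrow> p u = u [^] m" "\<And>x. x \<in> B \<Longrightarrow> p x \<in> U" 
      "\<And>x y. \<lbrakk>x \<in> B; y \<in> B\<rbrakk> \<Longrightarrow> p (x \<otimes> y) = p x \<otimes> p y" by metis
    have pp: "p (x [^] k) = p x [^] k" if x: "x \<in> B" for x and k :: nat
    proof (induction k)
      case 0
      show ?case using p(2)[OF subgroup.one_closed[OF U(2)]] by simp
    next
      case (Suc k)
      then show ?case using p(4)[OF subgroup_nat_pow_closed[OF D(1) x] x] by simp
    qed
    show ?thesis
    proof (intro exI[of _ m] conjI allI ballI impI)
      show "m > 0" by fact
      fix k :: nat and x assume x: "x \<in> B" "x [^] k = f"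
      have fU: "f \<in> U" unfolding U_def by (simp add: generate.incl)
      have fc: "f \<in> carrier G" using fB D by blast
      obtain j :: int where j: "p x = f [^] j" using p(3)[OF x(1)] generate_pow[OF fc] unfolding U_def by blast
      have "f [^] int m = f [^] m" by (rule int_pow_int)
      also have "\<dots> = p (x [^] k)" using p(2)[OF fU] x by simp
      also have "\<dots> = (f [^] j) [^] int k" using pp[OF x(1)] j by (simp add: int_pow_int)
      also have "\<dots> = f [^] (j * int k)" using fc by (simp add: int_pow_pow)
      finally have e: "f [^] int m = f [^] (j * int k)" .
      then have "f [^] (int m - j * int k) = \<one>" using fc by (simp add: int_pow_diff)
      moreover have "f [^] (j * int k - int m) = \<one>" using fc e by (simp add: int_pow_diff)
      ultimately have 1: "f [^] \<bar>int m - j * int k\<bar> = \<one>" by (simp add: abs_if)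
      have "int m - j * int k = 0"
      proof (rule ccontr)
        assume "int m - j * int k \<noteq> 0"
        then have "nat \<bar>int m - j * int k\<bar> > 0" by simp
        moreover have "f [^] nat \<bar>int m - j * int k\<bar> = \<one>" 
          using 1 int_pow_int[of G f "nat \<bar>int m - j * int k\<bar>"] by simp
        ultimately show False using tf[OF fB] F f by blast
      qed
      then have "int k dvd int m" by (metis dvd_triv_right eq_iff_diff_eq_0)
      then show "k dvd m" by simp
    qed
  qed
  then obtain m :: "'a \<Rightarrow> nat" where m: "\<And>f. f \<in> F \<Longrightarrow> m f > 0"
    "\<And>f k x. \<lbrakk>f \<in> F; x \<in> B; x [^] (k::nat) = f\<rbrakk> \<Longrightarrow> k dvd m f" by metis
  \<comment> \<open>An exponent larger than every \<open>m f\<close> divides none of them.\<close>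
  have "x [^] Suc (sum m F) \<notin> F" if "x \<in> B" for x
  proof
    assume "x [^] Suc (sum m F) \<in> F"
    then have "Suc (sum m F) \<le> m (x [^] Suc (sum m F))" 
      using m(2)[OF _ that HOL.refl] m(1) dvd_imp_le by blast
    also have "\<dots> \<le> sum m F" using \<open>x [^] Suc (sum m F) \<in> F\<close> F(1) by (intro member_le_sum) auto
    finally show False by simp
  qed
  then show thesis using that by blast
qed

end

section \<open>Virtual retracts and invariant complements\<close>

definition normalizes :: "('a, 'b) monoid_scheme \<Rightarrow> 'a set \<Rightarrow> 'a set \<Rightarrow> bool" where
  "normalizes G H M \<longleftrightarrow> (\<forall>h\<in>H. \<forall>x\<in>M. h \<otimes>\<^bsub>G\<^esub> x \<otimes>\<^bsub>G\<^esub> inv\<^bsub>G\<^esub> h \<in> M)"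

definition cent :: "('a, 'b) monoid_scheme \<Rightarrow> 'a set \<Rightarrow> 'a set" where
  "cent G N = {g \<in> carrier G. \<forall>n\<in>N. g \<otimes>\<^bsub>G\<^esub> n = n \<otimes>\<^bsub>G\<^esub> g}"

context group
begin

lemma normalizesD:
  assumes "normalizes G H M" "subgroup H G" "M \<subseteq> carrier G" "h \<in> H" "x \<in> M"
  shows "h \<otimes> x \<otimes> inv h \<in> M" "inv h \<otimes> x \<otimes> h \<in> M"
  using assms(1,4,5) subgroup.m_inv_closed[OF assms(2,4)] subgroup.mem_carrier[OF assms(2,4)]
  unfolding normalizes_def by (auto dest: bspec[where x = "inv h"])

lemma normalizes_mult_commute:
  assumes "normalizes G H M" "subgroup H G" "subgroup M G"
  shows "M <#> H = H <#> M"
proof -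
  note c = subgroup.mem_carrier[OF assms(2)] subgroup.mem_carrier[OF assms(3)]
  note n = normalizesD[OF assms(1,2) subgroup.subset[OF assms(3)]]
  show ?thesis
  proof (intro subset_antisym subsetI)
    fix x assume "x \<in> M <#> H"
    then obtain m h where x: "m \<in> M" "h \<in> H" "x = m \<otimes> h" unfolding set_mult_def by blast
    then have "x = h \<otimes> (inv h \<otimes> m \<otimes> h)" using c by (simp add: m_assoc)
    then show "x \<in> H <#> M" unfolding set_mult_def using n(2)[OF x(2,1)] x(2) by blast
  next
    fix x assume "x \<in> H <#> M"
    then obtain m h where x: "m \<in> M" "h \<in> H" "x = h \<otimes> m" unfolding set_mult_def by blast
    then have "x = (h \<otimes> m \<otimes> inv h) \<otimes> h" using c by (simp add: m_assoc)
    then show "x \<in> M <#> H" unfolding set_mult_def using n(1)[OF x(2,1)] x(2) by blast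
  qed
qed

lemma subgroup_mult_normalizes:
  assumes "normalizes G H M" "subgroup H G" "subgroup M G"
  shows "subgroup (M <#> H) G"
proof (rule subgroupI)
  interpret H: subgroup H G by fact
  interpret M: subgroup M G by fact
  note n = normalizesD[OF assms(1,2) M.subset]
  show "M <#> H \<subseteq> carrier G" unfolding set_mult_def by auto
  show "M <#> H \<noteq> {}" unfolding set_mult_def using H.one_closed M.one_closed by blast
  fix a assume "a \<in> M <#> H"
  then obtain m h where a: "a = m \<otimes> h" "m \<in> M" "h \<in> H" unfolding set_mult_def by blast
  have "inv a = (inv h \<otimes> inv m \<otimes> h) \<otimes> inv h"
    using a by (simp add: inv_mult_group m_assoc)
  then show "inv a \<in> M <#> H" unfolding set_mult_def using a n(2)[of h "inv m"] by blast
  fix b assume "b \<in> M <#> H"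
  then obtain m' h' where b: "b = m' \<otimes> h'" "m' \<in> M" "h' \<in> H" unfolding set_mult_def by blast
  have "a \<otimes> b = (m \<otimes> (h \<otimes> m' \<otimes> inv h)) \<otimes> (h \<otimes> h')"
    using a b by (simp add: m_assoc)
  moreover have "m \<otimes> (h \<otimes> m' \<otimes> inv h) \<in> M" "h \<otimes> h' \<in> H" using a b n(1) by auto
  ultimately show "a \<otimes> b \<in> M <#> H" unfolding set_mult_def by blast
qed

lemma cent_subgroup:
  assumes "N \<subseteq> carrier G"
  shows "subgroup (cent G N) G"
proof (rule subgroupI)
  show "cent G N \<subseteq> carrier G" unfolding cent_def by blast
  show "cent G N \<noteq> {}" using assms unfolding cent_def by (auto intro!: exI[of _ \<one>])
  fix a assume a: "a \<in> cent G N"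
  show "inv a \<in> cent G N"
    unfolding cent_def
  proof (intro CollectI conjI ballI)
    show "inv a \<in> carrier G" using a unfolding cent_def by simp
    fix n assume n: "n \<in> N"
    have "a \<otimes> n = n \<otimes> a" "a \<in> carrier G" "n \<in> carrier G" using a n assms unfolding cent_def by auto
    then show "inv a \<otimes> n = n \<otimes> inv a"
      by (metis inv_closed inv_solve_left inv_solve_right m_assoc m_closed)
  qed
  fix b assume b: "b \<in> cent G N"
  show "a \<otimes> b \<in> cent G N"
    unfolding cent_def
  proof (intro CollectI conjI ballI)
    show "a \<otimes> b \<in> carrier G" using a b unfolding cent_def by simp
    fix n assume n: "n \<in> N"
    have e: "a \<otimes> n = n \<otimes> a" "b \<otimes> n = n \<otimes> b" "a \<in> carrier G" "b \<in> carrier G" "n \<in> carrier G" 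
      using a b n assms unfolding cent_def by auto
    then have "a \<otimes> b \<otimes> n = a \<otimes> (b \<otimes> n)" by (simp add: m_assoc)
    also have "\<dots> = (a \<otimes> n) \<otimes> b" using e(3-) by (simp only: e(2) m_assoc)
    also have "\<dots> = n \<otimes> (a \<otimes> b)" using e(3-) by (simp only: e(1) m_assoc)
    finally show "a \<otimes> b \<otimes> n = n \<otimes> (a \<otimes> b)" .
  qed
qed

text \<open>The retraction \<rho> onto \<open>P\<close> is followed by the projection of
  \<open>M <#> H\<close> onto \<open>H\<close> that kills \<open>M\<close>. This projection is
  defined only on \<open>M <#> H\<close>, so the domain shrinks to the preimage of that subgroup
  under \<rho>, still of finite index.\<close>

lemma virtual_retract_trans:
  assumes P: "virtual_retract G P" and H: "subgroup H G" "H \<subseteq> P" and M: "subgroup M G" "M \<subseteq> P"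
    and n: "normalizes G H M" "M \<inter> H = {\<one>}" and fc: "fin_cover G (M <#> H) P"
  shows "virtual_retract G H"
proof -
  obtain K \<rho> where K: "finite_index G K" "P \<subseteq> K" and \<rho>: "\<rho> \<in> hom (G\<lparr>carrier := K\<rparr>) (G\<lparr>carrier := P\<rparr>)" 
    "\<And>h. h \<in> P \<Longrightarrow> \<rho> h = h" and Psub: "subgroup P G"
    using P unfolding virtual_retract_def by blast
  have Ks: "subgroup K G" "fin_cover G K (carrier G)" using K(1) by (auto simp: finite_index_iff)
  interpret P: subgroup P G by fact
  interpret K: subgroup K G by fact
  interpret H: subgroup H G by fact
  interpret M: subgroup M G by fact
  have rP: "\<rho> x \<in> P" if "x \<in> K" for x using \<rho>(1) that unfolding hom_def by auto
  have rm: "\<rho> (x \<otimes> y) = \<rho> x \<otimes> \<rho> y" if "x \<in> K" "y \<in> K" for x y using \<rho>(1) that unfolding hom_def by auto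
  have r1: "\<rho> \<one> = \<one>" using \<rho>(2) by simp
  have ri: "\<rho> (inv x) = inv (\<rho> x)" if "x \<in> K" for x
  proof -
    have "\<rho> x \<otimes> \<rho> (inv x) = \<one>" using rm[of x "inv x"] r1 that by simp
    then show ?thesis using rP that by (metis P.mem_carrier K.m_inv_closed inv_equality inv_inv inv_closed)
  qed
  have MH: "subgroup (M <#> H) G" using subgroup_mult_normalizes[OF n(1) H(1) M(1)] .
  interpret MH: subgroup "M <#> H" G by (rule MH)
  have MHP: "M <#> H \<subseteq> P" using H(2) M(2) unfolding set_mult_def by auto
  have HMH: "h \<in> M <#> H" if "h \<in> H" for h 
  proof -
    have "h = \<one> \<otimes> h" using that by simp
    then show ?thesis unfolding set_mult_def using M.one_closed that by blast
  qed
  define L where "L = {k \<in> K. \<rho> k \<in> M <#> H}"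
  have L: "subgroup L G"
  proof (rule subgroupI)
    show "L \<subseteq> carrier G" unfolding L_def using K.subset by blast
    have "\<one> \<in> L" unfolding L_def using r1 by simp
    then show "L \<noteq> {}" by blast
    show "inv a \<in> L" if "a \<in> L" for a using that ri unfolding L_def by simp
    show "a \<otimes> b \<in> L" if "a \<in> L" "b \<in> L" for a b using that rm unfolding L_def by simp
  qed
  have "fin_cover G L K"
  proof (rule fin_coverI_map[where f = "\<lambda>k. (M <#> H) #> \<rho> k"])
    have "(\<lambda>k. (M <#> H) #> \<rho> k) ` K \<subseteq> (\<lambda>x. (M <#> H) #> x) ` P" using rP by blast
    then show "finite ((\<lambda>k. (M <#> H) #> \<rho> k) ` K)" 
      using fin_cover_rcosets[OF fc MH P.subset] finite_subset by blast
    fix x y assume xy: "x \<in> K" "y \<in> K" "(M <#> H) #> \<rho> x = (M <#> H) #> \<rho> y"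
    then have "\<rho> x \<in> (M <#> H) #> \<rho> y" using rcos_self[of "\<rho> x" "M <#> H"] MH rP by auto
    then obtain z where z: "z \<in> M <#> H" "\<rho> x = z \<otimes> \<rho> y" unfolding r_coset_def by blast
    then have "\<rho> (x \<otimes> inv y) = z" using xy rm ri rP by (simp add: m_assoc)
    then show "x \<otimes> inv y \<in> L" unfolding L_def using xy z by simp
  qed (rule K.subset)
  then have "fin_cover G L (carrier G)" using fin_cover_trans Ks(2) L by blast
  with L have Lfi: "finite_index G L" by (simp add: finite_index_iff)
  \<comment> \<open>Well defined because \<open>M \<inter> H\<close> is trivial, and multiplicative
    because \<open>H\<close> normalizes \<open>M\<close>.\<close>
  define \<pi> where "\<pi> x = (THE h. h \<in> H \<and> (\<exists>m\<in>M. x = m \<otimes> h))" for x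
  have \<pi>: "\<pi> (m \<otimes> h) = h" if "m \<in> M" "h \<in> H" for m h
    unfolding \<pi>_def
  proof (rule the_equality)
    fix h' assume "h' \<in> H \<and> (\<exists>m'\<in>M. m \<otimes> h = m' \<otimes> h')"
    then obtain m' where h': "h' \<in> H" "m' \<in> M" "m \<otimes> h = m' \<otimes> h'" by blast
    then have "inv m' \<otimes> m = h' \<otimes> inv h"
      using that by (metis H.mem_carrier M.mem_carrier inv_closed inv_solve_left' inv_solve_right m_assoc m_closed)
    moreover have "inv m' \<otimes> m \<in> M" "h' \<otimes> inv h \<in> H" using h' that by auto
    ultimately have "h' \<otimes> inv h = \<one>" using n(2) by auto
    then show "h' = h" using h' that by (metis H.mem_carrier inv_closed inv_equality inv_inv)
  qed (use that in blast)
  show ?thesis unfolding virtual_retract_def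
  proof (intro conjI exI[of _ L] bexI[of _ "\<lambda>x. \<pi> (\<rho> x)"])
    show "subgroup H G" by fact
    show "finite_index G L" by fact
    show "H \<subseteq> L" using H(2) K(2) \<rho>(2) HMH unfolding L_def by auto
    show "\<forall>h\<in>H. \<pi> (\<rho> h) = h"
    proof
      fix h assume h: "h \<in> H"
      then show "\<pi> (\<rho> h) = h" using \<rho>(2)[of h] H(2) \<pi>[of \<one> h] by auto
    qed
    show "(\<lambda>x. \<pi> (\<rho> x)) \<in> hom (G\<lparr>carrier := L\<rparr>) (G\<lparr>carrier := H\<rparr>)"
    proof (rule homI)
      fix x assume "x \<in> carrier (G\<lparr>carrier := L\<rparr>)"
      then obtain m h where x: "m \<in> M" "h \<in> H" "\<rho> x = m \<otimes> h" "x \<in> K" unfolding L_def set_mult_def by auto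
      then show "\<pi> (\<rho> x) \<in> carrier (G\<lparr>carrier := H\<rparr>)" using \<pi> by simp
      fix y assume "y \<in> carrier (G\<lparr>carrier := L\<rparr>)"
      then obtain m' h' where y: "m' \<in> M" "h' \<in> H" "\<rho> y = m' \<otimes> h'" "y \<in> K" unfolding L_def set_mult_def by auto
      have "\<rho> (x \<otimes> y) = (m \<otimes> (h \<otimes> m' \<otimes> inv h)) \<otimes> (h \<otimes> h')"
        using x y rm by (simp add: m_assoc)
      moreover have "m \<otimes> (h \<otimes> m' \<otimes> inv h) \<in> M" "h \<otimes> h' \<in> H" 
        using x y normalizesD(1)[OF n(1) H(1) M.subset] by auto
      ultimately have "\<pi> (\<rho> (x \<otimes> y)) = h \<otimes> h'" using \<pi> by simp
      then show "\<pi> (\<rho> (x \<otimes>\<^bsub>G\<lparr>carrier := L\<rparr>\<^esub> y)) = \<pi> (\<rho> x) \<otimes>\<^bsub>G\<lparr>carrier := H\<rparr>\<^esub> \<pi> (\<rho> y)"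
        using x y \<pi> by simp
    qed
  qed
qed

text \<open>Maschke's argument: a retraction up to a power is averaged over the finite group
  \<open>H / C\<close>, and its kernel is the complement.\<close>

lemma invariant_complement:
  assumes B: "abelian_sub G B" "finitely_generated_in G B" 
    "\<And>x n. \<lbrakk>x \<in> B; n > (0::nat); x [^] n = \<one>\<rbrakk> \<Longrightarrow> x = \<one>"
    and H: "subgroup H G" "normalizes G H B"
    and C: "subgroup C G" "C \<subseteq> H" "C \<subseteq> cent G B" "fin_cover G C H"
    and U: "subgroup U G" "U \<subseteq> B" "normalizes G H U"
  obtains M where "subgroup M G" "M \<subseteq> B" "normalizes G H M" "M \<inter> U = {\<one>}" "fin_cover G (M <#> U) B"
proof -
  note D = abelian_subD[OF B(1)]
  interpret B: subgroup B G by (rule D(1))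
  interpret H: subgroup H G by (rule H(1))
  interpret C: subgroup C G by (rule C(1))
  interpret U: subgroup U G by (rule U(1))
  \<comment> \<open>\<open>B\<close> as a commutative group of its own, so that products over a
    finite index set are available.\<close>
  define GB where "GB = G\<lparr>carrier := B\<rparr>"
  have "group GB" unfolding GB_def by (rule B.subgroup_is_group) (rule is_group)
  then interpret GB: comm_group GB
    by (rule group.group_comm_groupI) (use D(3) in \<open>simp add: GB_def\<close>)
  have [simp]: "carrier GB = B" "x \<otimes>\<^bsub>GB\<^esub> y = x \<otimes> y" "\<one>\<^bsub>GB\<^esub> = \<one>" for x y unfolding GB_def by simp_all
  have nB: "h \<otimes> x \<otimes> inv h \<in> B" "inv h \<otimes> x \<otimes> h \<in> B" if "h \<in> H" "x \<in> B" for h x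
    using normalizesD[OF H(2,1) B.subset that] by auto
  have nU: "h \<otimes> x \<otimes> inv h \<in> U" "inv h \<otimes> x \<otimes> h \<in> U" if "h \<in> H" "x \<in> U" for h x
    using normalizesD[OF U(3) H(1) U.subset that] by auto
  obtain S where S: "finite S" "S \<subseteq> carrier G" "generate G S = B" 
    using B(2) unfolding finitely_generated_in_def by blast
  have SB: "S \<subseteq> B" using S(3) generate.incl[of _ S G] by blast
  have "generate G (U \<union> S) = B"
    using S(3) mono_generate[of S "U \<union> S"] generate_subgroup_incl[OF _ D(1), of "U \<union> S"] U SB by blast
  with abelian_power_retraction[OF B(1) U(1,2) S(1) SB] obtain p m where p: "m > (0::nat)"
    "\<And>u. u \<in> U \<Longrightarrow> p u = u [^] m" "\<And>x. x \<in> B \<Longrightarrow> p x \<in> U" 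
    "\<And>x y. \<lbrakk>x \<in> B; y \<in> B\<rbrakk> \<Longrightarrow> p (x \<otimes> y) = p x \<otimes> p y" by metis
  \<comment> \<open>The conjugates of \<open>p\<close> under \<open>H\<close>. Each of them is again
    a homomorphism from \<open>B\<close> to \<open>U\<close> that raises the elements of
    \<open>U\<close> to the power \<open>m\<close>.\<close>
  define f where "f h x = inv h \<otimes> p (h \<otimes> x \<otimes> inv h) \<otimes> h" for h x
  have fU: "f h x \<in> U" if "h \<in> H" "x \<in> B" for h x
    unfolding f_def using nU(2)[OF that(1)] p(3) nB(1)[OF that] by simp
  have fm: "f h (x \<otimes> y) = f h x \<otimes> f h y" if h: "h \<in> H" and xy: "x \<in> B" "y \<in> B" for h x y
  proof -
    have "h \<otimes> (x \<otimes> y) \<otimes> inv h = (h \<otimes> x \<otimes> inv h) \<otimes> (h \<otimes> y \<otimes> inv h)"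
      using h xy by (simp add: m_assoc)
    then have "p (h \<otimes> (x \<otimes> y) \<otimes> inv h) = p (h \<otimes> x \<otimes> inv h) \<otimes> p (h \<otimes> y \<otimes> inv h)"
      using p(4) nB(1)[OF h] xy by simp
    moreover have "p (h \<otimes> x \<otimes> inv h) \<in> carrier G" "p (h \<otimes> y \<otimes> inv h) \<in> carrier G"
      using p(3)[OF nB(1)[OF h]] xy by auto
    ultimately show ?thesis unfolding f_def using h by (simp add: m_assoc)
  qed
  have fu: "f h u = u [^] m" if h: "h \<in> H" and u: "u \<in> U" for h u
  proof -
    have "p (h \<otimes> u \<otimes> inv h) = (h \<otimes> u \<otimes> inv h) [^] m" using p(2) nU(1)[OF h u] by simp
    also have "\<dots> = h \<otimes> u [^] m \<otimes> inv h"
    proof (induction m)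
      case (Suc m)
      then show ?case using h u by (simp add: m_assoc)
    qed (use h in simp)
    finally show ?thesis unfolding f_def using h u by (simp add: m_assoc)
  qed
  \<comment> \<open>The conjugate depends only on the coset \<open>C #> h\<close>, since
    \<open>C\<close> centralizes \<open>B\<close>, which contains both the argument and the value of
    \<open>p\<close>. So the average is a product over the finite set of these cosets.\<close>
  have fC: "f (c \<otimes> h) x = f h x" if c: "c \<in> C" and h: "h \<in> H" and x: "x \<in> B" for c h x
  proof -
    let ?y = "h \<otimes> x \<otimes> inv h"
    have y: "?y \<in> B" using nB(1)[OF h x] .
    have cc: "c \<otimes> z = z \<otimes> c" if "z \<in> B" for z using C(3) c that unfolding cent_def by blast
    have cH: "c \<in> carrier G" "h \<in> carrier G" "x \<in> carrier G" using c h x by auto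
    have "(c \<otimes> h) \<otimes> x \<otimes> inv (c \<otimes> h) = (c \<otimes> ?y) \<otimes> inv c" using cH by (simp add: inv_mult_group m_assoc)
    also have "\<dots> = ?y" using cc[OF y] cH by (simp add: m_assoc)
    finally have 1: "(c \<otimes> h) \<otimes> x \<otimes> inv (c \<otimes> h) = ?y" .
    have py: "p ?y \<in> B" using p(3)[OF y] U(2) by blast
    have "f (c \<otimes> h) x = inv h \<otimes> (inv c \<otimes> (p ?y \<otimes> c)) \<otimes> h" 
      unfolding f_def 1 using cH py by (simp add: inv_mult_group m_assoc)
    also have "p ?y \<otimes> c = c \<otimes> p ?y" using cc[OF py] by simp
    finally show ?thesis unfolding f_def using cH py by simp
  qed
  define I where "I = (\<lambda>h. C #> h) ` H"
  have I: "finite I" unfolding I_def by (rule fin_cover_rcosets[OF C(4,1) H.subset])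
  define rep where "rep Q = (SOME h. h \<in> Q)" for Q :: "'a set"
  have rep: "rep (C #> h) \<in> C #> h" if "h \<in> H" for h
    unfolding rep_def using rcos_self[of h C] C(1) that by (auto intro!: someI[where x = h])
  have frep: "rep (C #> h) \<in> H \<and> (\<forall>x\<in>B. f (rep (C #> h)) x = f h x)" if h: "h \<in> H" for h
  proof -
    obtain c where "c \<in> C" "rep (C #> h) = c \<otimes> h" using rep[OF h] unfolding r_coset_def by blast
    then show ?thesis using fC[OF _ h] C(2) h by auto
  qed
  have repH: "rep Q \<in> H" if "Q \<in> I" for Q using that frep unfolding I_def by blast
  define F where "F x = finprod GB (\<lambda>Q. f (rep Q) x) I" for x
  have fPi: "(\<lambda>Q. f (rep Q) x) \<in> I \<rightarrow> B" if "x \<in> B" for x using fU repH that U(2) by blast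
  have FU: "F x \<in> U" if x: "x \<in> B" for x
  proof -
    have "finprod GB (\<lambda>Q. f (rep Q) x) J \<in> U" if "finite J" "J \<subseteq> I" for J
      using that
    proof (induction J rule: finite_induct)
      case (insert j J)
      then have "finprod GB (\<lambda>Q. f (rep Q) x) (insert j J) = f (rep j) x \<otimes> finprod GB (\<lambda>Q. f (rep Q) x) J"
        using fPi[OF x] by (subst GB.finprod_insert) auto
      then show ?case using insert fU[OF repH x] by auto
    qed simp
    then show ?thesis unfolding F_def using I by blast
  qed
  have Fm: "F (x \<otimes> y) = F x \<otimes> F y" if "x \<in> B" "y \<in> B" for x y
  proof -
    have "F (x \<otimes> y) = finprod GB (\<lambda>Q. f (rep Q) x \<otimes>\<^bsub>GB\<^esub> f (rep Q) y) I"
      unfolding F_def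
    proof (rule GB.finprod_cong'[OF HOL.refl])
      show "(\<lambda>Q. f (rep Q) x \<otimes>\<^bsub>GB\<^esub> f (rep Q) y) \<in> I \<rightarrow> carrier GB"
        using fPi[OF that(1)] fPi[OF that(2)] by (simp add: Pi_iff)
      show "f (rep Q) (x \<otimes> y) = f (rep Q) x \<otimes>\<^bsub>GB\<^esub> f (rep Q) y" if "Q \<in> I" for Q
        using fm[OF repH[OF that] \<open>x \<in> B\<close> \<open>y \<in> B\<close>] by simp
    qed
    also have "\<dots> = F x \<otimes> F y" unfolding F_def using GB.finprod_multf[of "\<lambda>Q. f (rep Q) x" I "\<lambda>Q. f (rep Q) y"] fPi that by simp
    finally show ?thesis .
  qed
  \<comment> \<open>On \<open>U\<close> each of the \<open>card I\<close> factors of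
    \<open>F\<close> is the \<open>m\<close>-th power.\<close>
  define r where "r = m * card I"
  have "C #> \<one> \<in> I" unfolding I_def by (rule imageI) (rule H.one_closed)
  then have "card I > 0" using I card_gt_0_iff[of I] by fastforce
  then have r: "r > 0" unfolding r_def using p(1) by simp
  have Fu: "F u = u [^] r" if u: "u \<in> U" for u
  proof -
    have um: "u [^] m \<in> B" using u U(2) subgroup_nat_pow_closed[OF U(1) u] by blast
    have "F u = finprod GB (\<lambda>Q. u [^] m) I"
      unfolding F_def using fu[OF repH u] um by (intro GB.finprod_cong') auto
    also have "\<dots> = (u [^] m) [^]\<^bsub>GB\<^esub> card I" using um by (intro GB.finprod_const) simp
    also have "\<dots> = (u [^] m) [^] card I" unfolding GB_def by (simp flip: nat_pow_consistent)
    finally show ?thesis using u unfolding r_def by (simp add: nat_pow_pow)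
  qed
  have F1: "F \<one> = \<one>" using Fu[of \<one>] by simp
  have Fp: "F (x [^] k) = F x [^] k" if x: "x \<in> B" for x and k :: nat
  proof (induction k)
    case (Suc k)
    then show ?case using Fm[OF subgroup_nat_pow_closed[OF D(1) x] x] by simp
  qed (use F1 in simp)
  have Fi: "F (inv x) = inv (F x)" if x: "x \<in> B" for x
    using Fm[of "inv x" x] F1 x FU by (simp add: inv_equality)
  \<comment> \<open>Right multiplication by \<open>g\<close> permutes the cosets of \<open>C\<close>
    in \<open>H\<close>, so conjugating the argument of \<open>F\<close> conjugates the value and
    otherwise only reorders the factors.\<close>
  have Fconj: "F (g \<otimes> x \<otimes> inv g) = g \<otimes> F x \<otimes> inv g" if g: "g \<in> H" and x: "x \<in> B" for g x
  proof -
    have bij: "inj_on (\<lambda>Q. Q #> g) I" "(\<lambda>Q. Q #> g) ` I = I"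
    proof -
      have e: "(C #> h) #> k = C #> (h \<otimes> k)" if "h \<in> H" "k \<in> H" for h k
        using coset_mult_assoc[of C h k] that C.subset by simp
      show "inj_on (\<lambda>Q. Q #> g) I"
      proof (rule inj_on_inverseI[where g = "\<lambda>Q. Q #> inv g"])
        show "Q #> g #> inv g = Q" if "Q \<in> I" for Q
          using that g unfolding I_def by (auto simp: e m_assoc)
      qed
      show "(\<lambda>Q. Q #> g) ` I = I"
      proof
        show "(\<lambda>Q. Q #> g) ` I \<subseteq> I" unfolding I_def using e g by auto
        show "I \<subseteq> (\<lambda>Q. Q #> g) ` I"
        proof
          fix Q assume "Q \<in> I"
          then obtain h where h: "h \<in> H" "Q = C #> h" unfolding I_def by blast
          then have "Q = (C #> (h \<otimes> inv g)) #> g" using g by (simp add: e m_assoc)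
          then show "Q \<in> (\<lambda>Q. Q #> g) ` I" unfolding I_def using h g by blast
        qed
      qed
    qed
    have gx: "g \<otimes> x \<otimes> inv g \<in> B" using nB(1)[OF g x] .
    have eq: "f (rep Q) (g \<otimes> x \<otimes> inv g) = g \<otimes> f (rep (Q #> g)) x \<otimes> inv g" if Q: "Q \<in> I" for Q
    proof -
      obtain h where h: "h \<in> H" "Q = C #> h" using Q unfolding I_def by blast
      have "Q #> g = C #> (h \<otimes> g)" using coset_mult_assoc[of C h g] C.subset h g by simp
      then have 1: "f (rep (Q #> g)) x = f (h \<otimes> g) x" using frep[of "h \<otimes> g"] h g x by simp
      have 2: "f (rep Q) (g \<otimes> x \<otimes> inv g) = f h (g \<otimes> x \<otimes> inv g)" using frep[OF h(1)] gx h by simp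
      have 3: "h \<otimes> (g \<otimes> x \<otimes> inv g) \<otimes> inv h = (h \<otimes> g) \<otimes> x \<otimes> inv (h \<otimes> g)"
        using h g x by (simp add: inv_mult_group m_assoc)
      define z where "z = p ((h \<otimes> g) \<otimes> x \<otimes> inv (h \<otimes> g))"
      have z: "z \<in> carrier G" unfolding z_def using p(3)[OF nB(1)[of "h \<otimes> g"]] h g x by simp
      have "f h (g \<otimes> x \<otimes> inv g) = inv h \<otimes> z \<otimes> h" unfolding f_def 3 z_def ..
      moreover have "f (h \<otimes> g) x = inv (h \<otimes> g) \<otimes> z \<otimes> (h \<otimes> g)" unfolding f_def z_def ..
      ultimately show ?thesis unfolding 1 2 using h g z by (simp add: inv_mult_group m_assoc)
    qed
    have conj: "finprod GB (\<lambda>Q. g \<otimes> w Q \<otimes> inv g) J = g \<otimes> finprod GB w J \<otimes> inv g" 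
      if "finite J" "w \<in> J \<rightarrow> B" for w and J :: "'a set set"
      using that
    proof (induction J rule: finite_induct)
      case empty
      then show ?case using g by simp
    next
      case (insert j J)
      have w: "w j \<in> B" "w \<in> J \<rightarrow> B" using insert by auto
      have fp: "finprod GB w J \<in> B" using GB.finprod_closed[of w J] w by simp
      have "finprod GB (\<lambda>Q. g \<otimes> w Q \<otimes> inv g) (insert j J) = (g \<otimes> w j \<otimes> inv g) \<otimes> finprod GB (\<lambda>Q. g \<otimes> w Q \<otimes> inv g) J"
        using insert.hyps w nB(1)[OF g] by (subst GB.finprod_insert) auto
      also have "\<dots> = (g \<otimes> w j \<otimes> inv g) \<otimes> (g \<otimes> finprod GB w J \<otimes> inv g)" using insert.IH w by simp
      also have "\<dots> = g \<otimes> (w j \<otimes> finprod GB w J) \<otimes> inv g" using g w fp by (simp add: m_assoc)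
      also have "w j \<otimes> finprod GB w J = finprod GB w (insert j J)" using insert w by (subst GB.finprod_insert) auto
      finally show ?case .
    qed
    have "F (g \<otimes> x \<otimes> inv g) = finprod GB (\<lambda>Q. g \<otimes> f (rep (Q #> g)) x \<otimes> inv g) I"
      unfolding F_def
    proof (rule GB.finprod_cong'[OF HOL.refl])
      have "f (rep (Q #> g)) x \<in> B" if "Q \<in> I" for Q
        using fU[OF repH x, of "Q #> g"] imageI[OF that, of "\<lambda>Q. Q #> g"] bij(2) U(2) by blast
      then show "(\<lambda>Q. g \<otimes> f (rep (Q #> g)) x \<otimes> inv g) \<in> I \<rightarrow> carrier GB" using nB(1)[OF g] by simp
    qed (rule eq)
    also have "\<dots> = finprod GB (\<lambda>Q. g \<otimes> f (rep Q) x \<otimes> inv g) ((\<lambda>Q. Q #> g) ` I)"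
      using bij nB(1)[OF g] subsetD[OF U(2) fU[OF repH x]] by (subst GB.finprod_reindex) auto
    also have "\<dots> = g \<otimes> F x \<otimes> inv g" unfolding F_def bij(2) using conj[OF I fPi[OF x]] by simp
    finally show ?thesis .
  qed
  define M where "M = {x \<in> B. F x = \<one>}"
  have M: "subgroup M G"
  proof (rule subgroupI)
    show "M \<subseteq> carrier G" unfolding M_def using B.subset by blast
    have "\<one> \<in> M" unfolding M_def using F1 by simp
    then show "M \<noteq> {}" by blast
    show "inv a \<in> M" if "a \<in> M" for a using that Fi unfolding M_def by simp
    show "a \<otimes> b \<in> M" if "a \<in> M" "b \<in> M" for a b using that Fm unfolding M_def by simp
  qed
  moreover have "M \<subseteq> B" unfolding M_def by blast
  moreover have "normalizes G H M" unfolding normalizes_def M_def using Fconj nB(1) by simp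
  \<comment> \<open>On \<open>M \<inter> U\<close> the map \<open>F\<close> is trivial and is also
    the \<open>r\<close>-th power, which has trivial kernel in the torsion-free group
    \<open>B\<close>.\<close>
  moreover have "M \<inter> U = {\<one>}" 
  proof -
    have "x = \<one>" if "x \<in> M" "x \<in> U" for x
      using B(3)[of x r] r Fu[OF that(2)] that(1) unfolding M_def by simp
    moreover have "\<one> \<in> M" unfolding M_def using F1 by simp
    ultimately show ?thesis using U.one_closed by blast
  qed
  moreover have "fin_cover G (M <#> U) B"
  proof -
    have "fin_cover G ((\<lambda>x. x [^] r) ` B) B" using fin_cover_powers[OF B(1) r S(1) SB] S(3) by simp
    \<comment> \<open>The splitting is
      \<open>x [^] r = (x [^] r \<otimes> inv (F x)) \<otimes> F x\<close>; the first factor lies in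
      the kernel of \<open>F\<close> since \<open>F (F x) = F x [^] r\<close>.\<close>
    moreover have "(\<lambda>x. x [^] r) ` B \<subseteq> M <#> U"
    proof
      fix y assume "y \<in> (\<lambda>x. x [^] r) ` B"
      then obtain x where x: "x \<in> B" "y = x [^] r" by blast
      have xr: "x [^] r \<in> B" by (rule subgroup_nat_pow_closed[OF D(1) x(1)])
      have FB: "F x \<in> B" using FU[OF x(1)] U(2) by blast
      have "F (x [^] r \<otimes> inv (F x)) = F x [^] r \<otimes> inv (F (F x))"
        using Fm[OF xr] Fi[OF FB] Fp[OF x(1)] FB by simp
      also have "\<dots> = \<one>" using Fu[OF FU[OF x(1)]] FB by simp
      finally have "x [^] r \<otimes> inv (F x) \<in> M" unfolding M_def using xr FB by simp
      moreover have "y = (x [^] r \<otimes> inv (F x)) \<otimes> F x" using x FB by (simp add: m_assoc)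
      ultimately show "y \<in> M <#> U" unfolding set_mult_def using FU[OF x(1)] by blast
    qed
    ultimately show ?thesis using fin_cover_mono by blast
  qed
  ultimately show thesis using that by blast
qed

end

section \<open>Complements in virtually abelian groups and inside normal subgroups\<close>

context group
begin

lemma conj_nat_pow:
  assumes "h \<in> carrier G" "x \<in> carrier G"
  shows "(h \<otimes> x \<otimes> inv h) [^] (k::nat) = h \<otimes> x [^] k \<otimes> inv h"
  using assms by (induction k) (simp_all add: m_assoc)

lemma normalizes_generate_powers:
  assumes "subgroup H G" "subgroup P G" "normalizes G H P"
  shows "normalizes G H (generate G ((\<lambda>x. x [^] (k::nat)) ` P))"
  unfolding normalizes_def
proof (intro ballI)
  fix h x assume h: "h \<in> H" and x: "x \<in> generate G ((\<lambda>x. x [^] k) ` P)"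
  have hc: "h \<in> carrier G" by (rule subgroup.mem_carrier[OF assms(1) h])
  have Pc: "(\<lambda>x. x [^] k) ` P \<subseteq> carrier G" using subgroup.mem_carrier[OF assms(2)] by auto
  have Wsub: "subgroup (generate G ((\<lambda>x. x [^] k) ` P)) G" by (rule generate_is_subgroup[OF Pc])
  have base: "h \<otimes> y \<otimes> inv h \<in> generate G ((\<lambda>x. x [^] k) ` P)" if y: "y \<in> (\<lambda>x. x [^] k) ` P" for y
  proof -
    obtain z where z: "z \<in> P" "y = z [^] k" using y by blast
    have "h \<otimes> y \<otimes> inv h = (h \<otimes> z \<otimes> inv h) [^] k"
      using conj_nat_pow[OF hc subgroup.mem_carrier[OF assms(2) z(1)]] z by simp
    moreover have "h \<otimes> z \<otimes> inv h \<in> P" using assms(3) h z unfolding normalizes_def by blast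
    ultimately show ?thesis by (auto intro: generate.incl)
  qed
  show "h \<otimes> x \<otimes> inv h \<in> generate G ((\<lambda>x. x [^] k) ` P)"
    using x
  proof (induction rule: generate.induct)
    case one
    then show ?case using hc subgroup.one_closed[OF Wsub] by simp
  next
    case (incl y)
    then show ?case by (rule base)
  next
    case (inv y)
    have yc: "y \<in> carrier G" by (rule subsetD[OF Pc inv])
    have "h \<otimes> inv y \<otimes> inv h = inv (h \<otimes> y \<otimes> inv h)" using hc yc by (simp add: inv_mult_group m_assoc)
    then show ?case using subgroup.m_inv_closed[OF Wsub base[OF inv]] by simp
  next
    case (eng a b)
    have c: "a \<in> carrier G" "b \<in> carrier G" using eng generate_in_carrier[OF Pc] by auto
    have "h \<otimes> (a \<otimes> b) \<otimes> inv h = (h \<otimes> a \<otimes> inv h) \<otimes> (h \<otimes> b \<otimes> inv h)" using c hc by (simp add: m_assoc)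
    then show ?case using subgroup.m_closed[OF Wsub eng.IH] by simp
  qed
qed

lemma normalizes_Int:
  assumes "normalizes G H M" "normalizes G H L"
  shows "normalizes G H (M \<inter> L)"
  using assms unfolding normalizes_def by blast

lemma normalizes_self:
  assumes "subgroup H G"
  shows "normalizes G H H"
  unfolding normalizes_def using subgroup.m_closed[OF assms] subgroup.m_inv_closed[OF assms] by blast

lemma normalizes_mono:
  assumes "normalizes G H M" "H' \<subseteq> H"
  shows "normalizes G H' M"
  using assms unfolding normalizes_def by blast

text \<open>\<open>V\<close> is a torsion-free abelian subgroup of finite index that is normal in
  \<open>G\<close>. The averaging runs over \<open>P\<close> modulo \<open>P \<inter> V\<close>,
  which centralizes \<open>V\<close> and is at the same time the subgroup to be complemented. A
  complement inside \<open>V\<close> meets \<open>P\<close> only where it meets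
  \<open>P \<inter> V\<close>.\<close>

lemma virtually_abelian_complement:
  assumes fg: "finitely_generated_in G (carrier G)" and va: "virtually_abelian G" and P: "subgroup P G"
  obtains M where "abelian_sub G M" "finitely_generated_in G M" 
    "\<And>x n. \<lbrakk>x \<in> M; n > (0::nat); x [^] n = \<one>\<rbrakk> \<Longrightarrow> x = \<one>"
    "normalizes G P M" "M \<inter> P = {\<one>}" "fin_cover G (M <#> P) (carrier G)"
proof -
  interpret P: subgroup P G by fact
  obtain B where B: "abelian_sub G B" "fin_cover G B (carrier G)" using virtually_abelianE[OF va] .
  note D = abelian_subD[OF B(1)]
  have Bfg: "finitely_generated_in G B" using finitely_generated_subgroup[OF fg va D(1)] .
  obtain k :: nat where k: "generate G ((\<lambda>x. x [^] k) ` carrier G) \<subseteq> B" 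
    "\<And>x n. \<lbrakk>x \<in> generate G ((\<lambda>x. x [^] k) ` carrier G); n > (0::nat); x [^] n = \<one>\<rbrakk> \<Longrightarrow> x = \<one>"
    "fin_cover G (generate G ((\<lambda>x. x [^] k) ` carrier G)) (carrier G)"
    using torsion_free_powers[OF subgroup_self B(1) _ Bfg B(2)] D(2) by blast
  define V where "V = generate G ((\<lambda>x. x [^] k) ` carrier G)"
  have Vs: "subgroup V G" unfolding V_def by (rule generate_is_subgroup) auto
  have Vab: "abelian_sub G V" using abelian_sub_subset[OF B(1) Vs] k(1) unfolding V_def by simp
  have nV: "normalizes G (carrier G) V"
    unfolding V_def by (intro normalizes_generate_powers subgroup_self normalizes_self)
  have nP: "normalizes G P V" by (rule normalizes_mono[OF nV P.subset])
  have U: "subgroup (P \<inter> V) G" by (rule subgroups_Inter_pair[OF P Vs])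
  have Vc: "V \<subseteq> cent G V" using Vab unfolding abelian_sub_def cent_def by (auto simp: subgroup.mem_carrier)
  obtain M where M: "subgroup M G" "M \<subseteq> V" "normalizes G P M" "M \<inter> (P \<inter> V) = {\<one>}" "fin_cover G (M <#> (P \<inter> V)) V"
  proof (rule invariant_complement[OF Vab _ _ P nP U _ _ _ U])
    show "finitely_generated_in G V" by (rule finitely_generated_subgroup[OF fg va Vs])
    show "x = \<one>" if "x \<in> V" "n > 0" "x [^] n = \<one>" for x and n :: nat using k(2) that unfolding V_def by blast
    show "P \<inter> V \<subseteq> P" "P \<inter> V \<subseteq> V" by auto
    show "P \<inter> V \<subseteq> cent G V" using Vc by blast
    have "fin_cover G (V \<inter> P) P" using fin_cover_Int[OF k(3)[folded V_def] Vs P P.subset] by blast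
    then show "fin_cover G (P \<inter> V) P" by (simp add: Int_commute)
    show "normalizes G P (P \<inter> V)" by (rule normalizes_Int[OF normalizes_self[OF P] nP])
  qed (rule that)
  have "M <#> (P \<inter> V) \<subseteq> M <#> P" by (rule mono_set_mult) auto
  then have "fin_cover G (M <#> P) V" using M(5) fin_cover_mono by blast
  then have fc: "fin_cover G (M <#> P) (carrier G)"
    using fin_cover_trans[OF _ k(3)[folded V_def]] subgroup_mult_normalizes[OF M(3) P M(1)] by blast
  have "M \<inter> P = {\<one>}" using M(2,4) by blast
  moreover have "\<And>x n. \<lbrakk>x \<in> M; n > (0::nat); x [^] n = \<one>\<rbrakk> \<Longrightarrow> x = \<one>"
    using k(2) M(2) unfolding V_def by blast
  ultimately show thesis
    using that[OF abelian_sub_subset[OF Vab M(1,2)] finitely_generated_subgroup[OF fg va M(1)] _ M(3) _ fc] by blast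
qed

text \<open>Passing from \<open>M\<close> to its \<open>k\<close>-th powers keeps a complement up to
  finite index and can avoid any finite set of nontrivial \<open>M\<close>-components. This keeps
  prescribed elements apart when double cosets are collapsed.\<close>

lemma virtually_abelian_separation:
  assumes fg: "finitely_generated_in G (carrier G)" and va: "virtually_abelian G" and P: "subgroup P G"
    and F: "finite F" "F \<inter> P = {}"
  obtains M where "subgroup M G" "normalizes G P M" "M \<inter> P = {\<one>}" "fin_cover G (M <#> P) (carrier G)" 
    "F \<inter> (M <#> P) = {}"
proof -
  interpret P: subgroup P G by fact
  obtain M where M: "abelian_sub G M" "finitely_generated_in G M" 
    "\<And>x n. \<lbrakk>x \<in> M; n > (0::nat); x [^] n = \<one>\<rbrakk> \<Longrightarrow> x = \<one>"
    "normalizes G P M" "M \<inter> P = {\<one>}" "fin_cover G (M <#> P) (carrier G)"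
    using virtually_abelian_complement[OF fg va P] by blast
  note D = abelian_subD[OF M(1)]
  interpret M: subgroup M G by (rule D(1))
  \<comment> \<open>The \<open>M\<close>-components of those elements of \<open>F\<close> that lie
    in \<open>M <#> P\<close>. None of them is \<open>\<one>\<close>, since \<open>F\<close> is
    disjoint from \<open>P\<close>.\<close>
  define E where "E = {m \<in> M. \<exists>p\<in>P. m \<otimes> p \<in> F}"
  have uniq: "m = m'" if "m \<in> M" "m' \<in> M" "p \<in> P" "p' \<in> P" "m \<otimes> p = m' \<otimes> p'" for m m' p p'
  proof -
    have "inv m' \<otimes> m = p' \<otimes> inv p"
      using that by (metis P.mem_carrier M.mem_carrier inv_closed inv_solve_left' inv_solve_right m_assoc m_closed)
    moreover have "inv m' \<otimes> m \<in> M" "p' \<otimes> inv p \<in> P" using that by auto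
    ultimately have "inv m' \<otimes> m = \<one>" using M(5) by auto
    then show "m = m'" using that by (metis M.mem_carrier inv_closed inv_equality inv_inv)
  qed
  have "E \<subseteq> (\<lambda>f. THE m. m \<in> M \<and> (\<exists>p\<in>P. f = m \<otimes> p)) ` F"
  proof
    fix m assume "m \<in> E"
    then obtain p where p: "m \<in> M" "p \<in> P" "m \<otimes> p \<in> F" unfolding E_def by blast
    have e: "(THE m'. m' \<in> M \<and> (\<exists>p'\<in>P. m \<otimes> p = m' \<otimes> p')) = m"
      by (rule the_equality) (use p uniq in blast)+
    show "m \<in> (\<lambda>f. THE m. m \<in> M \<and> (\<exists>p\<in>P. f = m \<otimes> p)) ` F"
      by (rule image_eqI[where x = "m \<otimes> p"]) (use e p(3) in simp_all)
  qed
  then have "finite E" using F(1) by (rule finite_surj[rotated])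
  moreover have "E \<subseteq> M" unfolding E_def by blast
  ultimately have E: "finite E" "E \<subseteq> M" by auto
  have "\<one> \<notin> E" using F(2) unfolding E_def by auto
  obtain k :: nat where k: "k > 0" "\<And>x. x \<in> M \<Longrightarrow> x [^] k \<notin> E"
  proof (rule power_avoiding[OF M(1,2) _ E \<open>\<one> \<notin> E\<close>])
    show "x = \<one>" if "x \<in> M" "n > 0" "x [^] n = \<one>" for x and n :: nat by (rule M(3)[OF that])
  qed (rule that)
  define L where "L = (\<lambda>x. x [^] k) ` M"
  have L: "subgroup L G" "L \<subseteq> M" unfolding L_def using subgroup_powers[OF M(1)] subgroup_nat_pow_closed[OF D(1)] by auto
  have nL: "normalizes G P L" unfolding normalizes_def
  proof (intro ballI)
    fix h x assume h: "h \<in> P" and x: "x \<in> L"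
    then obtain y where y: "y \<in> M" "x = y [^] k" unfolding L_def by blast
    have "h \<otimes> x \<otimes> inv h = (h \<otimes> y \<otimes> inv h) [^] k" using conj_nat_pow y h by simp
    moreover have "h \<otimes> y \<otimes> inv h \<in> M" using M(4) h y unfolding normalizes_def by blast
    ultimately show "h \<otimes> x \<otimes> inv h \<in> L" unfolding L_def by blast
  qed
  have "L \<inter> P = {\<one>}" using L M(5) subgroup.one_closed[OF L(1)] P.one_closed by blast
  moreover have "fin_cover G (L <#> P) (carrier G)"
  proof -
    obtain S where S: "finite S" "S \<subseteq> carrier G" "generate G S = M" 
      using M(2) unfolding finitely_generated_in_def by blast
    have SM: "S \<subseteq> M" using S(3) generate.incl[of _ S G] by blast
    have "fin_cover G L M" using fin_cover_powers[OF M(1) k(1) S(1) SM] S(3) unfolding L_def by simp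
    then have "fin_cover G (P <#> L) (P <#> M)" using fin_cover_mult_left L M.subset P.subset by blast
    then have "fin_cover G (L <#> P) (M <#> P)" 
      using normalizes_mult_commute[OF nL P L(1)] normalizes_mult_commute[OF M(4) P D(1)] by simp
    then show ?thesis using fin_cover_trans M(6) subgroup_mult_normalizes[OF nL P L(1)] by blast
  qed
  moreover have "F \<inter> (L <#> P) = {}"
  proof -
    have False if "f \<in> F" "f = l \<otimes> p" "l \<in> L" "p \<in> P" for f l p
    proof -
      have "l \<in> E" unfolding E_def using that L(2) by blast
      then show False using that k(2) unfolding L_def by blast
    qed
    then show ?thesis unfolding set_mult_def by blast
  qed
  ultimately show thesis using that[OF L(1) nL] by blast
qed

text \<open>Averaging over \<open>H\<close> is possible because \<open>H\<close> acts through a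
  finite group on \<open>V\<close>, a torsion-free abelian subgroup of finite index in
  \<open>N\<close>. Being generated by powers of elements of \<open>N\<close>, the subgroup
  \<open>V\<close> is normalized by \<open>H\<close>, which may fail for \<open>B\<close>.\<close>

lemma normal_complement:
  assumes N: "N \<lhd> G" and B: "abelian_sub G B" "B \<subseteq> N" "finitely_generated_in G B" "fin_cover G B N"
    and C: "fin_cover G (N <#> cent G N) (carrier G)" and H: "subgroup H G"
  obtains M where "subgroup M G" "M \<subseteq> N" "normalizes G H M" "M \<inter> H = {\<one>}" "fin_cover G (M <#> H) (N <#> H)"
proof -
  interpret N: normal N G by fact
  interpret H: subgroup H G by fact
  note D = abelian_subD[OF B(1)]
  interpret B: subgroup B G by (rule D(1))
  have Ns: "subgroup N G" by (rule N.subgroup_axioms)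
  have nN: "normalizes G H N" unfolding normalizes_def using N.inv_op_closed2[OF H.mem_carrier] by simp
  obtain k :: nat where k: "generate G ((\<lambda>x. x [^] k) ` N) \<subseteq> B" 
    "\<And>x n. \<lbrakk>x \<in> generate G ((\<lambda>x. x [^] k) ` N); n > (0::nat); x [^] n = \<one>\<rbrakk> \<Longrightarrow> x = \<one>"
    "fin_cover G (generate G ((\<lambda>x. x [^] k) ` N)) N"
    using torsion_free_powers[OF Ns B] by blast
  define V where "V = generate G ((\<lambda>x. x [^] k) ` N)"
  have Vs: "subgroup V G" unfolding V_def by (rule generate_is_subgroup) auto
  have Vab: "abelian_sub G V" using abelian_sub_subset[OF B(1) Vs] k(1) unfolding V_def by simp
  have VN: "V \<subseteq> N" using k(1) B(2) unfolding V_def by blast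
  have nV: "normalizes G H V" unfolding V_def by (intro normalizes_generate_powers H Ns nN)
  have U: "subgroup (H \<inter> V) G" by (rule subgroups_Inter_pair[OF H Vs])
  have cV: "subgroup (cent G V) G" by (rule cent_subgroup[OF subgroup.subset[OF Vs]])
  have cN: "cent G N \<subseteq> carrier G" unfolding cent_def by blast
  \<comment> \<open>Both \<open>cent G N\<close> and the abelian group \<open>B\<close> centralize
    \<open>V\<close>, and finitely many translates of \<open>cent G N <#> B\<close> cover
    \<open>cent G N <#> N\<close>. So the centralizer of \<open>V\<close> has finite index in
    \<open>G\<close>.\<close>
  have "cent G N <#> B \<subseteq> cent G V"
  proof
    fix x assume "x \<in> cent G N <#> B"
    then obtain c b where cb: "c \<in> cent G N" "b \<in> B" "x = c \<otimes> b" unfolding set_mult_def by blast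
    have "c \<in> cent G V" using cb VN unfolding cent_def by blast
    moreover have "b \<in> cent G V" using cb k(1) D(3) unfolding cent_def V_def by auto
    ultimately show "x \<in> cent G V" using subgroup.m_closed[OF cV] cb by blast
  qed
  moreover have "fin_cover G (cent G N <#> B) (cent G N <#> N)"
    using fin_cover_mult_left[OF B(4) B.subset N.subset cN] .
  moreover have "cent G N <#> N = N <#> cent G N"
    unfolding set_mult_def cent_def by force
  ultimately have "fin_cover G (cent G V) (N <#> cent G N)" using fin_cover_mono by (metis order.refl)
  then have "fin_cover G (cent G V) (carrier G)" using fin_cover_trans C cV by blast
  then have fcV: "fin_cover G (cent G V \<inter> H) H" using fin_cover_Int[OF _ cV H H.subset] by blast
  obtain M where M: "subgroup M G" "M \<subseteq> V" "normalizes G H M" "M \<inter> (H \<inter> V) = {\<one>}" "fin_cover G (M <#> (H \<inter> V)) V"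
  proof (rule invariant_complement[OF Vab _ _ H nV _ _ _ fcV U])
    show "finitely_generated_in G V" 
    proof -
      obtain S where S: "finite S" "S \<subseteq> carrier G" "generate G S = B" 
        using B(3) unfolding finitely_generated_in_def by blast
      have "S \<subseteq> B" using S(3) generate.incl[of _ S G] by blast
      then show ?thesis using finitely_generated_abelian_subgroup[OF B(1) S(1) _ Vs] S(3) k(1) unfolding V_def by blast
    qed
    show "x = \<one>" if "x \<in> V" "n > 0" "x [^] n = \<one>" for x and n :: nat using k(2) that unfolding V_def by blast
    show "cent G V \<inter> H \<subseteq> H" "cent G V \<inter> H \<subseteq> cent G V" "H \<inter> V \<subseteq> V" by auto
    show "subgroup (cent G V \<inter> H) G" by (rule subgroups_Inter_pair[OF cV H])
    show "normalizes G H (H \<inter> V)" by (rule normalizes_Int[OF normalizes_self[OF H] nV])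
  qed (rule that)
  interpret M: subgroup M G by (rule M(1))
  have MH: "M \<inter> H = {\<one>}" using M(2,4) by blast
  have HM: "subgroup (M <#> H) G" "M <#> H = H <#> M" 
    using subgroup_mult_normalizes[OF M(3) H M(1)] normalizes_mult_commute[OF M(3) H M(1)] by auto
  have UV: "M <#> (H \<inter> V) \<subseteq> carrier G" by (auto simp: set_mult_def)
  have "fin_cover G (M <#> (H \<inter> V)) N"
  proof (rule fin_cover_trans[OF M(5)])
    show "fin_cover G V N" using k(3) unfolding V_def .
    have "normalizes G (H \<inter> V) M" by (rule normalizes_mono[OF M(3)]) auto
    then show "subgroup (M <#> (H \<inter> V)) G" using subgroup_mult_normalizes U M(1) by blast
  qed
  then have "fin_cover G (H <#> (M <#> (H \<inter> V))) (H <#> N)"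
    using fin_cover_mult_left[OF _ UV N.subset H.subset] by blast
  \<comment> \<open>As a set \<open>H\<close> commutes with \<open>M\<close>, and it absorbs
    \<open>H \<inter> V\<close>.\<close>
  moreover have "H <#> (M <#> (H \<inter> V)) \<subseteq> M <#> H"
  proof -
    have "H <#> (M <#> (H \<inter> V)) = M <#> H <#> (H \<inter> V)"
      using set_mult_assoc[of H M "H \<inter> V"] HM(2) H.subset M.subset by auto
    also have "\<dots> = M <#> (H <#> (H \<inter> V))"
      using set_mult_assoc[of M H "H \<inter> V"] H.subset M.subset by auto
    also have "\<dots> \<subseteq> M <#> H" by (rule mono_set_mult) (auto simp: set_mult_def)
    finally show ?thesis .
  qed
  ultimately have "fin_cover G (M <#> H) (N <#> H)"
    using fin_cover_mono normalizes_mult_commute[OF nN H Ns] by (metis order.refl)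
  moreover have "M \<subseteq> N" using M(2) VN by blast
  ultimately show thesis using that[OF M(1) _ M(3) MH] by blast
qed

end

section \<open>Virtual retractions from commuting actions\<close>

text \<open>The counting step of Marshall Hall's theorem, with types. A partial injection that
  shifts types by \<open>T\<close> uses as many elements of type \<omega> in its domain as of type
  \<open>T \<omega>\<close> in its range. All types being equally frequent, the leftovers
  \<open>R1 \<omega>\<close> and \<open>R2 \<omega>\<close> have the same size.\<close>

lemma extend_bij_betw_typed:
  assumes fin: "finite P" and E: "E1 \<subseteq> P" "E2 \<subseteq> P" and \<sigma>0: "bij_betw \<sigma>0 E1 E2"
    and w: "\<And>e. e \<in> E1 \<Longrightarrow> w (\<sigma>0 e) = T (w e)" "w ` P \<subseteq> \<Omega>" and T: "bij_betw T \<Omega> \<Omega>"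
    and c: "\<And>\<omega>. \<omega> \<in> \<Omega> \<Longrightarrow> card {p \<in> P. w p = \<omega>} = c"
  obtains \<sigma> where "bij_betw \<sigma> P P" "\<And>e. e \<in> E1 \<Longrightarrow> \<sigma> e = \<sigma>0 e" "\<And>p. p \<in> P \<Longrightarrow> w (\<sigma> p) = T (w p)"
proof -
  have Tinj: "inj_on T \<Omega>" and Tim: "T ` \<Omega> = \<Omega>" using T by (auto simp: bij_betw_def)
  have \<sigma>0i: "inj_on \<sigma>0 E1" and \<sigma>0im: "\<sigma>0 ` E1 = E2" using \<sigma>0 by (auto simp: bij_betw_def)
  define R1 where "R1 \<omega> = {p \<in> P - E1. w p = \<omega>}" for \<omega>
  define R2 where "R2 \<omega> = {p \<in> P - E2. w p = T \<omega>}" for \<omega>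
  have "\<exists>b. bij_betw b (R1 \<omega>) (R2 \<omega>)" if \<omega>: "\<omega> \<in> \<Omega>" for \<omega>
  proof -
    have T\<omega>: "T \<omega> \<in> \<Omega>" using \<omega> Tim by blast
    have "\<sigma>0 ` {e \<in> E1. w e = \<omega>} = {e \<in> E2. w e = T \<omega>}"
    proof (intro subset_antisym subsetI)
      fix y assume "y \<in> {e \<in> E2. w e = T \<omega>}"
      then obtain e where e: "e \<in> E1" "y = \<sigma>0 e" "w y = T \<omega>" using \<sigma>0im by blast
      then have "T (w e) = T \<omega>" using w(1) by simp
      then have "w e = \<omega>" using Tinj \<omega> w(2) E e by (auto dest: inj_onD)
      then show "y \<in> \<sigma>0 ` {e \<in> E1. w e = \<omega>}" using e by blast
    qed (use \<sigma>0im w(1) in auto)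
    then have "card {e \<in> E1. w e = \<omega>} = card {e \<in> E2. w e = T \<omega>}"
      using card_image[of \<sigma>0 "{e \<in> E1. w e = \<omega>}"] inj_on_subset[OF \<sigma>0i] by fastforce
    moreover have "R1 \<omega> = {p \<in> P. w p = \<omega>} - {e \<in> E1. w e = \<omega>}" "R2 \<omega> = {p \<in> P. w p = T \<omega>} - {e \<in> E2. w e = T \<omega>}"
      unfolding R1_def R2_def by auto
    moreover have "{e \<in> E1. w e = \<omega>} \<subseteq> {p \<in> P. w p = \<omega>}" "{e \<in> E2. w e = T \<omega>} \<subseteq> {p \<in> P. w p = T \<omega>}" using E by auto
    moreover have "finite {e \<in> E1. w e = \<omega>}" "finite {e \<in> E2. w e = T \<omega>}" 
      by (rule finite_subset[OF _ fin]; use E in auto)+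
    ultimately have "card (R1 \<omega>) = card (R2 \<omega>)" using c[OF \<omega>] c[OF T\<omega>] by (simp add: card_Diff_subset)
    moreover have "finite (R1 \<omega>)" "finite (R2 \<omega>)" unfolding R1_def R2_def using fin by auto
    ultimately show ?thesis by (simp add: finite_same_card_bij)
  qed
  then obtain b where b: "\<And>\<omega>. \<omega> \<in> \<Omega> \<Longrightarrow> bij_betw (b \<omega>) (R1 \<omega>) (R2 \<omega>)" by metis
  define \<sigma> where "\<sigma> p = (if p \<in> E1 then \<sigma>0 p else b (w p) p)" for p
  have w\<Omega>: "w p \<in> \<Omega>" if "p \<in> P" for p using w(2) that by blast
  have bR: "b (w p) p \<in> R2 (w p)" if "p \<in> P" "p \<notin> E1" for p
    using bij_betwE[OF b[OF w\<Omega>[OF that(1)]]] that unfolding R1_def by blast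
  have \<sigma>w: "w (\<sigma> p) = T (w p)" if "p \<in> P" for p
    using w(1) bR[OF that] unfolding \<sigma>_def R2_def by auto
  have \<sigma>P: "\<sigma> p \<in> P" if "p \<in> P" for p
    using bR[OF that] \<sigma>0im E unfolding \<sigma>_def R2_def by auto
  have inj: "inj_on \<sigma> P"
  proof (rule inj_onI)
    fix p q assume pq: "p \<in> P" "q \<in> P" "\<sigma> p = \<sigma> q"
    then have "T (w p) = T (w q)" using \<sigma>w by metis
    then have ww: "w p = w q" using Tinj w\<Omega> pq by (auto dest: inj_onD)
    have E2: "\<sigma> p \<in> E2 \<longleftrightarrow> p \<in> E1" if "p \<in> P" for p
      using that bR[OF that] \<sigma>0im unfolding \<sigma>_def R2_def by auto
    show "p = q"
    proof (cases "p \<in> E1")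
      case True
      then have "q \<in> E1" using E2[OF pq(1)] E2[OF pq(2)] pq(3) by simp
      then show ?thesis using True pq(3) \<sigma>0i unfolding \<sigma>_def by (auto dest: inj_onD)
    next
      case False
      then have "q \<notin> E1" using E2[OF pq(1)] E2[OF pq(2)] pq(3) by simp
      then have "b (w p) p = b (w p) q" "p \<in> R1 (w p)" "q \<in> R1 (w p)" 
        using False pq ww unfolding \<sigma>_def R1_def by auto
      then show ?thesis using b[OF w\<Omega>[OF pq(1)]] by (auto simp: bij_betw_def dest: inj_onD)
    qed
  qed
  have "\<sigma> ` P \<subseteq> P" using \<sigma>P by blast
  then have "bij_betw \<sigma> P P" using inj fin endo_inj_surj[of P \<sigma>] by (simp add: bij_betw_def)
  then show thesis
  proof (rule that)
    show "\<sigma> e = \<sigma>0 e" if "e \<in> E1" for e using that unfolding \<sigma>_def by simp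
  qed (rule \<sigma>w)
qed

text \<open>The right half of a biset. Freeness means that an equivariant map is determined by its
  values on one representative of each orbit, and that these values can be prescribed at
  will.\<close>

locale free_right_action = group G for G (structure) +
  fixes H :: "'a set" and Y :: "'c set" and \<delta> :: "'c \<Rightarrow> 'a \<Rightarrow> 'c"
  assumes H: "subgroup H G"
    and closed: "\<lbrakk>y \<in> Y; h \<in> H\<rbrakk> \<Longrightarrow> \<delta> y h \<in> Y"
    and act_one: "y \<in> Y \<Longrightarrow> \<delta> y \<one> = y"
    and act_mult: "\<lbrakk>y \<in> Y; h \<in> H; k \<in> H\<rbrakk> \<Longrightarrow> \<delta> (\<delta> y h) k = \<delta> y (h \<otimes> k)"
    and free: "\<lbrakk>y \<in> Y; h \<in> H; k \<in> H; \<delta> y h = \<delta> y k\<rbrakk> \<Longrightarrow> h = k"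
begin

sublocale H: subgroup H G by (rule H)

lemma act_inv: "\<lbrakk>y \<in> Y; h \<in> H\<rbrakk> \<Longrightarrow> \<delta> (\<delta> y h) (inv h) = y"
  by (simp add: act_mult act_one)

definition orb :: "'c \<Rightarrow> 'c set" where
  "orb y = \<delta> y ` H"

lemma orbE:
  assumes "z \<in> orb y"
  obtains h where "h \<in> H" "z = \<delta> y h"
  using assms unfolding orb_def by blast

lemma orb_self: "y \<in> Y \<Longrightarrow> y \<in> orb y"
  unfolding orb_def using act_one by (metis H.one_closed imageI)

lemma orb_act: 
  assumes "y \<in> Y" "h \<in> H"
  shows "orb (\<delta> y h) = orb y"
proof (intro subset_antisym subsetI)
  fix z assume "z \<in> orb (\<delta> y h)"
  then show "z \<in> orb y" unfolding orb_def using assms act_mult by auto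
next
  fix z assume "z \<in> orb y"
  then obtain k where k: "k \<in> H" "z = \<delta> y k" unfolding orb_def by blast
  have "z = \<delta> (\<delta> y h) (inv h \<otimes> k)" using k assms act_mult by simp
  then show "z \<in> orb (\<delta> y h)" unfolding orb_def using assms k by blast
qed

lemma orb_eqD:
  assumes "y \<in> Y" "z \<in> Y" "orb y = orb z"
  obtains h where "h \<in> H" "z = \<delta> y h"
  using assms orb_self[OF assms(2)] unfolding orb_def by blast

lemma orb_eq_mem:
  assumes "y \<in> Y" "z \<in> orb y"
  shows "z \<in> Y" "orb z = orb y"
proof -
  obtain h where "h \<in> H" "z = \<delta> y h" using assms(2) unfolding orb_def by blast
  then show "z \<in> Y" "orb z = orb y" using orb_act closed assms(1) by simp_all
qed

text \<open>\<open>adm y z\<close> permits \<tau> to send \<open>y\<close> to \<open>z\<close>, and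
  the type \<open>w\<close> tells between which orbits this can happen after a translation by
  \<open>H\<close>. The extension is found for the orbits as a permutation respecting types, and is
  then lifted by prescribing an admissible image of one representative per orbit.\<close>

lemma equivariant_extension:
  fixes adm :: "'c \<Rightarrow> 'c \<Rightarrow> bool" and w :: "'c \<Rightarrow> 'w" and T :: "'w \<Rightarrow> 'w"
  assumes fin: "finite (orb ` Y)"
    and adm: "\<And>y z h. \<lbrakk>y \<in> Y; z \<in> Y; h \<in> H; adm y z\<rbrakk> \<Longrightarrow> adm (\<delta> y h) (\<delta> z h)"
    and E: "E \<subseteq> Y" "\<And>y h. \<lbrakk>y \<in> E; h \<in> H\<rbrakk> \<Longrightarrow> \<delta> y h \<in> E"
    and \<tau>0: "inj_on \<tau>0 E" "\<tau>0 ` E \<subseteq> Y" "\<And>y h. \<lbrakk>y \<in> E; h \<in> H\<rbrakk> \<Longrightarrow> \<tau>0 (\<delta> y h) = \<delta> (\<tau>0 y) h"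
      "\<And>y. y \<in> E \<Longrightarrow> adm y (\<tau>0 y)"
    and w: "w ` Y \<subseteq> \<Omega>" "\<And>y h. \<lbrakk>y \<in> Y; h \<in> H\<rbrakk> \<Longrightarrow> w (\<delta> y h) = w y"
    and T: "bij_betw T \<Omega> \<Omega>"
    and wadm: "\<And>y z. \<lbrakk>y \<in> Y; z \<in> Y; adm y z\<rbrakk> \<Longrightarrow> w z = T (w y)"
      "\<And>y z. \<lbrakk>y \<in> Y; z \<in> Y; w z = T (w y)\<rbrakk> \<Longrightarrow> \<exists>h\<in>H. adm y (\<delta> z h)"
    and c: "\<And>\<omega>. \<omega> \<in> \<Omega> \<Longrightarrow> card (orb ` {y \<in> Y. w y = \<omega>}) = c"
  obtains \<tau> where "bij_betw \<tau> Y Y" "\<And>y h. \<lbrakk>y \<in> Y; h \<in> H\<rbrakk> \<Longrightarrow> \<tau> (\<delta> y h) = \<delta> (\<tau> y) h"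
    "\<And>y. y \<in> E \<Longrightarrow> \<tau> y = \<tau>0 y" "\<And>y. y \<in> Y \<Longrightarrow> adm y (\<tau> y)"
proof -
  define P where "P = orb ` Y"
  define rep where "rep Q = (SOME y. y \<in> Q)" for Q :: "'c set"
  have rep: "rep Q \<in> Q" "rep Q \<in> Y" "orb (rep Q) = Q" if Q: "Q \<in> P" for Q
  proof -
    obtain y where y: "y \<in> Y" "Q = orb y" using Q unfolding P_def by blast
    show 1: "rep Q \<in> Q" unfolding rep_def y(2) by (rule someI[of "\<lambda>z. z \<in> orb y", OF orb_self[OF y(1)]])
    show "rep Q \<in> Y" "orb (rep Q) = Q" using orb_eq_mem[OF y(1)] 1 y(2) by auto
  qed
  have oP: "orb y \<in> P" if "y \<in> Y" for y using that unfolding P_def by blast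
  have repE: "rep (orb y) \<in> E" if "y \<in> E" for y
  proof -
    have "rep (orb y) \<in> orb y" using rep(1)[OF oP] that E(1) by blast
    then obtain h where "h \<in> H" "rep (orb y) = \<delta> y h" by (rule orbE)
    then show ?thesis using E(2)[OF that] by simp
  qed
  define E1 where "E1 = orb ` E"
  define E2 where "E2 = orb ` \<tau>0 ` E"
  define \<sigma>0 where "\<sigma>0 Q = orb (\<tau>0 (rep Q))" for Q
  define w' where "w' Q = w (rep Q)" for Q
  have w'o: "w' (orb y) = w y" if y: "y \<in> Y" for y
  proof -
    obtain h where "h \<in> H" "rep (orb y) = \<delta> y h" 
      using orb_eqD[OF y rep(2)[OF oP[OF y]]] rep(3)[OF oP[OF y]] by metis
    then show ?thesis unfolding w'_def using w(2) y by simp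
  qed
  have \<sigma>0o: "\<sigma>0 (orb y) = orb (\<tau>0 y)" if y: "y \<in> E" for y
  proof -
    have yY: "y \<in> Y" using y E by blast
    obtain h where "h \<in> H" "rep (orb y) = \<delta> y h" 
      using orb_eqD[OF yY rep(2)[OF oP[OF yY]]] rep(3)[OF oP[OF yY]] by metis
    then show ?thesis unfolding \<sigma>0_def using \<tau>0 y orb_act by auto
  qed
  have bij0: "bij_betw \<sigma>0 E1 E2"
  proof (rule bij_betw_imageI)
    show "inj_on \<sigma>0 E1"
    proof (rule inj_onI)
      fix Q Q' assume "Q \<in> E1" "Q' \<in> E1" and e: "\<sigma>0 Q = \<sigma>0 Q'"
      then obtain y y' where y: "y \<in> E" "Q = orb y" "y' \<in> E" "Q' = orb y'" unfolding E1_def by blast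
      then have "orb (\<tau>0 y) = orb (\<tau>0 y')" using e \<sigma>0o by simp
      then obtain h where h: "h \<in> H" "\<tau>0 y' = \<delta> (\<tau>0 y) h" using orb_eqD y \<tau>0(2) by (metis image_subset_iff)
      then have "\<tau>0 y' = \<tau>0 (\<delta> y h)" using \<tau>0(3) y by simp
      then have "y' = \<delta> y h" using \<tau>0(1) y h E(2) by (auto dest: inj_onD)
      then show "Q = Q'" using orb_act y h E by auto
    qed
    show "\<sigma>0 ` E1 = E2" unfolding E1_def E2_def using \<sigma>0o by (auto simp: image_image)
  qed
  have Pw: "{p \<in> P. w' p = \<omega>} = orb ` {y \<in> Y. w y = \<omega>}" for \<omega> unfolding P_def using w'o by auto
  obtain \<sigma> where \<sigma>: "bij_betw \<sigma> P P" "\<And>e. e \<in> E1 \<Longrightarrow> \<sigma> e = \<sigma>0 e" "\<And>p. p \<in> P \<Longrightarrow> w' (\<sigma> p) = T (w' p)"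
  proof (rule extend_bij_betw_typed[of P E1 E2 \<sigma>0 w' T \<Omega> c])
    show "finite P" using fin unfolding P_def .
    show "E1 \<subseteq> P" "E2 \<subseteq> P" unfolding E1_def E2_def P_def using E \<tau>0 by auto
    show "w' ` P \<subseteq> \<Omega>" using w(1) w'o unfolding P_def by auto
    show "w' (\<sigma>0 e) = T (w' e)" if "e \<in> E1" for e
    proof -
      obtain y where y: "y \<in> E" "e = orb y" using \<open>e \<in> E1\<close> unfolding E1_def by blast
      then have "y \<in> Y" "\<tau>0 y \<in> Y" using E \<tau>0 by auto
      then show ?thesis using y \<sigma>0o w'o wadm(1) \<tau>0(4) by simp
    qed
    show "card {p \<in> P. w' p = \<omega>} = c" if "\<omega> \<in> \<Omega>" for \<omega> unfolding Pw using c that .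
  qed (use bij0 T that in auto)
  \<comment> \<open>The image of the representative of \<open>Q\<close>: dictated by
    \<open>\<tau>0\<close> over \<open>E1\<close>, and elsewhere any admissible point of the target
    orbit.\<close>
  have "\<exists>r. r \<in> \<sigma> Q \<and> adm (rep Q) r \<and> (Q \<in> E1 \<longrightarrow> r = \<tau>0 (rep Q))" if Q: "Q \<in> P" for Q
  proof (cases "Q \<in> E1")
    case True
    then obtain y where y: "y \<in> E" "Q = orb y" unfolding E1_def by blast
    have "rep Q \<in> E" using repE y by simp
    moreover have "\<tau>0 (rep Q) \<in> \<sigma> Q" using \<sigma>(2)[OF True] orb_self \<tau>0(2) \<open>rep Q \<in> E\<close> unfolding \<sigma>0_def by auto
    ultimately show ?thesis using \<tau>0(4) by blast
  next
    case False
    have \<sigma>Q: "\<sigma> Q \<in> P" using \<sigma>(1) Q by (auto simp: bij_betw_def)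
    have "w (rep (\<sigma> Q)) = T (w (rep Q))" using \<sigma>(3)[OF Q] unfolding w'_def .
    then obtain h where h: "h \<in> H" "adm (rep Q) (\<delta> (rep (\<sigma> Q)) h)" using wadm(2) rep(2) Q \<sigma>Q by blast
    moreover have "\<delta> (rep (\<sigma> Q)) h \<in> orb (rep (\<sigma> Q))" unfolding orb_def using h(1) by (rule imageI)
    then have "\<delta> (rep (\<sigma> Q)) h \<in> \<sigma> Q" using rep(3)[OF \<sigma>Q] by simp
    ultimately show ?thesis using False by blast
  qed
  then obtain r where r: "\<And>Q. Q \<in> P \<Longrightarrow> r Q \<in> \<sigma> Q" "\<And>Q. Q \<in> P \<Longrightarrow> adm (rep Q) (r Q)" 
    "\<And>Q. \<lbrakk>Q \<in> P; Q \<in> E1\<rbrakk> \<Longrightarrow> r Q = \<tau>0 (rep Q)" by metis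
  have rY: "r Q \<in> Y" "orb (r Q) = \<sigma> Q" if Q: "Q \<in> P" for Q
  proof -
    have \<sigma>Q: "\<sigma> Q \<in> P" using \<sigma>(1) Q by (auto simp: bij_betw_def)
    then show "r Q \<in> Y" "orb (r Q) = \<sigma> Q" using orb_eq_mem[OF rep(2)[OF \<sigma>Q]] rep(3)[OF \<sigma>Q] r(1)[OF Q] by auto
  qed
  \<comment> \<open>The coordinate of \<open>y\<close> with respect to the representative of its
    orbit, unique by freeness.\<close>
  define hh where "hh y = (THE h. h \<in> H \<and> y = \<delta> (rep (orb y)) h)" for y
  have hh: "hh (\<delta> (rep Q) h) = h" if "Q \<in> P" "h \<in> H" for Q h
  proof -
    have o: "orb (\<delta> (rep Q) h) = Q" using orb_act rep that by simp
    show ?thesis unfolding hh_def o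
      by (rule the_equality) (use that free[OF rep(2)[OF that(1)]] in auto)
  qed
  define \<tau> where "\<tau> y = \<delta> (r (orb y)) (hh y)" for y
  have \<tau>: "\<tau> (\<delta> (rep Q) h) = \<delta> (r Q) h" if "Q \<in> P" "h \<in> H" for Q h
    unfolding \<tau>_def using hh[OF that] orb_act rep that by simp
  have Yform: "\<exists>Q\<in>P. \<exists>h\<in>H. y = \<delta> (rep Q) h" if y: "y \<in> Y" for y
    using orb_eqD[OF rep(2)[OF oP[OF y]] y] rep(3)[OF oP[OF y]] oP[OF y] by metis
  have eqv: "\<tau> (\<delta> y h) = \<delta> (\<tau> y) h" if yh: "y \<in> Y" "h \<in> H" for y h
  proof -
    obtain Q k where Q: "Q \<in> P" "k \<in> H" "y = \<delta> (rep Q) k" using Yform[OF yh(1)] by blast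
    then show ?thesis using \<tau> yh rep(2) rY(1) act_mult by simp
  qed
  have ext: "\<tau> y = \<tau>0 y" if y: "y \<in> E" for y
  proof -
    obtain Q k where Q: "Q \<in> P" "k \<in> H" "y = \<delta> (rep Q) k" using Yform y E(1) by blast
    then have "Q = orb y" using orb_act rep by simp
    then have "Q \<in> E1" "rep Q \<in> E" using y repE unfolding E1_def by auto
    then show ?thesis using Q \<tau> r(3) \<tau>0(3) by simp
  qed
  have adm': "adm y (\<tau> y)" if y: "y \<in> Y" for y
  proof -
    obtain Q k where Q: "Q \<in> P" "k \<in> H" "y = \<delta> (rep Q) k" using Yform y by blast
    then show ?thesis using \<tau> r(2) adm rep(2) rY(1) by simp
  qed
  have "bij_betw \<tau> Y Y"
  proof (rule bij_betw_imageI)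
    show "inj_on \<tau> Y"
    proof (rule inj_onI)
      fix y z assume yz: "y \<in> Y" "z \<in> Y" "\<tau> y = \<tau> z"
      obtain Q k where Q: "Q \<in> P" "k \<in> H" "y = \<delta> (rep Q) k" using Yform yz by blast
      obtain R l where R: "R \<in> P" "l \<in> H" "z = \<delta> (rep R) l" using Yform yz by blast
      have e: "\<delta> (r Q) k = \<delta> (r R) l" using yz \<tau> Q R by simp
      have "orb (\<delta> (r Q) k) = \<sigma> Q" "orb (\<delta> (r R) l) = \<sigma> R" using orb_act rY Q R by auto
      then have "\<sigma> Q = \<sigma> R" using e by simp
      then have "Q = R" using \<sigma>(1) Q R by (auto simp: bij_betw_def dest: inj_onD)
      then show "y = z" using e free[OF rY(1)] Q R by auto
    qed
    show "\<tau> ` Y = Y"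
    proof (intro subset_antisym subsetI)
      fix z assume "z \<in> \<tau> ` Y"
      then obtain y where "y \<in> Y" "z = \<tau> y" by blast
      moreover obtain Q k where "Q \<in> P" "k \<in> H" "y = \<delta> (rep Q) k" using Yform \<open>y \<in> Y\<close> by blast
      ultimately show "z \<in> Y" using \<tau> rY closed by simp
    next
      fix z assume z: "z \<in> Y"
      then obtain Q where Q: "Q \<in> P" "orb z = \<sigma> Q" using \<sigma>(1) oP[OF z] by (auto simp: bij_betw_def)
      then obtain k where k: "k \<in> H" "z = \<delta> (r Q) k" using orb_eqD[OF rY(1) z] rY(2) by metis
      then have "z = \<tau> (\<delta> (rep Q) k)" using \<tau> Q by simp
      then show "z \<in> \<tau> ` Y" using closed rep(2) Q k by blast
    qed
  qed
  then show thesis using that eqv ext adm' by blast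
qed

text \<open>A homomorphism \<open>K \<rightarrow> H\<close> from a finite index subgroup of \<open>G\<close> corresponds to a set with commuting
  actions of \<open>G\<close> from the left and of \<open>H\<close> from the right, the latter free with finitely many
  orbits: \<open>K\<close> is the stabilizer of the orb of \<open>y0\<close>, and \<open>g y0 = y0 \<rho>(g)\<close>.\<close>

lemma virtual_retract_biset:
  assumes \<beta>: "\<And>g y. \<lbrakk>g \<in> carrier G; y \<in> Y\<rbrakk> \<Longrightarrow> \<beta> g y \<in> Y" "\<And>y. y \<in> Y \<Longrightarrow> \<beta> \<one> y = y"
      "\<And>g g' y. \<lbrakk>g \<in> carrier G; g' \<in> carrier G; y \<in> Y\<rbrakk> \<Longrightarrow> \<beta> (g \<otimes> g') y = \<beta> g (\<beta> g' y)"
    and comm: "\<And>g y h. \<lbrakk>g \<in> carrier G; y \<in> Y; h \<in> H\<rbrakk> \<Longrightarrow> \<beta> g (\<delta> y h) = \<delta> (\<beta> g y) h"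
    and fin: "finite (orb ` Y)" and y0: "y0 \<in> Y" "\<And>h. h \<in> H \<Longrightarrow> \<beta> h y0 = \<delta> y0 h"
  shows "virtual_retract G H"
proof -
  define K where "K = {g \<in> carrier G. \<beta> g y0 \<in> orb y0}"
  define \<rho> where "\<rho> g = (THE h. h \<in> H \<and> \<beta> g y0 = \<delta> y0 h)" for g
  have \<rho>I: "\<rho> g = h" if "h \<in> H" "\<beta> g y0 = \<delta> y0 h" for g h
    unfolding \<rho>_def by (rule the_equality) (use that free[OF y0(1)] in auto)
  have KI: "g \<in> K \<longleftrightarrow> g \<in> carrier G \<and> (\<exists>h\<in>H. \<beta> g y0 = \<delta> y0 h)" for g
    unfolding K_def orb_def by blast
  have mult: "\<beta> (a \<otimes> b) y0 = \<delta> y0 (h \<otimes> k)" 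
    if "a \<in> carrier G" "b \<in> carrier G" "h \<in> H" "k \<in> H" "\<beta> a y0 = \<delta> y0 h" "\<beta> b y0 = \<delta> y0 k" for a b h k
    using \<beta>(3)[OF that(1,2) y0(1)] that comm[OF that(1) y0(1) that(4)] act_mult[OF y0(1)] by simp
  have inv': "\<beta> (inv a) y0 = \<delta> y0 (inv h)" if "a \<in> carrier G" "h \<in> H" "\<beta> a y0 = \<delta> y0 h" for a h
  proof -
    have "y0 = \<beta> (inv a \<otimes> a) y0" using that(1) \<beta>(2)[OF y0(1)] by simp
    also have "\<dots> = \<beta> (inv a) (\<delta> y0 h)" using \<beta>(3)[of "inv a" a y0] that y0 by simp
    also have "\<dots> = \<delta> (\<beta> (inv a) y0) h" using comm that y0 by simp
    finally have "\<delta> y0 (inv h) = \<delta> (\<delta> (\<beta> (inv a) y0) h) (inv h)" by simp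
    then show ?thesis using act_inv \<beta>(1) y0 that by simp
  qed
  have K: "subgroup K G"
  proof (rule subgroupI)
    show "K \<subseteq> carrier G" unfolding K_def by blast
    have "\<one> \<in> K" unfolding K_def using \<beta>(2)[OF y0(1)] orb_self[OF y0(1)] by simp
    then show "K \<noteq> {}" by blast
    show "inv a \<in> K" if "a \<in> K" for a using that inv' unfolding KI by (meson H.m_inv_closed inv_closed)
    show "a \<otimes> b \<in> K" if "a \<in> K" "b \<in> K" for a b using that mult unfolding KI by (meson H.m_closed m_closed)
  qed
  \<comment> \<open>The inverse converts the left action into right cosets of \<open>K\<close>: if
    \<open>inv x\<close> and \<open>inv y\<close> send \<open>y0\<close> into the same orbit, then
    \<open>x \<otimes> inv y\<close> stabilizes the orbit of \<open>y0\<close>.\<close>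
  have "fin_cover G K (carrier G)"
  proof (rule fin_coverI_map[where f = "\<lambda>g. orb (\<beta> (inv g) y0)"])
    have "(\<lambda>g. orb (\<beta> (inv g) y0)) ` carrier G \<subseteq> orb ` Y" using \<beta>(1) y0 by auto
    then show "finite ((\<lambda>g. orb (\<beta> (inv g) y0)) ` carrier G)" using fin finite_subset by blast
    fix x y assume xy: "x \<in> carrier G" "y \<in> carrier G" "orb (\<beta> (inv x) y0) = orb (\<beta> (inv y) y0)"
    then obtain h where h: "h \<in> H" "\<beta> (inv y) y0 = \<delta> (\<beta> (inv x) y0) h" 
      using orb_eqD \<beta>(1) y0(1) by (metis inv_closed)
    have "\<beta> (x \<otimes> inv y) y0 = \<beta> x (\<beta> (inv y) y0)" using \<beta>(3) xy y0 by simp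
    also have "\<dots> = \<delta> (\<beta> x (\<beta> (inv x) y0)) h" using h comm \<beta>(1) xy y0 by simp
    also have "\<beta> x (\<beta> (inv x) y0) = \<beta> (x \<otimes> inv x) y0" using \<beta>(3)[of x "inv x" y0] xy y0 by simp
    also have "\<dots> = y0" using \<beta>(2)[OF y0(1)] xy by simp
    finally show "x \<otimes> inv y \<in> K" unfolding KI using xy h by blast
  qed auto
  then have Kfi: "finite_index G K" using K by (simp add: finite_index_iff)
  show ?thesis unfolding virtual_retract_def
  proof (intro conjI exI[of _ K] bexI[of _ \<rho>])
    show "subgroup H G" by (rule H)
    show "finite_index G K" by fact
    show "H \<subseteq> K" using y0(2) H.mem_carrier by (auto simp: KI)
    show "\<forall>h\<in>H. \<rho> h = h" using \<rho>I y0(2) by simp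
    show "\<rho> \<in> hom (G\<lparr>carrier := K\<rparr>) (G\<lparr>carrier := H\<rparr>)"
    proof (rule homI)
      fix x assume "x \<in> carrier (G\<lparr>carrier := K\<rparr>)"
      then obtain h where x: "x \<in> carrier G" "h \<in> H" "\<beta> x y0 = \<delta> y0 h" using KI by auto
      then show "\<rho> x \<in> carrier (G\<lparr>carrier := H\<rparr>)" using \<rho>I by simp
      fix y assume "y \<in> carrier (G\<lparr>carrier := K\<rparr>)"
      then obtain k where y: "y \<in> carrier G" "k \<in> H" "\<beta> y y0 = \<delta> y0 k" using KI by auto
      have "\<rho> (x \<otimes> y) = h \<otimes> k" using \<rho>I mult x y by simp
      then show "\<rho> (x \<otimes>\<^bsub>G\<lparr>carrier := K\<rparr>\<^esub> y) = \<rho> x \<otimes>\<^bsub>G\<lparr>carrier := H\<rparr>\<^esub> \<rho> y"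
        using \<rho>I x y by simp
    qed
  qed
qed

end

section \<open>Collapsing double cosets\<close>

lemma finite_image_factor:
  assumes "finite (f ` A)" "\<And>x y. \<lbrakk>x \<in> A; y \<in> A; f x = f y\<rbrakk> \<Longrightarrow> g x = g y"
  shows "finite (g ` A)"
proof -
  have "g ` A \<subseteq> (\<lambda>c. g (inv_into A f c)) ` f ` A"
  proof
    fix z assume "z \<in> g ` A"
    then obtain x where x: "x \<in> A" "z = g x" by blast
    have "g (inv_into A f (f x)) = g x"
      by (rule assms(2)) (use x in \<open>auto intro: inv_into_into f_inv_into_f\<close>)
    then show "z \<in> (\<lambda>c. g (inv_into A f c)) ` f ` A" using x by (auto simp: image_iff intro!: bexI[of _ x])
  qed
  then show ?thesis using assms(1) by (meson finite_imageI finite_subset)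
qed

definition left_act :: "('a, 'b) monoid_scheme \<Rightarrow> ('a \<Rightarrow> 'c \<Rightarrow> 'c) \<Rightarrow> 'c set \<Rightarrow> bool" where
  "left_act G \<beta> Y \<longleftrightarrow> (\<forall>g\<in>carrier G. \<forall>y\<in>Y. \<beta> g y \<in> Y) \<and> (\<forall>y\<in>Y. \<beta> \<one>\<^bsub>G\<^esub> y = y) \<and>
    (\<forall>g\<in>carrier G. \<forall>g'\<in>carrier G. \<forall>y\<in>Y. \<beta> (g \<otimes>\<^bsub>G\<^esub> g') y = \<beta> g (\<beta> g' y))"

lemma left_actD:
  assumes "left_act G \<beta> Y"
  shows "\<lbrakk>g \<in> carrier G; y \<in> Y\<rbrakk> \<Longrightarrow> \<beta> g y \<in> Y" "y \<in> Y \<Longrightarrow> \<beta> \<one>\<^bsub>G\<^esub> y = y"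
    "\<lbrakk>g \<in> carrier G; g' \<in> carrier G; y \<in> Y\<rbrakk> \<Longrightarrow> \<beta> (g \<otimes>\<^bsub>G\<^esub> g') y = \<beta> g (\<beta> g' y)"
  using assms unfolding left_act_def by blast+

text \<open>The group \<open>G\<close> behaves like the HNN-extension of \<open>A\<close> with stable letter \<open>t\<close> and associated
  subgroup \<open>N\<close>; the universal property is only needed for permutations.\<close>

locale normal_hnn = group G for G (structure) +
  fixes A N :: "'a set" and t :: 'a
  assumes A: "subgroup A G" and N: "N \<lhd> G" and NA: "N \<subseteq> A" and t: "t \<in> carrier G"
    and word_induct: "\<And>P g. \<lbrakk>g \<in> carrier G; P \<one>; 
        \<And>a g. \<lbrakk>a \<in> A; g \<in> carrier G; P g\<rbrakk> \<Longrightarrow> P (a \<otimes> g);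
        \<And>g. \<lbrakk>g \<in> carrier G; P g\<rbrakk> \<Longrightarrow> P (t \<otimes> g);
        \<And>g. \<lbrakk>g \<in> carrier G; P g\<rbrakk> \<Longrightarrow> P (inv t \<otimes> g)\<rbrakk> \<Longrightarrow> P g"
    and universal: "\<And>(Y :: (nat \<times> 'a set) set) \<alpha> \<tau>. 
      \<lbrakk>\<And>a y. \<lbrakk>a \<in> A; y \<in> Y\<rbrakk> \<Longrightarrow> \<alpha> a y \<in> Y; \<And>y. y \<in> Y \<Longrightarrow> \<alpha> \<one> y = y;
       \<And>a b y. \<lbrakk>a \<in> A; b \<in> A; y \<in> Y\<rbrakk> \<Longrightarrow> \<alpha> (a \<otimes> b) y = \<alpha> a (\<alpha> b y);
       bij_betw \<tau> Y Y; \<And>n y. \<lbrakk>n \<in> N; y \<in> Y\<rbrakk> \<Longrightarrow> \<alpha> n (\<tau> y) = \<tau> (\<alpha> (inv t \<otimes> n \<otimes> t) y)\<rbrakk> \<Longrightarrow>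
      \<exists>\<beta>. left_act G \<beta> Y \<and> (\<forall>a\<in>A. \<forall>y\<in>Y. \<beta> a y = \<alpha> a y) \<and> (\<forall>y\<in>Y. \<beta> t y = \<tau> y)"
begin

sublocale A: subgroup A G by (rule A)
sublocale N: normal N G by (rule N)

lemma cent_N_subgroup: "subgroup (cent G N) G"
  by (rule cent_subgroup[OF N.subset])

sublocale Z: subgroup "cent G N" G by (rule cent_N_subgroup)

lemma centD: "\<lbrakk>z \<in> cent G N; n \<in> N\<rbrakk> \<Longrightarrow> z \<otimes> n = n \<otimes> z"
  unfolding cent_def by blast

lemma cent_conj:
  assumes g: "g \<in> carrier G" and z: "z \<in> cent G N"
  shows "g \<otimes> z \<otimes> inv g \<in> cent G N"
  unfolding cent_def
proof (intro CollectI conjI ballI)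
  show "g \<otimes> z \<otimes> inv g \<in> carrier G" using g z by simp
  fix n assume n: "n \<in> N"
  define n' where "n' = inv g \<otimes> n \<otimes> g"
  have n': "n' \<in> N" unfolding n'_def using N.inv_op_closed1[OF g n] .
  have nn: "n = g \<otimes> n' \<otimes> inv g" unfolding n'_def using g n by (simp add: m_assoc)
  have "g \<otimes> z \<otimes> inv g \<otimes> n = g \<otimes> (z \<otimes> n') \<otimes> inv g" unfolding nn using g z n' by (simp add: m_assoc)
  also have "z \<otimes> n' = n' \<otimes> z" by (rule centD[OF z n'])
  also have "g \<otimes> (n' \<otimes> z) \<otimes> inv g = n \<otimes> (g \<otimes> z \<otimes> inv g)" unfolding nn using g z n' by (simp add: m_assoc)
  finally show "g \<otimes> z \<otimes> inv g \<otimes> n = n \<otimes> (g \<otimes> z \<otimes> inv g)" .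
qed

text \<open>\<open>pt\<close> attaches points of \<open>Y\<close> to group elements. For
  \<open>t\<close> the move is prescribed only if both ends lie in \<open>Q\<close>, where the
  partial action is known. For \<open>A\<close> there is no such restriction, because the
  construction contains whole orbits under \<open>A\<close>.\<close>

definition follows :: "(nat \<times> 'a set) set \<Rightarrow> ('a \<Rightarrow> nat \<times> 'a set \<Rightarrow> nat \<times> 'a set) \<Rightarrow> ('a \<Rightarrow> nat \<times> 'a set) \<Rightarrow> 'a set \<Rightarrow> bool" where
  "follows Y \<beta> pt Q \<longleftrightarrow> pt ` Q \<subseteq> Y \<and> (\<forall>x\<in>Q. \<forall>a\<in>A. \<beta> a (pt x) = pt (a \<otimes> x)) \<and>
    (\<forall>x\<in>Q. t \<otimes> x \<in> Q \<longrightarrow> \<beta> t (pt x) = pt (t \<otimes> x))"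

lemma follows_mono: "follows Y \<beta> pt Q \<Longrightarrow> R \<subseteq> Q \<Longrightarrow> follows Y \<beta> pt R"
  unfolding follows_def by blast

text \<open>The set \<open>Q\<close> consists of the suffixes of a word for \<open>g\<close>.\<close>

lemma path:
  assumes "g \<in> carrier G"
  shows "\<exists>Q. finite Q \<and> Q \<subseteq> carrier G \<and> \<one> \<in> Q \<and> g \<in> Q \<and> 
    (\<forall>Y \<beta> pt. left_act G \<beta> Y \<longrightarrow> follows Y \<beta> pt Q \<longrightarrow> \<beta> g (pt \<one>) = pt g)"
    (is "\<exists>Q. ?P g Q")
proof -
  have step: "\<exists>Q. ?P (b \<otimes> g) Q" if g: "g \<in> carrier G" "\<exists>Q. ?P g Q" and b: "b \<in> carrier G"
    and move: "\<And>Y \<beta> pt Q. \<lbrakk>left_act G \<beta> Y; follows Y \<beta> pt Q; g \<in> Q; b \<otimes> g \<in> Q\<rbrakk> \<Longrightarrow> \<beta> b (pt g) = pt (b \<otimes> g)"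
    for b g
  proof -
    obtain Q where Q: "?P g Q" using g(2) by blast
    have "\<beta> (b \<otimes> g) (pt \<one>) = pt (b \<otimes> g)" 
      if \<beta>: "left_act G \<beta> Y" and f: "follows Y \<beta> pt (insert (b \<otimes> g) Q)" for Y \<beta> pt
    proof -
      have "\<beta> g (pt \<one>) = pt g" using Q \<beta> follows_mono[OF f subset_insertI] by blast
      moreover have "\<beta> (b \<otimes> g) (pt \<one>) = \<beta> b (\<beta> g (pt \<one>))" 
        using f b g(1) Q by (intro left_actD(3)[OF \<beta>]) (auto simp: follows_def)
      moreover have "\<beta> b (pt g) = pt (b \<otimes> g)" by (rule move[OF \<beta> f]) (use Q in auto)
      ultimately show ?thesis by simp
    qed
    then have "?P (b \<otimes> g) (insert (b \<otimes> g) Q)" using Q b g(1) by simp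
    then show ?thesis by blast
  qed
  show ?thesis using assms
  proof (rule word_induct)
    have "?P \<one> {\<one>}" unfolding left_act_def follows_def by auto
    then show "\<exists>Q. ?P \<one> Q" by blast
    fix g assume g: "g \<in> carrier G" "\<exists>Q. ?P g Q"
    show "\<exists>Q. ?P (a \<otimes> g) Q" if "a \<in> A" for a
      by (rule step[OF g]) (use that in \<open>auto simp: follows_def\<close>)
    show "\<exists>Q. ?P (t \<otimes> g) Q" by (rule step[OF g t]) (auto simp: follows_def)
    \<comment> \<open>A letter \<open>inv t\<close> reads the prescribed move of \<open>t\<close>
      from \<open>inv t \<otimes> g\<close> to \<open>g\<close> backwards.\<close>
    show "\<exists>Q. ?P (inv t \<otimes> g) Q"
    proof (rule step[OF g inv_closed[OF t]])
      fix Y \<beta> pt Q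
      assume \<beta>: "left_act G \<beta> Y" and f: "follows Y \<beta> pt Q" and Q: "g \<in> Q" "inv t \<otimes> g \<in> Q"
      have p: "pt (inv t \<otimes> g) \<in> Y" using f Q unfolding follows_def by blast
      have "t \<otimes> (inv t \<otimes> g) = g" using t g by simp
      then have "\<beta> t (pt (inv t \<otimes> g)) = pt g" using f Q unfolding follows_def by metis
      then show "\<beta> (inv t) (pt g) = pt (inv t \<otimes> g)"
        using left_actD(3)[OF \<beta> _ _ p, of "inv t" t] left_actD(2)[OF \<beta> p] t by simp
    qed
  qed
qed

text \<open>The set is \<open>A \<inter> g H (inv g)\<close>, the stabilizer in \<open>A\<close> of
  the coset \<open>g H\<close> under left multiplication.\<close>

lemma conj_preimage_subgroup:
  assumes H: "subgroup H G" and g: "g \<in> carrier G"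
  shows "subgroup {a \<in> A. inv g \<otimes> a \<otimes> g \<in> H} G"
proof (rule subgroupI)
  interpret H: subgroup H G by (rule H)
  let ?L = "{a \<in> A. inv g \<otimes> a \<otimes> g \<in> H}"
  show "?L \<subseteq> carrier G" by auto
  have "\<one> \<in> ?L" using g by simp
  then show "?L \<noteq> {}" by blast
  fix a assume a: "a \<in> ?L"
  have "inv g \<otimes> inv a \<otimes> g = inv (inv g \<otimes> a \<otimes> g)" using a g by (auto simp: inv_mult_group m_assoc)
  then show "inv a \<in> ?L" using a by auto
  fix b assume b: "b \<in> ?L"
  have "inv g \<otimes> (a \<otimes> b) \<otimes> g = (inv g \<otimes> a \<otimes> g) \<otimes> (inv g \<otimes> b \<otimes> g)"
    using a b g by (auto simp: m_assoc)
  then show "a \<otimes> b \<in> ?L" using a b by auto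
qed

end

text \<open>\<open>M g\<close> complements \<open>A \<inter> g H (inv g)\<close> up to finite index
  and so stands for a virtual retraction of \<open>A\<close> onto this stabilizer. The condition
  \<open>separated\<close> says that elements of \<open>Q\<close> in one double coset
  \<open>A g H\<close>, if their \<open>A\<close>-parts are congruent after the collapse, already
  lie in one left coset of \<open>H\<close>.\<close>

locale hnn_pieces = normal_hnn +
  fixes H Q :: "'a set" and M :: "'a \<Rightarrow> 'a set"
  assumes H: "subgroup H G" and NH: "N \<subseteq> H" and Q: "finite Q" "Q \<subseteq> carrier G"
    and M: "g \<in> carrier G \<Longrightarrow> subgroup (M g) G" "g \<in> carrier G \<Longrightarrow> M g \<subseteq> A"
      "g \<in> carrier G \<Longrightarrow> normalizes G {a \<in> A. inv g \<otimes> a \<otimes> g \<in> H} (M g)"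
      "g \<in> carrier G \<Longrightarrow> M g \<inter> {a \<in> A. inv g \<otimes> a \<otimes> g \<in> H} = {\<one>}"
      "g \<in> carrier G \<Longrightarrow> fin_cover G (M g <#> {a \<in> A. inv g \<otimes> a \<otimes> g \<in> H}) A"
    and separated: "\<lbrakk>g \<in> carrier G; a \<in> A; b \<in> A; h \<in> H; k \<in> H; a \<otimes> g \<otimes> h \<in> Q; b \<otimes> g \<otimes> k \<in> Q; 
      inv a \<otimes> b \<in> M g <#> {a \<in> A. inv g \<otimes> a \<otimes> g \<in> H}\<rbrakk> \<Longrightarrow> inv g \<otimes> (inv a \<otimes> b) \<otimes> g \<in> H"
begin

sublocale H: subgroup H G by (rule H)

definition L :: "'a \<Rightarrow> 'a set" where
  "L g = {a \<in> A. inv g \<otimes> a \<otimes> g \<in> H}"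

lemma M_carrier: "\<lbrakk>g \<in> carrier G; m \<in> M g\<rbrakk> \<Longrightarrow> m \<in> carrier G"
  using M(2)[of g] by auto

lemma L_subgroup:
  assumes g: "g \<in> carrier G"
  shows "subgroup (L g) G"
  unfolding L_def by (rule conj_preimage_subgroup[OF H g])

lemma N_subset_L:
  assumes g: "g \<in> carrier G"
  shows "N \<subseteq> L g"
  using N.inv_op_closed1[OF g] NA NH unfolding L_def by auto

lemma M_conj:
  assumes g: "g \<in> carrier G" and l: "l \<in> L g" and m: "m \<in> M g"
  shows "l \<otimes> m \<otimes> inv l \<in> M g" "inv l \<otimes> m \<otimes> l \<in> M g"
  using normalizesD[OF M(3)[OF g, folded L_def] L_subgroup[OF g] subgroup.subset[OF M(1)[OF g]] l m] .

text \<open>Since \<open>N\<close> is normal and contained in \<open>L g\<close>, a commutator of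
  \<open>m\<close> with an element of \<open>N\<close> lies both in \<open>M g\<close> and in
  \<open>L g\<close>, hence is trivial. This is why the collapse preserves types.\<close>

lemma M_cent:
  assumes g: "g \<in> carrier G" and m: "m \<in> M g"
  shows "m \<in> cent G N"
  unfolding cent_def
proof (intro CollectI conjI ballI)
  show mc: "m \<in> carrier G" using M_carrier[OF g m] .
  interpret Mg: subgroup "M g" G by (rule M(1)[OF g])
  fix n assume n: "n \<in> N"
  then have nL: "n \<in> L g" using N_subset_L[OF g] by blast
  have "m \<otimes> (n \<otimes> inv m \<otimes> inv n) \<in> M g" using M_conj(1)[OF g nL, of "inv m"] m by simp
  moreover have "(m \<otimes> n \<otimes> inv m) \<otimes> inv n \<in> N" using N.inv_op_closed2[OF mc n] n by simp
  then have "m \<otimes> (n \<otimes> inv m \<otimes> inv n) \<in> N" using mc n by (simp add: m_assoc)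
  then have "m \<otimes> (n \<otimes> inv m \<otimes> inv n) \<in> L g" using N_subset_L[OF g] by blast
  ultimately have "m \<otimes> (n \<otimes> inv m \<otimes> inv n) = \<one>" using M(4)[OF g, folded L_def] by blast
  then have "m \<otimes> n \<otimes> inv m \<otimes> inv n = \<one>" using mc n by (simp add: m_assoc)
  then have "m \<otimes> n \<otimes> inv m = n" using mc n by (metis N.mem_carrier inv_closed inv_equality inv_inv m_closed)
  then show "m \<otimes> n = n \<otimes> m" using mc n by (metis N.mem_carrier inv_closed inv_solve_right' m_closed)
qed

definition dc :: "'a \<Rightarrow> 'a set" where
  "dc x = {a \<otimes> x \<otimes> h | a h. a \<in> A \<and> h \<in> H}"

definition rp :: "'a \<Rightarrow> 'a" where
  "rp x = (SOME g. g \<in> dc x)"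

text \<open>For \<open>x = a g h\<close> with \<open>g\<close> the representative of the double coset of \<open>x\<close>, the set \<open>pts x\<close> is
  \<open>a (M g) g h\<close>. The sets \<open>pts x\<close> partition \<open>G\<close>, and they are the points of the collapsed double cosets.\<close>

definition pts :: "'a \<Rightarrow> 'a set" where
  "pts x = {a \<otimes> m \<otimes> rp x \<otimes> h | a m h. a \<in> A \<and> m \<in> M (rp x) \<and> h \<in> H \<and> a \<otimes> rp x \<otimes> h = x}"

lemma dc_mult:
  assumes "x \<in> carrier G" "a \<in> A" "h \<in> H"
  shows "dc (a \<otimes> x \<otimes> h) = dc x"
proof (intro subset_antisym subsetI)
  fix y assume "y \<in> dc (a \<otimes> x \<otimes> h)"
  then obtain b k where b: "b \<in> A" "k \<in> H" "y = b \<otimes> (a \<otimes> x \<otimes> h) \<otimes> k" unfolding dc_def by blast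
  then have "y = (b \<otimes> a) \<otimes> x \<otimes> (h \<otimes> k)" using assms by (simp add: m_assoc)
  then show "y \<in> dc x" unfolding dc_def using assms b by blast
next
  fix y assume "y \<in> dc x"
  then obtain b k where b: "b \<in> A" "k \<in> H" "y = b \<otimes> x \<otimes> k" unfolding dc_def by blast
  then have "y = (b \<otimes> inv a) \<otimes> (a \<otimes> x \<otimes> h) \<otimes> (inv h \<otimes> k)" using assms by (simp add: m_assoc)
  then show "y \<in> dc (a \<otimes> x \<otimes> h)" unfolding dc_def using assms b by blast
qed

lemma rp_mult:
  assumes "x \<in> carrier G" "a \<in> A" "h \<in> H"
  shows "rp (a \<otimes> x \<otimes> h) = rp x"
  unfolding rp_def dc_mult[OF assms] ..

lemma rp_left: "\<lbrakk>x \<in> carrier G; a \<in> A\<rbrakk> \<Longrightarrow> rp (a \<otimes> x) = rp x"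
  using rp_mult[of x a \<one>] by simp

lemma rp_right: "\<lbrakk>x \<in> carrier G; h \<in> H\<rbrakk> \<Longrightarrow> rp (x \<otimes> h) = rp x"
  using rp_mult[of x \<one> h] by simp

lemma rp_dc:
  assumes x: "x \<in> carrier G"
  shows "rp x \<in> dc x"
proof -
  have "x = \<one> \<otimes> x \<otimes> \<one>" using x by simp
  then have "x \<in> dc x" unfolding dc_def using A.one_closed H.one_closed by blast
  then show ?thesis unfolding rp_def by (rule someI[of "\<lambda>g. g \<in> dc x"])
qed

lemma rp_decomp:
  assumes x: "x \<in> carrier G"
  obtains a h where "a \<in> A" "h \<in> H" "x = a \<otimes> rp x \<otimes> h"
proof -
  from rp_dc[OF x] obtain a h where ah: "a \<in> A" "h \<in> H" "rp x = a \<otimes> x \<otimes> h" unfolding dc_def by blast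
  then have "x = inv a \<otimes> rp x \<otimes> inv h" using x by (simp add: m_assoc)
  with ah that show thesis by blast
qed

lemma rp_carrier: 
  assumes x: "x \<in> carrier G"
  shows "rp x \<in> carrier G"
proof -
  from rp_dc[OF x] show ?thesis unfolding dc_def using x by auto
qed

text \<open>Two decompositions of \<open>x\<close> differ by some \<open>l \<in> L g\<close>, and
  \<open>l\<close> normalizes \<open>M g\<close>; so any single decomposition describes the whole
  set.\<close>

lemma pts_eq:
  assumes x: "x \<in> carrier G" and ah: "a \<in> A" "h \<in> H" "x = a \<otimes> rp x \<otimes> h"
  shows "pts x = (\<lambda>m. a \<otimes> m \<otimes> rp x \<otimes> h) ` M (rp x)"
proof (intro subset_antisym subsetI)
  define g where "g = rp x"
  have g: "g \<in> carrier G" unfolding g_def by (rule rp_carrier[OF x])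
  fix v assume "v \<in> pts x"
  then obtain b m k where b: "b \<in> A" "m \<in> M g" "k \<in> H" "b \<otimes> g \<otimes> k = x" "v = b \<otimes> m \<otimes> g \<otimes> k"
    unfolding pts_def g_def by blast
  define l where "l = inv a \<otimes> b"
  have mc: "m \<in> carrier G" using M_carrier g b by blast
  have c: "a \<in> carrier G" "b \<in> carrier G" "h \<in> carrier G" "k \<in> carrier G" using ah b by auto
  have xa: "a \<otimes> (g \<otimes> h) = b \<otimes> (g \<otimes> k)" using ah(3) b(4) c g unfolding g_def by (simp add: m_assoc)
  have lg: "l \<otimes> (g \<otimes> k) = g \<otimes> h" 
    unfolding l_def using c g xa[symmetric] by (simp add: m_assoc)
  have "inv g \<otimes> l \<otimes> g = inv g \<otimes> (l \<otimes> (g \<otimes> k)) \<otimes> inv k" using c g unfolding l_def by (simp add: m_assoc)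
  also have "\<dots> = h \<otimes> inv k" unfolding lg using c g by simp
  finally have "inv g \<otimes> l \<otimes> g \<in> H" using ah b by simp
  then have l: "l \<in> L g" unfolding L_def l_def using ah b by simp
  have lc: "l \<in> carrier G" unfolding l_def using c by simp
  have "b = a \<otimes> l" unfolding l_def using c by simp
  then have "v = a \<otimes> (l \<otimes> m \<otimes> inv l) \<otimes> (l \<otimes> (g \<otimes> k))" 
    using b(5) c lc g mc by (simp add: m_assoc)
  then have "v = a \<otimes> (l \<otimes> m \<otimes> inv l) \<otimes> g \<otimes> h" unfolding lg using c g lc mc by (simp add: m_assoc)
  then show "v \<in> (\<lambda>m. a \<otimes> m \<otimes> rp x \<otimes> h) ` M (rp x)" using M_conj(1)[OF g l b(2)] unfolding g_def by blast
next
  fix v assume "v \<in> (\<lambda>m. a \<otimes> m \<otimes> rp x \<otimes> h) ` M (rp x)"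
  then show "v \<in> pts x" unfolding pts_def using ah(1,2) ah(3)[symmetric] by blast
qed

lemma pts_left:
  assumes x: "x \<in> carrier G" and b: "b \<in> A"
  shows "pts (b \<otimes> x) = b <# pts x"
proof -
  obtain a h where ah: "a \<in> A" "h \<in> H" "x = a \<otimes> rp x \<otimes> h" using rp_decomp[OF x] .
  note g = rp_carrier[OF x]
  have c: "b \<in> carrier G" "a \<in> carrier G" "h \<in> carrier G" using ah b by auto
  have bx: "b \<otimes> x \<in> carrier G" using x c by simp
  have r: "rp (b \<otimes> x) = rp x" by (rule rp_left[OF x b])
  have "b \<otimes> x = (b \<otimes> a) \<otimes> rp x \<otimes> h" using ah(3) c g by (metis m_assoc m_closed)
  then have "pts (b \<otimes> x) = (\<lambda>m. (b \<otimes> a) \<otimes> m \<otimes> rp x \<otimes> h) ` M (rp x)"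
    using pts_eq[OF bx, of "b \<otimes> a" h] ah b unfolding r by simp
  also have "\<dots> = b <# pts x"
    unfolding pts_eq[OF x ah] l_coset_def using c g M_carrier[OF g] by (force simp: m_assoc)
  finally show ?thesis .
qed

lemma pts_right:
  assumes x: "x \<in> carrier G" and k: "k \<in> H"
  shows "pts (x \<otimes> k) = pts x #> k"
proof -
  obtain a h where ah: "a \<in> A" "h \<in> H" "x = a \<otimes> rp x \<otimes> h" using rp_decomp[OF x] .
  note g = rp_carrier[OF x]
  have c: "k \<in> carrier G" "a \<in> carrier G" "h \<in> carrier G" using ah k by auto
  have bx: "x \<otimes> k \<in> carrier G" using x c by simp
  have r: "rp (x \<otimes> k) = rp x" by (rule rp_right[OF x k])
  have "x \<otimes> k = a \<otimes> rp x \<otimes> (h \<otimes> k)" using ah(3) c g by (metis m_assoc m_closed)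
  then have "pts (x \<otimes> k) = (\<lambda>m. a \<otimes> m \<otimes> rp x \<otimes> (h \<otimes> k)) ` M (rp x)"
    using pts_eq[OF bx, of a "h \<otimes> k"] ah k unfolding r by simp
  also have "\<dots> = pts x #> k"
    unfolding pts_eq[OF x ah] r_coset_def using c g M_carrier[OF g] by (force simp: m_assoc)
  finally show ?thesis .
qed

lemma pts_self:
  assumes x: "x \<in> carrier G"
  shows "x \<in> pts x"
proof -
  obtain a h where ah: "a \<in> A" "h \<in> H" "x = a \<otimes> rp x \<otimes> h" using rp_decomp[OF x] .
  have "\<one> \<in> M (rp x)" using subgroup.one_closed[OF M(1)[OF rp_carrier[OF x]]] .
  moreover have "x = a \<otimes> \<one> \<otimes> rp x \<otimes> h" using ah by simp
  ultimately show ?thesis unfolding pts_eq[OF x ah] by blast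
qed

lemma pts_cent:
  assumes x: "x \<in> carrier G" and v: "v \<in> pts x"
  obtains z where "z \<in> cent G N" "v = z \<otimes> x"
proof -
  obtain a h where ah: "a \<in> A" "h \<in> H" "x = a \<otimes> rp x \<otimes> h" using rp_decomp[OF x] .
  note g = rp_carrier[OF x]
  obtain m where m: "m \<in> M (rp x)" "v = a \<otimes> m \<otimes> rp x \<otimes> h" using v unfolding pts_eq[OF x ah] by blast
  have c: "a \<in> carrier G" "h \<in> carrier G" "m \<in> carrier G" using ah M_carrier[OF g m(1)] by auto
  have "v = (a \<otimes> m \<otimes> inv a) \<otimes> (a \<otimes> rp x \<otimes> h)" using m c g by (simp add: m_assoc)
  then have "v = (a \<otimes> m \<otimes> inv a) \<otimes> x" using ah(3) by simp
  then show thesis using that[of "a \<otimes> m \<otimes> inv a"] cent_conj[OF c(1) M_cent[OF g m(1)]] by blast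
qed

lemma pts_carrier:
  assumes x: "x \<in> carrier G"
  shows "pts x \<subseteq> carrier G"
  using pts_cent[OF x] x by (metis Z.mem_carrier m_closed subsetI)

text \<open>If \<open>k\<close> fixes a point, comparing two expressions for \<open>x\<close>
  produces an element of \<open>M g \<inter> L g\<close>. Its triviality forces
  \<open>k = \<one>\<close>.\<close>

lemma pts_free:
  assumes x: "x \<in> carrier G" and k: "k \<in> H" and e: "pts x = pts x #> k"
  shows "k = \<one>"
proof -
  obtain a h where ah: "a \<in> A" "h \<in> H" "x = a \<otimes> rp x \<otimes> h" using rp_decomp[OF x] .
  define g where "g = rp x"
  have g: "g \<in> carrier G" unfolding g_def by (rule rp_carrier[OF x])
  have "x \<in> pts x #> k" using pts_self[OF x] e by simp
  then obtain m where m: "m \<in> M g" "x = a \<otimes> m \<otimes> g \<otimes> h \<otimes> k" 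
    unfolding pts_eq[OF x ah] r_coset_def g_def by blast
  have c: "a \<in> carrier G" "h \<in> carrier G" "m \<in> carrier G" "k \<in> carrier G" using ah k M_carrier[OF g m(1)] by auto
  have "a \<otimes> (g \<otimes> h) = a \<otimes> (m \<otimes> (g \<otimes> (h \<otimes> k)))" using ah(3) m(2) c g unfolding g_def by (simp add: m_assoc)
  then have e1: "m \<otimes> (g \<otimes> (h \<otimes> k)) = g \<otimes> h" using c g by simp
  have "inv g \<otimes> m \<otimes> g = inv g \<otimes> (m \<otimes> (g \<otimes> (h \<otimes> k))) \<otimes> inv (h \<otimes> k)" using c g by (simp add: m_assoc inv_mult_group)
  also have "\<dots> = h \<otimes> inv (h \<otimes> k)" unfolding e1 using c g by simp
  finally have "inv g \<otimes> m \<otimes> g \<in> H" using ah k by simp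
  then have "m \<in> L g" unfolding L_def using M(2)[OF g] m by blast
  then have "m = \<one>" using M(4)[OF g, folded L_def] m by blast
  then have "g \<otimes> (h \<otimes> k) = g \<otimes> h" using e1 c g by simp
  then show ?thesis using c g by simp
qed

text \<open>What the separation is for: among the translates of \<open>Q\<close> by \<open>H\<close>
  nothing is identified, so a move of \<open>t\<close> prescribed on their points is well defined
  and injective.\<close>

lemma pts_inj:
  assumes x: "x \<in> Q" "y \<in> Q" and k: "k \<in> H" "l \<in> H" and e: "pts (x \<otimes> k) = pts (y \<otimes> l)"
  shows "x \<otimes> k = y \<otimes> l"
proof -
  define u where "u = x \<otimes> k"
  have xc: "x \<in> carrier G" "y \<in> carrier G" using x Q by auto
  have u: "u \<in> carrier G" and uv: "y \<otimes> l \<in> carrier G" unfolding u_def using xc k by auto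
  obtain a h where ah: "a \<in> A" "h \<in> H" "u = a \<otimes> rp u \<otimes> h" using rp_decomp[OF u] .
  define g where "g = rp u"
  have g: "g \<in> carrier G" unfolding g_def by (rule rp_carrier[OF u])
  have "y \<otimes> l \<in> pts u" using pts_self[OF uv] e unfolding u_def by simp
  then obtain m where m: "m \<in> M g" "y \<otimes> l = a \<otimes> m \<otimes> g \<otimes> h" unfolding pts_eq[OF u ah] g_def by blast
  have mA: "m \<in> A" using m M(2)[OF g] by blast
  have c: "a \<in> carrier G" "h \<in> carrier G" "m \<in> carrier G" "k \<in> carrier G" "l \<in> carrier G" using ah k mA by auto
  have xQ: "x = a \<otimes> g \<otimes> (h \<otimes> inv k)"
  proof -
    have "x = u \<otimes> inv k" unfolding u_def using xc c by (simp add: m_assoc)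
    then show ?thesis using ah(3) c g unfolding g_def by (metis inv_closed m_assoc m_closed)
  qed
  have yQ: "y = (a \<otimes> m) \<otimes> g \<otimes> (h \<otimes> inv l)"
  proof -
    have "y = (y \<otimes> l) \<otimes> inv l" using xc c by (simp add: m_assoc)
    then show ?thesis unfolding m(2) using c g by (simp add: m_assoc)
  qed
  have am: "inv a \<otimes> (a \<otimes> m) = m" using c by simp
  have "m = m \<otimes> \<one>" using c by simp
  moreover have "\<one> \<in> {a \<in> A. inv g \<otimes> a \<otimes> g \<in> H}" using g by simp
  ultimately have "m \<in> M g <#> {a \<in> A. inv g \<otimes> a \<otimes> g \<in> H}" unfolding set_mult_def using m(1) by blast
  then have "inv g \<otimes> m \<otimes> g \<in> H"
    using separated[OF g ah(1), of "a \<otimes> m" "h \<otimes> inv k" "h \<otimes> inv l"] ah mA k x xQ yQ am by simp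
  then have "m \<in> L g" unfolding L_def using mA by blast
  then have "m = \<one>" using M(4)[OF g, folded L_def] m by blast
  then have "y \<otimes> l = a \<otimes> g \<otimes> h" using m c by simp
  then show ?thesis using ah(3) unfolding g_def u_def by simp
qed

end

context group
begin

lemma l_coset_mult: "\<lbrakk>V \<subseteq> carrier G; a \<in> carrier G; b \<in> carrier G\<rbrakk> \<Longrightarrow> (a \<otimes> b) <# V = a <# (b <# V)"
  unfolding l_coset_def by (force simp: m_assoc)

lemma l_coset_r_coset: 
  "\<lbrakk>V \<subseteq> carrier G; a \<in> carrier G; b \<in> carrier G\<rbrakk> \<Longrightarrow> (a <# V) #> b = a <# (V #> b)"
  unfolding l_coset_def r_coset_def by (force simp: m_assoc)

lemma r_coset_mult: "\<lbrakk>V \<subseteq> carrier G; a \<in> carrier G; b \<in> carrier G\<rbrakk> \<Longrightarrow> (V #> a) #> b = V #> (a \<otimes> b)"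
  unfolding r_coset_def by (force simp: m_assoc)

lemma l_coset_one: "V \<subseteq> carrier G \<Longrightarrow> \<one> <# V = V"
  unfolding l_coset_def by force

end

section \<open>The collapsed set \<open>Y0\<close>, its finitely many orbits and the types of its
  points\<close>

context hnn_pieces
begin

definition U :: "'a set" where
  "U = {a \<otimes> q \<otimes> h | a q h. a \<in> A \<and> q \<in> Q \<and> h \<in> H}"

lemma U_carrier: "x \<in> U \<Longrightarrow> x \<in> carrier G"
  unfolding U_def using Q(2) by auto

lemma Q_U: "q \<in> Q \<Longrightarrow> q \<in> U"
proof -
  assume q: "q \<in> Q"
  then have "q = \<one> \<otimes> q \<otimes> \<one>" using Q(2) by auto
  then show "q \<in> U" unfolding U_def using q A.one_closed H.one_closed by blast
qed

lemma U_left: "\<lbrakk>x \<in> U; a \<in> A\<rbrakk> \<Longrightarrow> a \<otimes> x \<in> U"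
proof -
  assume "x \<in> U" and a: "a \<in> A"
  then obtain b q h where x: "b \<in> A" "q \<in> Q" "h \<in> H" "x = b \<otimes> q \<otimes> h" unfolding U_def by blast
  then have "a \<otimes> x = (a \<otimes> b) \<otimes> q \<otimes> h" using a Q(2) by (auto simp: m_assoc)
  then show "a \<otimes> x \<in> U" unfolding U_def using x a by blast
qed

lemma U_right: "\<lbrakk>x \<in> U; k \<in> H\<rbrakk> \<Longrightarrow> x \<otimes> k \<in> U"
proof -
  assume "x \<in> U" and k: "k \<in> H"
  then obtain b q h where x: "b \<in> A" "q \<in> Q" "h \<in> H" "x = b \<otimes> q \<otimes> h" unfolding U_def by blast
  then have "x \<otimes> k = b \<otimes> q \<otimes> (h \<otimes> k)" using k Q(2) by (auto simp: m_assoc)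
  then show "x \<otimes> k \<in> U" unfolding U_def using x k by blast
qed

definition Y0 :: "'a set set" where
  "Y0 = pts ` U"

sublocale R0: free_right_action G H Y0 "\<lambda>v h. v #> h"
proof
  show "y #> h \<in> Y0" if y: "y \<in> Y0" "h \<in> H" for y h
  proof -
    obtain x where x: "x \<in> U" "y = pts x" using y unfolding Y0_def by blast
    then have "y #> h = pts (x \<otimes> h)" using pts_right U_carrier y by simp
    then show ?thesis unfolding Y0_def using U_right[OF x(1) y(2)] by blast
  qed
  show "y #> \<one> = y" if "y \<in> Y0" for y
    using that coset_mult_one[OF pts_carrier[OF U_carrier]] unfolding Y0_def by auto
  show "y #> h #> k = y #> (h \<otimes> k)" if "y \<in> Y0" "h \<in> H" "k \<in> H" for y h k
    using that r_coset_mult[OF pts_carrier[OF U_carrier]] unfolding Y0_def by auto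
  show "h = k" if y: "y \<in> Y0" and hk: "h \<in> H" "k \<in> H" and e: "y #> h = y #> k" for y h k
  proof -
    obtain x where x: "x \<in> U" "y = pts x" using y unfolding Y0_def by blast
    have xc: "x \<in> carrier G" by (rule U_carrier[OF x(1)])
    have xh: "x \<otimes> h \<in> carrier G" using xc hk by simp
    have "pts (x \<otimes> h) = pts (x \<otimes> k)" using pts_right[OF xc] hk e x by simp
    also have "x \<otimes> k = (x \<otimes> h) \<otimes> (inv h \<otimes> k)" using xc hk by (simp add: m_assoc)
    also have "pts \<dots> = pts (x \<otimes> h) #> (inv h \<otimes> k)" using pts_right[OF xh] hk by simp
    finally have e2: "pts (x \<otimes> h) = pts (x \<otimes> h) #> (inv h \<otimes> k)" .
    have "inv h \<otimes> k = \<one>" by (rule pts_free[OF xh _ e2]) (use hk in simp)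
    then have "h \<otimes> (inv h \<otimes> k) = h \<otimes> \<one>" by (rule arg_cong)
    then show "h = k" using hk by simp
  qed
qed

text \<open>Write \<open>q = b \<otimes> g \<otimes> h\<close>. The orbit of the point of
  \<open>inv a \<otimes> q\<close> depends only on the right coset of \<open>M g <#> L g\<close>
  that contains \<open>inv b \<otimes> a\<close>: \<open>M g\<close> has been divided out, and
  \<open>L g\<close> moves across \<open>g\<close> into \<open>H\<close>. There are finitely many
  such cosets in \<open>A\<close>.\<close>

lemma finite_orbits0: "finite (R0.orb ` Y0)"
proof -
  have "finite ((\<lambda>a. R0.orb (pts (inv a \<otimes> q))) ` A)" if q: "q \<in> Q" for q
  proof -
    have qc: "q \<in> carrier G" using q Q(2) by blast
    define g where "g = rp q"
    have g: "g \<in> carrier G" unfolding g_def by (rule rp_carrier[OF qc])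
    obtain b h where bh: "b \<in> A" "h \<in> H" "q = b \<otimes> g \<otimes> h" using rp_decomp[OF qc] unfolding g_def by blast
    have sub: "subgroup (M g <#> L g) G"
      using subgroup_mult_normalizes[OF M(3)[OF g, folded L_def] L_subgroup[OF g] M(1)[OF g]] .
    have "finite ((\<lambda>a. (M g <#> L g) #> a) ` A)"
      using fin_cover_rcosets[OF M(5)[OF g, folded L_def] sub A.subset] .
    then have fin: "finite ((\<lambda>a. (M g <#> L g) #> (inv b \<otimes> a)) ` A)"
      by (rule finite_subset[rotated]) (use bh in auto)
    show ?thesis
    proof (rule finite_image_factor[OF fin])
      fix x y assume xy: "x \<in> A" "y \<in> A" "(M g <#> L g) #> (inv b \<otimes> x) = (M g <#> L g) #> (inv b \<otimes> y)"
      define x' y' where "x' = inv b \<otimes> x" and "y' = inv b \<otimes> y"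
      have xy': "x' \<in> A" "y' \<in> A" unfolding x'_def y'_def using xy bh by auto
      have "y' \<in> (M g <#> L g) #> x'" using rcos_self[of y' "M g <#> L g"] sub xy xy' unfolding x'_def y'_def by simp
      then obtain m l where ml: "m \<in> M g" "l \<in> L g" "y' = m \<otimes> l \<otimes> x'" unfolding r_coset_def set_mult_def by blast
      have mA: "m \<in> A" "l \<in> A" using ml M(2)[OF g] unfolding L_def by auto
      have lH: "inv g \<otimes> l \<otimes> g \<in> H" using ml unfolding L_def by blast
      have c: "m \<in> carrier G" "l \<in> carrier G" "x' \<in> carrier G" "y' \<in> carrier G" "h \<in> carrier G" "b \<in> carrier G" "x \<in> carrier G" "y \<in> carrier G"
        using mA xy' bh xy by auto
      have rg: "rp (a \<otimes> g \<otimes> k) = g" if "a \<in> A" "k \<in> H" for a k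
      proof -
        have "rp (a \<otimes> g \<otimes> k) = rp g" by (rule rp_mult[OF g that])
        also have "\<dots> = rp (b \<otimes> g \<otimes> h)" by (rule rp_mult[symmetric, OF g bh(1,2)])
        also have "\<dots> = g" unfolding bh(3)[symmetric] by (rule g_def[symmetric])
        finally show ?thesis .
      qed
      have pe: "pts (a \<otimes> g \<otimes> k) = (\<lambda>m. a \<otimes> m \<otimes> g \<otimes> k) ` M g" if "a \<in> A" "k \<in> H" for a k
        using pts_eq[of "a \<otimes> g \<otimes> k" a k] rg[OF that] that g by simp
      have ix: "inv x \<otimes> q = inv x' \<otimes> g \<otimes> h" unfolding x'_def using bh(3) c g by (simp add: inv_mult_group m_assoc)
      have iy: "inv y \<otimes> q = (inv x' \<otimes> inv l \<otimes> inv m) \<otimes> g \<otimes> h"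
      proof -
        have "inv y \<otimes> q = inv y' \<otimes> g \<otimes> h" unfolding y'_def using bh(3) c g by (simp add: inv_mult_group m_assoc)
        then show ?thesis unfolding ml(3) using c g by (simp add: inv_mult_group m_assoc)
      qed
      \<comment> \<open>The translation by \<open>H\<close> that compensates \<open>l\<close>: moved
        to the left across \<open>g \<otimes> h\<close> it becomes \<open>l\<close>.\<close>
      define k where "k = inv h \<otimes> (inv g \<otimes> l \<otimes> g) \<otimes> h"
      have k: "k \<in> H" unfolding k_def using lH bh by simp
      have kc: "k \<in> carrier G" using k by simp
      have ghk: "g \<otimes> h \<otimes> k = l \<otimes> g \<otimes> h" unfolding k_def using c g by (simp add: m_assoc)
      interpret Mg: subgroup "M g" G by (rule M(1)[OF g])
      have xyA: "inv x' \<otimes> inv l \<otimes> inv m \<in> A" "inv x' \<in> A" using xy' mA by auto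
      have "pts (inv y \<otimes> q) #> k = (\<lambda>v. (inv x' \<otimes> inv l \<otimes> inv m) \<otimes> v \<otimes> g \<otimes> h \<otimes> k) ` M g"
        unfolding iy pe[OF xyA(1) bh(2)] r_coset_def by blast
      also have "\<dots> = (\<lambda>v. inv x' \<otimes> (inv l \<otimes> (inv m \<otimes> v) \<otimes> l) \<otimes> g \<otimes> h) ` M g"
      proof (rule image_cong[OF HOL.refl])
        fix v assume "v \<in> M g"
        then have v: "v \<in> carrier G" by simp
        have "(inv x' \<otimes> inv l \<otimes> inv m) \<otimes> v \<otimes> g \<otimes> h \<otimes> k = (inv x' \<otimes> inv l \<otimes> inv m) \<otimes> v \<otimes> (g \<otimes> h \<otimes> k)"
          using c g v kc by (simp add: m_assoc)
        then show "(inv x' \<otimes> inv l \<otimes> inv m) \<otimes> v \<otimes> g \<otimes> h \<otimes> k = inv x' \<otimes> (inv l \<otimes> (inv m \<otimes> v) \<otimes> l) \<otimes> g \<otimes> h"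
          unfolding ghk using c g v by (simp add: m_assoc)
      qed
      also have "\<dots> = (\<lambda>u. inv x' \<otimes> u \<otimes> g \<otimes> h) ` (\<lambda>v. inv l \<otimes> (inv m \<otimes> v) \<otimes> l) ` M g" by (simp add: image_image)
      also have "(\<lambda>v. inv l \<otimes> (inv m \<otimes> v) \<otimes> l) ` M g = M g"
      proof (intro subset_antisym subsetI)
        fix u assume "u \<in> (\<lambda>v. inv l \<otimes> (inv m \<otimes> v) \<otimes> l) ` M g"
        then show "u \<in> M g" using M_conj(2)[OF g ml(2)] ml(1) by auto
      next
        fix u assume u: "u \<in> M g"
        have "u = inv l \<otimes> (inv m \<otimes> (m \<otimes> (l \<otimes> u \<otimes> inv l))) \<otimes> l" using c u by (simp add: m_assoc)
        moreover have "m \<otimes> (l \<otimes> u \<otimes> inv l) \<in> M g" using M_conj(1)[OF g ml(2) u] ml(1) by simp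
        ultimately show "u \<in> (\<lambda>v. inv l \<otimes> (inv m \<otimes> v) \<otimes> l) ` M g" by blast
      qed
      also have "(\<lambda>u. inv x' \<otimes> u \<otimes> g \<otimes> h) ` M g = pts (inv x \<otimes> q)" unfolding ix pe[OF xyA(2) bh(2)] ..
      finally have e: "pts (inv x \<otimes> q) = pts (inv y \<otimes> q) #> k" by simp
      have "pts (inv y \<otimes> q) \<in> Y0" unfolding Y0_def using U_left[OF Q_U[OF q]] xy by simp
      then show "R0.orb (pts (inv x \<otimes> q)) = R0.orb (pts (inv y \<otimes> q))" unfolding e using R0.orb_act k by simp
    qed
  qed
  then have "finite (\<Union>q\<in>Q. (\<lambda>a. R0.orb (pts (inv a \<otimes> q))) ` A)" using Q(1) by blast
  moreover have "R0.orb ` Y0 \<subseteq> (\<Union>q\<in>Q. (\<lambda>a. R0.orb (pts (inv a \<otimes> q))) ` A)"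
  proof
    fix O' assume "O' \<in> R0.orb ` Y0"
    then obtain a q h where x: "a \<in> A" "q \<in> Q" "h \<in> H" "O' = R0.orb (pts (a \<otimes> q \<otimes> h))" unfolding Y0_def U_def by blast
    have "a \<otimes> q \<in> U" using U_left[OF Q_U] x by simp
    then have "pts (a \<otimes> q) \<in> Y0" "pts (a \<otimes> q \<otimes> h) = pts (a \<otimes> q) #> h" 
      unfolding Y0_def using pts_right[OF U_carrier] x by auto
    then have "O' = R0.orb (pts (inv (inv a) \<otimes> q))" using x R0.orb_act by simp
    then show "O' \<in> (\<Union>q\<in>Q. (\<lambda>a. R0.orb (pts (inv a \<otimes> q))) ` A)" using x A.m_inv_closed by blast
  qed
  ultimately show ?thesis by (rule finite_subset[rotated])
qed

text \<open>Because \<open>cent G N\<close> is normal in \<open>G\<close>, this is the left coset of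
  \<open>cent G N <#> H\<close> containing \<open>x\<close>, and \<open>G\<close> permutes these
  cosets from the left.\<close>

definition W :: "'a \<Rightarrow> 'a set" where
  "W x = {z \<otimes> x \<otimes> h | z h. z \<in> cent G N \<and> h \<in> H}"

text \<open>The same coset, attached to the points; it is the type that \<open>t\<close> has to respect.\<close>

definition om :: "'a set \<Rightarrow> 'a set" where
  "om y = {z \<otimes> v \<otimes> h | z v h. z \<in> cent G N \<and> v \<in> y \<and> h \<in> H}"

lemma W_self: 
  assumes x: "x \<in> carrier G" 
  shows "x \<in> W x"
proof -
  have "x = \<one> \<otimes> x \<otimes> \<one>" using x by simp
  then show ?thesis unfolding W_def using H.one_closed Z.one_closed by blast
qed

lemma W_mult:
  assumes x: "x \<in> carrier G" and z: "z \<in> cent G N" and h: "h \<in> H"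
  shows "W (z \<otimes> x \<otimes> h) = W x"
proof (intro subset_antisym subsetI)
  fix y assume "y \<in> W (z \<otimes> x \<otimes> h)"
  then obtain c k where c: "c \<in> cent G N" "k \<in> H" "y = c \<otimes> (z \<otimes> x \<otimes> h) \<otimes> k" unfolding W_def by blast
  then have "y = (c \<otimes> z) \<otimes> x \<otimes> (h \<otimes> k)" using x z h by (simp add: m_assoc)
  then show "y \<in> W x" unfolding W_def using c z h by blast
next
  fix y assume "y \<in> W x"
  then obtain c k where c: "c \<in> cent G N" "k \<in> H" "y = c \<otimes> x \<otimes> k" unfolding W_def by blast
  then have "y = (c \<otimes> inv z) \<otimes> (z \<otimes> x \<otimes> h) \<otimes> (inv h \<otimes> k)" using x z h by (simp add: m_assoc)
  then show "y \<in> W (z \<otimes> x \<otimes> h)" unfolding W_def using c z h by blast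
qed

lemma W_z: "\<lbrakk>x \<in> carrier G; z \<in> cent G N\<rbrakk> \<Longrightarrow> W (z \<otimes> x) = W x"
  using W_mult[of x z \<one>] by simp

lemma W_h: "\<lbrakk>x \<in> carrier G; h \<in> H\<rbrakk> \<Longrightarrow> W (x \<otimes> h) = W x"
  using W_mult[of x \<one> h] by simp

lemma W_left:
  assumes x: "x \<in> carrier G" and g: "g \<in> carrier G"
  shows "W (g \<otimes> x) = g <# W x"
proof (intro subset_antisym subsetI)
  fix y assume "y \<in> W (g \<otimes> x)"
  then obtain c k where c: "c \<in> cent G N" "k \<in> H" "y = c \<otimes> (g \<otimes> x) \<otimes> k" unfolding W_def by blast
  then have "y = g \<otimes> ((inv g \<otimes> c \<otimes> inv (inv g)) \<otimes> x \<otimes> k)" using x g by (simp add: m_assoc)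
  then show "y \<in> g <# W x" unfolding W_def l_coset_def using c cent_conj[of "inv g" c] g by blast
next
  fix y assume "y \<in> g <# W x"
  then obtain c k where c: "c \<in> cent G N" "k \<in> H" "y = g \<otimes> (c \<otimes> x \<otimes> k)" unfolding W_def l_coset_def by blast
  then have "y = (g \<otimes> c \<otimes> inv g) \<otimes> (g \<otimes> x) \<otimes> k" using x g by (simp add: m_assoc)
  then show "y \<in> W (g \<otimes> x)" unfolding W_def using c cent_conj[of g c] g by blast
qed

lemma W_carrier: "x \<in> carrier G \<Longrightarrow> W x \<subseteq> carrier G"
  unfolding W_def by auto

lemma om_pts:
  assumes x: "x \<in> carrier G"
  shows "om (pts x) = W x"
proof (intro subset_antisym subsetI)
  fix y assume "y \<in> om (pts x)"
  then obtain z v h where zv: "z \<in> cent G N" "v \<in> pts x" "h \<in> H" "y = z \<otimes> v \<otimes> h" unfolding om_def by blast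
  obtain c where c: "c \<in> cent G N" "v = c \<otimes> x" using pts_cent[OF x zv(2)] .
  have "y = (z \<otimes> c) \<otimes> x \<otimes> h" using zv c x by (simp add: m_assoc)
  then show "y \<in> W x" unfolding W_def using zv c by blast
next
  fix y assume "y \<in> W x"
  then show "y \<in> om (pts x)" unfolding W_def om_def using pts_self[OF x] by blast
qed

definition freq :: "'a set \<Rightarrow> nat" where
  "freq \<omega> = card (R0.orb ` {y \<in> Y0. om y = \<omega>})"

lemma Y0_left:
  assumes "y \<in> Y0" "a \<in> A"
  shows "a <# y \<in> Y0" "om (a <# y) = a <# om y"
proof -
  obtain x where x: "x \<in> U" "y = pts x" using assms unfolding Y0_def by blast
  note xc = U_carrier[OF x(1)]
  have e: "a <# y = pts (a \<otimes> x)" using pts_left[OF xc assms(2)] x by simp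
  then show "a <# y \<in> Y0" unfolding Y0_def using U_left[OF x(1) assms(2)] by blast
  show "om (a <# y) = a <# om y" 
    using e x(2) om_pts[OF xc] om_pts[of "a \<otimes> x"] W_left[OF xc] assms(2) xc by simp
qed

lemma Y0_carrier: "y \<in> Y0 \<Longrightarrow> y \<subseteq> carrier G"
  unfolding Y0_def using pts_carrier U_carrier by auto

lemma om_carrier: "y \<in> Y0 \<Longrightarrow> om y \<subseteq> carrier G"
  unfolding Y0_def using om_pts W_carrier U_carrier by auto

lemma orb0_left:
  assumes "y \<in> Y0" "a \<in> A"
  shows "R0.orb (a <# y) = (\<lambda>v. a <# v) ` R0.orb y"
  unfolding R0.orb_def using l_coset_r_coset[OF Y0_carrier[OF assms(1)]] assms by (auto simp: image_image)

lemma freq_left_le: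
  assumes a: "a \<in> A" and \<omega>: "\<omega> \<subseteq> carrier G"
  shows "freq (a <# \<omega>) \<le> freq \<omega>"
proof -
  have "R0.orb ` {y \<in> Y0. om y = a <# \<omega>} \<subseteq> (\<lambda>O'. (\<lambda>v. a <# v) ` O') ` R0.orb ` {y \<in> Y0. om y = \<omega>}"
  proof
    fix O' assume "O' \<in> R0.orb ` {y \<in> Y0. om y = a <# \<omega>}"
    then obtain y where y: "y \<in> Y0" "om y = a <# \<omega>" "O' = R0.orb y" by blast
    define z where "z = inv a <# y"
    have ia: "inv a \<in> A" using a by simp
    have ac: "a \<in> carrier G" "inv a \<in> carrier G" using a by auto
    have z: "z \<in> Y0" unfolding z_def using Y0_left[OF y(1) ia] by simp
    have "om z = inv a <# (a <# \<omega>)" unfolding z_def using Y0_left[OF y(1) ia] y by simp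
    also have "\<dots> = \<omega>" using l_coset_mult[OF \<omega> ac(2,1)] ac l_coset_one[OF \<omega>] by simp
    finally have "om z = \<omega>" .
    have "a <# z = y" unfolding z_def 
      using l_coset_mult[OF Y0_carrier[OF y(1)] ac] ac l_coset_one[OF Y0_carrier[OF y(1)]] by simp
    then have "O' = (\<lambda>v. a <# v) ` R0.orb z" using orb0_left[OF z a] y by simp
    then show "O' \<in> (\<lambda>O'. (\<lambda>v. a <# v) ` O') ` R0.orb ` {y \<in> Y0. om y = \<omega>}" using z \<open>om z = \<omega>\<close> by blast
  qed
  moreover have "finite (R0.orb ` {y \<in> Y0. om y = \<omega>})" 
    by (rule finite_subset[OF _ finite_orbits0]) auto
  ultimately show ?thesis unfolding freq_def by (meson card_image_le card_mono finite_imageI le_trans)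
qed

text \<open>Left translation by \<open>a\<close> carries the orbits of type \<omega> to those of
  type \<open>a <# \<omega>\<close>. The number of copies of an orbit will depend on the frequency
  of its type, and this invariance lets \<open>A\<close> act on the copies.\<close>

lemma freq_left:
  assumes a: "a \<in> A" and \<omega>: "\<omega> \<subseteq> carrier G"
  shows "freq (a <# \<omega>) = freq \<omega>"
proof -
  have ac: "a \<in> carrier G" "inv a \<in> carrier G" using a by auto
  have "a <# \<omega> \<subseteq> carrier G" using \<omega> ac unfolding l_coset_def by auto
  then have "freq (inv a <# (a <# \<omega>)) \<le> freq (a <# \<omega>)" using freq_left_le[of "inv a"] a by simp
  moreover have "inv a <# (a <# \<omega>) = \<omega>" using l_coset_mult[OF \<omega> ac(2,1)] ac l_coset_one[OF \<omega>] by simp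
  ultimately show ?thesis using freq_left_le[OF a \<omega>] by simp
qed

end

section \<open>Extending the action of the stable letter\<close>

context hnn_pieces
begin

text \<open>By \<open>cov\<close> there are finitely many types and each of them occurs in
  \<open>Y0\<close>. By \<open>path\<close> the moves prescribed on \<open>Q\<close> determine how
  the generators of \<open>H\<close> act on the base point.\<close>

lemma virtual_retract:
  assumes one: "\<one> \<in> Q" and cov: "\<And>x. x \<in> carrier G \<Longrightarrow> \<exists>q\<in>Q. W x = W q"
    and S: "S \<subseteq> H" "generate G S = H"
    and path: "\<And>s Y \<beta> pt. \<lbrakk>s \<in> S; left_act G \<beta> Y; follows Y \<beta> pt Q\<rbrakk> \<Longrightarrow> \<beta> s (pt \<one>) = pt s"
  shows "virtual_retract G H"
proof -
  define \<Omega> where "\<Omega> = W ` carrier G"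
  have \<Omega>Q: "\<Omega> = W ` Q" unfolding \<Omega>_def using cov Q(2) by blast
  have \<Omega>: "finite \<Omega>" unfolding \<Omega>Q using Q(1) by simp
  have om\<Omega>: "om y \<in> \<Omega>" if "y \<in> Y0" for y
    using that om_pts U_carrier unfolding Y0_def \<Omega>_def by auto
  have fin_om: "finite (R0.orb ` {y \<in> Y0. om y = \<omega>})" for \<omega>
    by (rule finite_subset[OF _ finite_orbits0]) auto
  have freq_pos: "freq \<omega> > 0" if \<omega>: "\<omega> \<in> \<Omega>" for \<omega>
  proof -
    obtain q where q: "q \<in> Q" "\<omega> = W q" using \<omega> \<Omega>Q by blast
    have "pts q \<in> Y0" "om (pts q) = \<omega>" unfolding Y0_def using q Q_U om_pts Q(2) by auto
    then have "R0.orb (pts q) \<in> R0.orb ` {y \<in> Y0. om y = \<omega>}" by blast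
    then show ?thesis unfolding freq_def using fin_om[of \<omega>] card_gt_0_iff by blast
  qed
  \<comment> \<open>With \<open>F div freq \<omega>\<close> copies of the orbits of type \<open>\<omega>\<close>, every type has \<open>F\<close> orbits.\<close>
  define F where "F = (\<Prod>\<omega>\<in>\<Omega>. freq \<omega>)"
  have F: "F div freq \<omega> * freq \<omega> = F" "F div freq \<omega> > 0" "F div freq \<omega> \<le> F" if "\<omega> \<in> \<Omega>" for \<omega>
  proof -
    have "freq \<omega> dvd F" unfolding F_def using \<Omega> that by (rule dvd_prodI)
    then show "F div freq \<omega> * freq \<omega> = F" by simp
    moreover have "F > 0" unfolding F_def using freq_pos by (simp add: prod_pos)
    ultimately show "F div freq \<omega> > 0" by (metis gr0I mult_0)
    show "F div freq \<omega> \<le> F" by simp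
  qed
  define Y where "Y = {(k, y). y \<in> Y0 \<and> k < F div freq (om y)}"
  define \<delta> where "\<delta> = (\<lambda>(k :: nat, y :: 'a set) h. (k, y #> h))"
  define \<alpha> where "\<alpha> = (\<lambda>a (k :: nat, y :: 'a set). (k, a <# y))"
  have YI: "(k, y) \<in> Y \<longleftrightarrow> y \<in> Y0 \<and> k < F div freq (om y)" for k y unfolding Y_def by simp
  have \<delta>[simp]: "\<delta> (k, y) h = (k, y #> h)" and \<alpha>[simp]: "\<alpha> a (k, y) = (k, a <# y)" for k h a and y :: "'a set"
    unfolding \<delta>_def \<alpha>_def by auto
  have Yx: "\<exists>k x. x \<in> U \<and> y = (k, pts x)" if "y \<in> Y" for y using that unfolding Y_def Y0_def by auto
  have om_h: "om (y #> h) = om y" if "y \<in> Y0" "h \<in> H" for y h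
  proof -
    obtain x where x: "x \<in> U" "y = pts x" using \<open>y \<in> Y0\<close> unfolding Y0_def by blast
    have "y #> h = pts (x \<otimes> h)" using pts_right U_carrier x \<open>h \<in> H\<close> by simp
    then show ?thesis using x om_pts[of x] om_pts[of "x \<otimes> h"] W_h U_carrier \<open>h \<in> H\<close> by simp
  qed
  interpret R: free_right_action G H Y \<delta>
  proof
    fix y h k
    show "y \<in> Y \<Longrightarrow> h \<in> H \<Longrightarrow> \<delta> y h \<in> Y" unfolding Y_def using R0.closed om_h by auto
    show "y \<in> Y \<Longrightarrow> \<delta> y \<one> = y" unfolding Y_def using R0.act_one by auto
    show "y \<in> Y \<Longrightarrow> h \<in> H \<Longrightarrow> k \<in> H \<Longrightarrow> \<delta> (\<delta> y h) k = \<delta> y (h \<otimes> k)" unfolding Y_def using R0.act_mult by auto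
    show "y \<in> Y \<Longrightarrow> h \<in> H \<Longrightarrow> k \<in> H \<Longrightarrow> \<delta> y h = \<delta> y k \<Longrightarrow> h = k" unfolding Y_def using R0.free by auto
  qed
  have orbY: "R.orb (k, y) = Pair k ` R0.orb y" for k y
    unfolding R.orb_def R0.orb_def by auto
  \<comment> \<open>The condition that yields the defining relation: the factor \<open>c\<close>
    disappears from \<open>inv x' \<otimes> n \<otimes> x'\<close> because it commutes with
    \<open>N\<close>.\<close>
  define adm where "adm y z \<longleftrightarrow> (\<exists>x x' c. x \<in> carrier G \<and> x' \<in> carrier G \<and> c \<in> cent G N \<and> 
    snd y = pts x \<and> snd z = pts x' \<and> x' = c \<otimes> t \<otimes> x)" for y z :: "nat \<times> 'a set"
  \<comment> \<open>The elements on which the move of \<open>t\<close> is prescribed, saturated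
    under \<open>H\<close> so that the partial map can be equivariant.\<close>
  define QH where "QH = {q \<otimes> h | q h. q \<in> Q \<and> t \<otimes> q \<in> Q \<and> h \<in> H}"
  have QH: "x \<in> U \<and> t \<otimes> x \<in> U \<and> (\<forall>h\<in>H. x \<otimes> h \<in> QH \<and> t \<otimes> (x \<otimes> h) = t \<otimes> x \<otimes> h)" if "x \<in> QH" for x
  proof -
    obtain q h where x: "q \<in> Q" "t \<otimes> q \<in> Q" "h \<in> H" "x = q \<otimes> h" using \<open>x \<in> QH\<close> unfolding QH_def by blast
    have qc: "q \<in> carrier G" using x Q(2) by blast
    have "t \<otimes> x = (t \<otimes> q) \<otimes> h" using x qc t by (simp add: m_assoc)
    then have 1: "x \<in> U" "t \<otimes> x \<in> U" using U_right[OF Q_U] x by auto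
    have "x \<otimes> k \<in> QH \<and> t \<otimes> (x \<otimes> k) = t \<otimes> x \<otimes> k" if k: "k \<in> H" for k
    proof
      have "x \<otimes> k = q \<otimes> (h \<otimes> k)" using x qc k by (simp add: m_assoc)
      then show "x \<otimes> k \<in> QH" unfolding QH_def using x k by blast
      show "t \<otimes> (x \<otimes> k) = t \<otimes> x \<otimes> k" using x qc k t by (simp add: m_assoc)
    qed
    with 1 show ?thesis by blast
  qed
  have inj1: "x = x'" if xx: "x \<in> QH" "x' \<in> QH" "pts x = pts x'" for x x'
  proof -
    obtain q h where x: "q \<in> Q" "h \<in> H" "x = q \<otimes> h" using xx(1) unfolding QH_def by blast
    obtain q' h' where x': "q' \<in> Q" "h' \<in> H" "x' = q' \<otimes> h'" using xx(2) unfolding QH_def by blast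
    show ?thesis using pts_inj[OF x(1) x'(1) x(2) x'(2)] xx(3) x(3) x'(3) by simp
  qed
  have inj2: "x = x'" if xx: "x \<in> QH" "x' \<in> QH" "pts (t \<otimes> x) = pts (t \<otimes> x')" for x x'
  proof -
    obtain q h where x: "t \<otimes> q \<in> Q" "q \<in> Q" "h \<in> H" "x = q \<otimes> h" using xx(1) unfolding QH_def by blast
    obtain q' h' where x': "t \<otimes> q' \<in> Q" "q' \<in> Q" "h' \<in> H" "x' = q' \<otimes> h'" using xx(2) unfolding QH_def by blast
    have c: "q \<in> carrier G" "q' \<in> carrier G" using x x' Q(2) by auto
    have e: "t \<otimes> x = (t \<otimes> q) \<otimes> h" "t \<otimes> x' = (t \<otimes> q') \<otimes> h'" using x x' c t by (simp_all add: m_assoc)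
    have "t \<otimes> x = t \<otimes> x'" using pts_inj[OF x(1) x'(1) x(3) x'(3)] xx(3) unfolding e by simp
    then show ?thesis using t x x' c by simp
  qed
  \<comment> \<open>The prescribed moves live in copy \<open>0\<close>, which is present for every
    type.\<close>
  define E where "E = (\<lambda>x. (0 :: nat, pts x)) ` QH"
  define \<tau>0 where "\<tau>0 y = (0 :: nat, pts (t \<otimes> (THE x. x \<in> QH \<and> snd y = pts x)))" for y :: "nat \<times> 'a set"
  have \<tau>0: "\<tau>0 (0, pts x) = (0, pts (t \<otimes> x))" if x: "x \<in> QH" for x
  proof -
    have "(THE u. u \<in> QH \<and> snd (0 :: nat, pts x) = pts u) = x"
      by (rule the_equality) (use x inj1 in auto)
    then show ?thesis unfolding \<tau>0_def by simp
  qed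
  have pts0: "(0, pts x) \<in> Y" if "x \<in> U" for x
    unfolding YI using that F(2)[OF om\<Omega>, of "pts x"] unfolding Y0_def by auto
  have EY: "E \<subseteq> Y" unfolding E_def using QH pts0 by blast
  have Tbij: "bij_betw (\<lambda>\<omega> :: 'a set. t <# \<omega>) \<Omega> \<Omega>"
  proof (rule bij_betw_byWitness[where f' = "\<lambda>\<omega> :: 'a set. inv t <# \<omega>"])
    have tt: "t \<in> carrier G" "inv t \<in> carrier G" using t by auto
    show "\<forall>a\<in>\<Omega>. inv t <# (t <# a) = a"
      unfolding \<Omega>_def using l_coset_mult[OF W_carrier tt(2,1)] l_coset_one[OF W_carrier] tt by auto
    show "\<forall>a\<in>\<Omega>. t <# (inv t <# a) = a"
      unfolding \<Omega>_def using l_coset_mult[OF W_carrier tt] l_coset_one[OF W_carrier] tt by auto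
    show "(\<lambda>\<omega> :: 'a set. t <# \<omega>) ` \<Omega> \<subseteq> \<Omega>" "(\<lambda>\<omega> :: 'a set. inv t <# \<omega>) ` \<Omega> \<subseteq> \<Omega>"
      unfolding \<Omega>_def using W_left[OF _ tt(1)] W_left[OF _ tt(2)] tt by (auto simp flip: W_left)
  qed
  have Wct: "W (c \<otimes> t \<otimes> x) = t <# W x" if "c \<in> cent G N" "x \<in> carrier G" for c x
    using W_z[of "t \<otimes> x" c] W_left[of x t] that t by (simp add: m_assoc)
  have finY: "finite (R.orb ` Y)"
  proof (rule finite_subset)
    show "R.orb ` Y \<subseteq> (\<lambda>(k, O'). Pair k ` O') ` ({..<F} \<times> R0.orb ` Y0)"
    proof
      fix O' assume "O' \<in> R.orb ` Y"
      then obtain k y where ky: "y \<in> Y0" "k < F div freq (om y)" "O' = R.orb (k, y)" unfolding Y_def by blast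
      have "k < F" using ky(2) F(3)[OF om\<Omega>[OF ky(1)]] by (rule less_le_trans)
      then show "O' \<in> (\<lambda>(k, O'). Pair k ` O') ` ({..<F} \<times> R0.orb ` Y0)" using ky orbY by force
    qed
    show "finite ((\<lambda>(k, O'). Pair k ` O') ` ({..<F} \<times> R0.orb ` Y0))" using finite_orbits0 by simp
  qed
  have card_om: "card (R.orb ` {y \<in> Y. om (snd y) = \<omega>}) = F" if \<omega>: "\<omega> \<in> \<Omega>" for \<omega>
  proof -
    have e: "R.orb ` {y \<in> Y. om (snd y) = \<omega>} = 
      (\<lambda>(k, O'). Pair k ` O') ` ({..<F div freq \<omega>} \<times> R0.orb ` {y \<in> Y0. om y = \<omega>})" (is "?l = ?f ` ?r")
    proof (intro subset_antisym subsetI)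
      fix O' assume "O' \<in> ?l"
      then obtain k y where "y \<in> Y0" "k < F div freq (om y)" "om y = \<omega>" "O' = R.orb (k, y)" unfolding Y_def by auto
      then show "O' \<in> ?f ` ?r" using orbY by force
    next
      fix O' assume "O' \<in> ?f ` ?r"
      then obtain k y where "k < F div freq \<omega>" "y \<in> Y0" "om y = \<omega>" "O' = Pair k ` R0.orb y" by auto
      then have "(k, y) \<in> {y \<in> Y. om (snd y) = \<omega>}" "O' = R.orb (k, y)" using orbY YI by auto
      then show "O' \<in> ?l" by blast
    qed
    have "inj_on ?f ?r"
    proof (rule inj_onI, clarify)
      fix k y k' y' assume y: "y \<in> Y0" "y' \<in> Y0" and e: "Pair k ` R0.orb y = Pair k' ` R0.orb y'"
      have "y \<in> R0.orb y" by (rule R0.orb_self[OF y(1)])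
      then have "(k, y) \<in> Pair k' ` R0.orb y'" using e by blast
      then have "k = k'" by auto
      moreover have "R0.orb y = R0.orb y'" using e \<open>k = k'\<close> by (auto dest: inj_image_eq_iff[THEN iffD1, rotated] simp: inj_on_def)
      ultimately show "k = k' \<and> R0.orb y = R0.orb y'" by blast
    qed
    then have "card ?l = card ?r" unfolding e by (rule card_image)
    also have "\<dots> = F div freq \<omega> * freq \<omega>" by (simp add: card_cartesian_product freq_def)
    finally show ?thesis using F(1)[OF \<omega>] by simp
  qed
  obtain \<tau> where \<tau>: "bij_betw \<tau> Y Y" "\<And>y h. \<lbrakk>y \<in> Y; h \<in> H\<rbrakk> \<Longrightarrow> \<tau> (\<delta> y h) = \<delta> (\<tau> y) h"
    "\<And>y. y \<in> E \<Longrightarrow> \<tau> y = \<tau>0 y" "\<And>y. y \<in> Y \<Longrightarrow> adm y (\<tau> y)"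
  proof (rule R.equivariant_extension[of adm E \<tau>0 "\<lambda>y. om (snd y)" \<Omega> "\<lambda>\<omega> :: 'a set. t <# \<omega>" F])
    show "finite (R.orb ` Y)" by (rule finY)
    show "adm (\<delta> y h) (\<delta> z h)" if yz: "y \<in> Y" "z \<in> Y" "h \<in> H" "adm y z" for y z h
    proof -
      obtain x x' c where x: "x \<in> carrier G" "x' \<in> carrier G" "c \<in> cent G N" 
        "snd y = pts x" "snd z = pts x'" "x' = c \<otimes> t \<otimes> x" using yz(4) unfolding adm_def by blast
      have "snd (\<delta> y h) = pts (x \<otimes> h)" "snd (\<delta> z h) = pts (x' \<otimes> h)"
        using x pts_right yz(3) by (auto simp: \<delta>_def split: prod.splits)
      moreover have "x' \<otimes> h = c \<otimes> t \<otimes> (x \<otimes> h)" using x yz(3) t by (simp add: m_assoc)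
      moreover have "x \<otimes> h \<in> carrier G" "x' \<otimes> h \<in> carrier G" using x(1,2) yz(3) by auto
      ultimately show ?thesis unfolding adm_def using x(3) by blast
    qed
    show "E \<subseteq> Y" by (rule EY)
    show "\<delta> y h \<in> E" if "y \<in> E" "h \<in> H" for y h
      using that pts_right QH U_carrier unfolding E_def by (force simp flip: pts_right)
    show "inj_on \<tau>0 E"
    proof (rule inj_onI)
      fix y z assume "y \<in> E" "z \<in> E" and e: "\<tau>0 y = \<tau>0 z"
      then obtain x x' where x: "x \<in> QH" "y = (0, pts x)" "x' \<in> QH" "z = (0, pts x')" unfolding E_def by blast
      then show "y = z" using e \<tau>0 inj2 by auto
    qed
    show "\<tau>0 ` E \<subseteq> Y" unfolding E_def using QH pts0 \<tau>0 by auto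
    show "\<tau>0 (\<delta> y h) = \<delta> (\<tau>0 y) h" if yh: "y \<in> E" "h \<in> H" for y h
    proof -
      obtain x where x: "x \<in> QH" "y = (0, pts x)" using yh(1) unfolding E_def by blast
      note q = QH[OF x(1)]
      have "\<delta> y h = (0, pts (x \<otimes> h))" using pts_right U_carrier q x yh by simp
      then have "\<tau>0 (\<delta> y h) = (0, pts (t \<otimes> x \<otimes> h))" using \<tau>0 q yh by auto
      also have "\<dots> = \<delta> (\<tau>0 y) h" using \<tau>0 x pts_right U_carrier q yh by simp
      finally show ?thesis .
    qed
    show "adm y (\<tau>0 y)" if "y \<in> E" for y
    proof -
      obtain x where x: "x \<in> QH" "y = (0, pts x)" using \<open>y \<in> E\<close> unfolding E_def by blast
      have "x \<in> carrier G" "t \<otimes> x \<in> carrier G" "t \<otimes> x = \<one> \<otimes> t \<otimes> x" using QH[OF x(1)] U_carrier t by auto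
      then show ?thesis unfolding adm_def using x \<tau>0[OF x(1)] Z.one_closed by (metis snd_conv)
    qed
    show "(\<lambda>y. om (snd y)) ` Y \<subseteq> \<Omega>" using om\<Omega> unfolding Y_def by auto
    show "om (snd (\<delta> y h)) = om (snd y)" if "y \<in> Y" "h \<in> H" for y h using that om_h unfolding Y_def by auto
    show "om (snd z) = t <# om (snd y)" if "y \<in> Y" "z \<in> Y" "adm y z" for y z
      using that om_pts Wct unfolding adm_def by auto
    \<comment> \<open>The equation of types means
      \<open>t \<otimes> x = d \<otimes> x' \<otimes> h\<close>; translating \<open>z\<close> by
      this \<open>h\<close> and moving \<open>d\<close> to the other side gives an admissible
      pair.\<close>
    show "\<exists>h\<in>H. adm y (\<delta> z h)" if yz: "y \<in> Y" "z \<in> Y" "om (snd z) = t <# om (snd y)" for y z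
    proof -
      obtain k x where x: "x \<in> U" "y = (k, pts x)" using Yx yz(1) by blast
      obtain l x' where x': "x' \<in> U" "z = (l, pts x')" using Yx yz(2) by blast
      have c: "x \<in> carrier G" "x' \<in> carrier G" using x x' U_carrier by auto
      have tx: "t \<otimes> x \<in> carrier G" using c t by simp
      have "W x' = W (t \<otimes> x)" using yz(3) x x' om_pts W_left c t by simp
      then have "t \<otimes> x \<in> W x'" using W_self[OF tx] by simp
      then obtain d h where d: "d \<in> cent G N" "h \<in> H" "t \<otimes> x = d \<otimes> x' \<otimes> h" unfolding W_def by blast
      have "inv d \<otimes> t \<otimes> x = inv d \<otimes> (t \<otimes> x)" using d c t by (simp add: m_assoc)
      also have "\<dots> = x' \<otimes> h" unfolding d(3) using d c by (simp add: m_assoc)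
      finally have e: "x' \<otimes> h = inv d \<otimes> t \<otimes> x" ..
      have "snd (\<delta> z h) = pts (x' \<otimes> h)" using x' pts_right c d by simp
      moreover have "x' \<otimes> h \<in> carrier G" "inv d \<in> cent G N" using c d by auto
      ultimately have "adm y (\<delta> z h)" unfolding adm_def using x c e by (metis snd_conv)
      then show ?thesis using d by blast
    qed
    show "card (R.orb ` {y \<in> Y. om (snd y) = \<omega>}) = F" if "\<omega> \<in> \<Omega>" for \<omega> by (rule card_om[OF that])
  qed (use Tbij that in auto)
  \<comment> \<open>Since \<open>N\<close> is normal and contained in \<open>H\<close>, the left
    action of \<open>n\<close> on a point is a right translation by an element of \<open>H\<close>,
    and such translations commute with \<tau>.\<close>
  have nact: "\<alpha> n y = \<delta> y (inv x \<otimes> n \<otimes> x)" if nx: "n \<in> N" "x \<in> carrier G" "snd y = pts x" for n x y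
  proof -
    have nc: "n \<in> carrier G" using nx by auto
    have nA: "n \<in> A" using nx NA by blast
    have ic: "inv x \<otimes> n \<otimes> x \<in> H" using N.inv_op_closed1[OF nx(2,1)] NH by blast
    have "n <# pts x = pts (n \<otimes> x)" using pts_left[OF nx(2) nA] by simp
    also have "n \<otimes> x = x \<otimes> (inv x \<otimes> n \<otimes> x)" using nc nx by (simp add: m_assoc)
    also have "pts \<dots> = pts x #> (inv x \<otimes> n \<otimes> x)" by (rule pts_right[OF nx(2) ic])
    finally show ?thesis using nx(3) by (cases y) simp
  qed
  have rel: "\<alpha> n (\<tau> y) = \<tau> (\<alpha> (inv t \<otimes> n \<otimes> t) y)" if n: "n \<in> N" and y: "y \<in> Y" for n y
  proof -
    obtain x x' c where x: "x \<in> carrier G" "x' \<in> carrier G" "c \<in> cent G N" 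
        "snd y = pts x" "snd (\<tau> y) = pts x'" "x' = c \<otimes> t \<otimes> x" using \<tau>(4)[OF y] unfolding adm_def by blast
    have n': "inv t \<otimes> n \<otimes> t \<in> N" using N.inv_op_closed1[OF t n] .
    have nc: "n \<in> carrier G" using n by auto
    have cH: "inv x \<otimes> (inv t \<otimes> n \<otimes> t) \<otimes> x \<in> H" using N.inv_op_closed1[OF x(1) n'] NH by blast
    have "inv x' \<otimes> n \<otimes> x' = inv x \<otimes> (inv t \<otimes> (inv c \<otimes> (n \<otimes> c)) \<otimes> t) \<otimes> x"
      unfolding x(6) using x(1,3) t nc by (simp add: inv_mult_group m_assoc)
    also have "n \<otimes> c = c \<otimes> n" using centD[OF x(3) n] by simp
    also have "inv c \<otimes> (c \<otimes> n) = n" using x(3) nc by simp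
    finally have "\<alpha> n (\<tau> y) = \<delta> (\<tau> y) (inv x \<otimes> (inv t \<otimes> n \<otimes> t) \<otimes> x)" using nact[OF n x(2,5)] by simp
    also have "\<dots> = \<tau> (\<delta> y (inv x \<otimes> (inv t \<otimes> n \<otimes> t) \<otimes> x))" using \<tau>(2)[OF y cH] by simp
    also have "\<dots> = \<tau> (\<alpha> (inv t \<otimes> n \<otimes> t) y)" using nact[OF n' x(1,4)] by simp
    finally show ?thesis .
  qed
  \<comment> \<open>\<open>A\<close> changes the type of a point but, by \<open>freq_left\<close>,
    not the number of copies of its orbit.\<close>
  have \<alpha>Y: "\<alpha> a y \<in> Y" if "a \<in> A" "y \<in> Y" for a y
  proof -
    obtain k v where v: "y = (k, v)" "v \<in> Y0" "k < F div freq (om v)" using \<open>y \<in> Y\<close> unfolding Y_def by blast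
    then show ?thesis using Y0_left[OF v(2) \<open>a \<in> A\<close>] freq_left[OF \<open>a \<in> A\<close> om_carrier[OF v(2)]] by (simp add: YI)
  qed
  obtain \<beta> where \<beta>: "left_act G \<beta> Y" "\<And>a y. \<lbrakk>a \<in> A; y \<in> Y\<rbrakk> \<Longrightarrow> \<beta> a y = \<alpha> a y" "\<And>y. y \<in> Y \<Longrightarrow> \<beta> t y = \<tau> y"
  proof -
    have "\<exists>\<beta>. left_act G \<beta> Y \<and> (\<forall>a\<in>A. \<forall>y\<in>Y. \<beta> a y = \<alpha> a y) \<and> (\<forall>y\<in>Y. \<beta> t y = \<tau> y)"
    proof (rule universal)
      show "\<alpha> \<one> y = y" if "y \<in> Y" for y
        using that l_coset_one[OF Y0_carrier] unfolding Y_def by auto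
      show "\<alpha> (a \<otimes> b) y = \<alpha> a (\<alpha> b y)" if "a \<in> A" "b \<in> A" "y \<in> Y" for a b y
        using that l_coset_mult[OF Y0_carrier] unfolding Y_def by auto
    qed (use \<alpha>Y \<tau>(1) rel in auto)
    then show thesis using that by blast
  qed
  note \<beta>D = left_actD[OF \<beta>(1)]
  have comm: "\<forall>y\<in>Y. \<forall>h\<in>H. \<beta> g (\<delta> y h) = \<delta> (\<beta> g y) h" if "g \<in> carrier G" for g
    using that
  proof (rule word_induct)
    show "\<forall>y\<in>Y. \<forall>h\<in>H. \<beta> \<one> (\<delta> y h) = \<delta> (\<beta> \<one> y) h" using \<beta>D(2) R.closed by simp
    fix g assume g: "g \<in> carrier G" and IH: "\<forall>y\<in>Y. \<forall>h\<in>H. \<beta> g (\<delta> y h) = \<delta> (\<beta> g y) h"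
    have step: "\<forall>y\<in>Y. \<forall>h\<in>H. \<beta> (b \<otimes> g) (\<delta> y h) = \<delta> (\<beta> (b \<otimes> g) y) h" 
      if b: "b \<in> carrier G" "\<And>y h. \<lbrakk>y \<in> Y; h \<in> H\<rbrakk> \<Longrightarrow> \<beta> b (\<delta> y h) = \<delta> (\<beta> b y) h" for b
      using \<beta>D(1,3) R.closed IH g b by simp
    have tstep: "\<beta> t (\<delta> y h) = \<delta> (\<beta> t y) h" if "y \<in> Y" "h \<in> H" for y h
      using that \<beta>(3) \<tau>(2) R.closed by simp
    show "\<forall>y\<in>Y. \<forall>h\<in>H. \<beta> (t \<otimes> g) (\<delta> y h) = \<delta> (\<beta> (t \<otimes> g) y) h" by (rule step[OF t tstep])
    show "\<forall>y\<in>Y. \<forall>h\<in>H. \<beta> (inv t \<otimes> g) (\<delta> y h) = \<delta> (\<beta> (inv t \<otimes> g) y) h"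
    proof (rule step)
      show "inv t \<in> carrier G" using t by simp
      fix y h assume y: "y \<in> Y" "h \<in> H"
      define z where "z = \<beta> (inv t) y"
      have z: "z \<in> Y" unfolding z_def using \<beta>D(1) t y by simp
      have "\<beta> t z = y" unfolding z_def using \<beta>D(3)[of t "inv t" y] \<beta>D(2) t y by simp
      then have "\<delta> y h = \<beta> t (\<delta> z h)" using tstep z y by simp
      then have "\<beta> (inv t) (\<delta> y h) = \<beta> (inv t) (\<beta> t (\<delta> z h))" by simp
      also have "\<dots> = \<beta> (inv t \<otimes> t) (\<delta> z h)"
        by (rule \<beta>D(3)[symmetric]) (use t R.closed z y in auto)
      also have "\<dots> = \<delta> z h" using \<beta>D(2) t R.closed z y by simp
      finally show "\<beta> (inv t) (\<delta> y h) = \<delta> (\<beta> (inv t) y) h" unfolding z_def .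
    qed
    fix a assume a: "a \<in> A"
    show "\<forall>y\<in>Y. \<forall>h\<in>H. \<beta> (a \<otimes> g) (\<delta> y h) = \<delta> (\<beta> (a \<otimes> g) y) h"
    proof (rule step)
      show "a \<in> carrier G" using a by simp
      fix y h assume y: "y \<in> Y" "h \<in> H"
      obtain k v where v: "y = (k, v)" "v \<in> Y0" using y unfolding Y_def by blast
      have "\<alpha> a (\<delta> y h) = \<delta> (\<alpha> a y) h" using l_coset_r_coset[OF Y0_carrier[OF v(2)]] a y v by simp
      then show "\<beta> a (\<delta> y h) = \<delta> (\<beta> a y) h" using \<beta>(2) a y R.closed by simp
    qed
  qed
  define pt where "pt x = (0 :: nat, pts x)" for x
  have fol: "follows Y \<beta> pt Q" unfolding follows_def
  proof (intro conjI ballI impI)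
    show "pt ` Q \<subseteq> Y" unfolding pt_def using pts0 Q_U by blast
    show "\<beta> a (pt x) = pt (a \<otimes> x)" if "x \<in> Q" "a \<in> A" for x a
      unfolding pt_def using \<beta>(2)[OF that(2) pts0[OF Q_U[OF that(1)]]] pts_left[OF U_carrier[OF Q_U[OF that(1)]] that(2)] by simp
    show "\<beta> t (pt x) = pt (t \<otimes> x)" if x: "x \<in> Q" "t \<otimes> x \<in> Q" for x
    proof -
      have "x = x \<otimes> \<one>" using x(1) Q(2) by auto
      then have "x \<in> QH" unfolding QH_def using x H.one_closed by blast
      moreover have "pt x \<in> E" unfolding E_def pt_def using calculation by blast
      ultimately show ?thesis using \<beta>(3) \<tau>(3) \<tau>0 EY unfolding pt_def by auto
    qed
  qed
  define y0 where "y0 = pt \<one>"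
  have y0: "y0 \<in> Y" unfolding y0_def pt_def using pts0 Q_U one by blast
  have Hy: "\<beta> h y0 = \<delta> y0 h" if h: "h \<in> H" for h
  proof -
    \<comment> \<open>The elements satisfying the claim form a subgroup because the two actions
      commute, so it suffices to treat the generators in \<open>S\<close>.\<close>
    define D where "D = {h \<in> H. \<beta> h y0 = \<delta> y0 h}"
    have "subgroup D G"
    proof (rule subgroupI)
      show "D \<subseteq> carrier G" unfolding D_def using H.subset by blast
      have "\<one> \<in> D" unfolding D_def using \<beta>D(2)[OF y0] R.act_one[OF y0] by simp
      then show "D \<noteq> {}" by blast
      fix a assume a: "a \<in> D"
      then have aH: "a \<in> H" "\<beta> a y0 = \<delta> y0 a" unfolding D_def by auto
      have "\<delta> (\<beta> (inv a) y0) a = \<beta> (inv a) (\<beta> a y0)" using comm[of "inv a"] aH y0 by simp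
      also have "\<dots> = \<beta> (inv a \<otimes> a) y0" using \<beta>D(3)[of "inv a" a y0] aH y0 by simp
      also have "\<dots> = y0" using \<beta>D(2)[OF y0] aH by simp
      finally have "\<delta> (\<delta> (\<beta> (inv a) y0) a) (inv a) = \<delta> y0 (inv a)" by simp
      then have "\<beta> (inv a) y0 = \<delta> y0 (inv a)" using R.act_inv[of "\<beta> (inv a) y0" a] \<beta>D(1)[of "inv a" y0] aH y0 by simp
      then show "inv a \<in> D" unfolding D_def using aH by simp
      fix b assume "b \<in> D"
      then have b: "b \<in> H" "\<beta> b y0 = \<delta> y0 b" unfolding D_def by auto
      have "\<beta> (a \<otimes> b) y0 = \<beta> a (\<delta> y0 b)" using \<beta>D(3)[of a b y0] aH b y0 by simp
      also have "\<dots> = \<delta> (\<delta> y0 a) b" using comm[of a] aH b y0 by simp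
      also have "\<dots> = \<delta> y0 (a \<otimes> b)" using R.act_mult aH b y0 by simp
      finally show "a \<otimes> b \<in> D" unfolding D_def using aH b by simp
    qed
    moreover have "S \<subseteq> D"
    proof
      fix s assume s: "s \<in> S"
      then have sH: "s \<in> H" using S by blast
      have "\<beta> s y0 = pt s" unfolding y0_def by (rule path[OF s \<beta>(1) fol])
      also have "\<dots> = \<delta> y0 s" unfolding y0_def pt_def using pts_right[of \<one> s] sH by simp
      finally show "s \<in> D" unfolding D_def using sH by simp
    qed
    ultimately have "H \<subseteq> D" using generate_subgroup_incl S(2) by blast
    then show ?thesis using h unfolding D_def by blast
  qed
  show ?thesis
  proof (rule R.virtual_retract_biset[of \<beta> y0])
    show "\<beta> g (\<delta> y h) = \<delta> (\<beta> g y) h" if "g \<in> carrier G" "y \<in> Y" "h \<in> H" for g y h using comm that by blast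
  qed (use \<beta>D finY y0 Hy in auto)
qed

end

section \<open>Passing between the base group and \<open>G\<close>, and the necessity of the
  covering\<close>

context group
begin

lemma fin_cover_of_subgroup:
  assumes "subgroup P G" "fin_cover (G\<lparr>carrier := P\<rparr>) K L"
  shows "fin_cover G K L"
  using assms(2) subgroup.subset[OF assms(1)] unfolding fin_cover_def set_mult_def by auto

lemma finitely_generated_of_subgroup:
  assumes "subgroup P G" "finitely_generated_in (G\<lparr>carrier := P\<rparr>) K"
  shows "finitely_generated_in G K"
proof -
  obtain S where S: "finite S" "S \<subseteq> P" "generate (G\<lparr>carrier := P\<rparr>) S = K"
    using assms(2) unfolding finitely_generated_in_def by auto
  have "generate G S = K" using S generate_consistent[OF S(2) assms(1)] by simp
  then show ?thesis unfolding finitely_generated_in_def using S subgroup.subset[OF assms(1)] by blast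
qed

lemma virtually_abelian_subgroup_separation:
  assumes A: "subgroup A G" and fg: "finitely_generated_in (G\<lparr>carrier := A\<rparr>) A" 
    and va: "virtually_abelian (G\<lparr>carrier := A\<rparr>)"
    and P: "subgroup P G" "P \<subseteq> A" and F: "finite F" "F \<inter> P = {}"
  obtains M where "subgroup M G" "M \<subseteq> A" "normalizes G P M" "M \<inter> P = {\<one>}" "fin_cover G (M <#> P) A" 
    "F \<inter> (M <#> P) = {}"
proof -
  interpret GA: group "G\<lparr>carrier := A\<rparr>" by (rule subgroup.subgroup_is_group[OF A]) (rule is_group)
  have PA: "subgroup P (G\<lparr>carrier := A\<rparr>)" using subgroup_incl[OF P(1) A P(2)] .
  obtain M where M: "subgroup M (G\<lparr>carrier := A\<rparr>)" "normalizes (G\<lparr>carrier := A\<rparr>) P M" "M \<inter> P = {\<one>}"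
    "fin_cover (G\<lparr>carrier := A\<rparr>) (M <#> P) A" "F \<inter> (M <#> P) = {}"
    using GA.virtually_abelian_separation[OF _ va PA F] fg by (auto simp: set_mult_def)
  have "M \<subseteq> A" using subgroup.subset[OF M(1)] by simp
  moreover have "normalizes G P M"
    using M(2) P(2) m_inv_consistent[OF A] unfolding normalizes_def by (auto simp: subset_iff)
  ultimately show thesis using that incl_subgroup[OF A M(1)] M(3,5) fin_cover_of_subgroup[OF A M(4)] by blast
qed

lemma virtual_retract_normal_cover:
  assumes N: "N \<lhd> G" and VR: "virtual_retract G N"
  shows "fin_cover G (N <#> cent G N) (carrier G)"
proof -
  interpret N: normal N G by fact
  obtain K \<rho> where K: "finite_index G K" "N \<subseteq> K" and \<rho>: "\<rho> \<in> hom (G\<lparr>carrier := K\<rparr>) (G\<lparr>carrier := N\<rparr>)" 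
    "\<And>h. h \<in> N \<Longrightarrow> \<rho> h = h"
    using VR unfolding virtual_retract_def by blast
  have Ks: "subgroup K G" "fin_cover G K (carrier G)" using K(1) by (auto simp: finite_index_iff)
  interpret K: subgroup K G by (rule Ks(1))
  have rN: "\<rho> x \<in> N" if "x \<in> K" for x using \<rho>(1) that unfolding hom_def by auto
  have rm: "\<rho> (x \<otimes> y) = \<rho> x \<otimes> \<rho> y" if "x \<in> K" "y \<in> K" for x y using \<rho>(1) that unfolding hom_def by auto
  have "K \<subseteq> N <#> cent G N"
  proof
    fix k assume k: "k \<in> K"
    \<comment> \<open>The component of \<open>k\<close> in the kernel of \<rho>. Conjugation by it
      preserves \<open>N\<close>, where \<rho> is the identity, and \<rho> sends \<open>m\<close> to
      \<open>\<one>\<close>; so it fixes every element of \<open>N\<close>.\<close>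
    define m where "m = inv (\<rho> k) \<otimes> k"
    have rk: "\<rho> k \<in> N" "inv (\<rho> k) \<in> N" using rN[OF k] by auto
    have mK: "m \<in> K" unfolding m_def using rk K(2) k by blast
    have "\<rho> m = \<one>" unfolding m_def using rm[of "inv (\<rho> k)" k] rk K(2) k \<rho>(2) by auto
    have "m \<in> cent G N"
      unfolding cent_def
    proof (intro CollectI conjI ballI)
      show mc: "m \<in> carrier G" using mK by simp
      fix n assume n: "n \<in> N"
      have nK: "n \<in> K" using n K(2) by blast
      have "m \<otimes> n \<otimes> inv m \<in> N" using N.inv_op_closed2[OF mc n] .
      then have "m \<otimes> n \<otimes> inv m = \<rho> (m \<otimes> n \<otimes> inv m)" using \<rho>(2) by simp
      also have "\<dots> = \<rho> m \<otimes> \<rho> n \<otimes> \<rho> (inv m)" using rm mK nK by simp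
      also have "\<dots> = n \<otimes> (\<rho> m \<otimes> \<rho> (inv m))" using \<open>\<rho> m = \<one>\<close> \<rho>(2) n rN mK by simp
      also have "\<rho> m \<otimes> \<rho> (inv m) = \<rho> \<one>" using rm[of m "inv m"] mK by simp
      also have "\<rho> \<one> = \<one>" using \<rho>(2) by simp
      finally have "m \<otimes> n \<otimes> inv m = n" using n by simp
      then have "m \<otimes> n \<otimes> inv m \<otimes> m = n \<otimes> m" by simp
      then show "m \<otimes> n = n \<otimes> m" using mc n by (simp add: m_assoc)
    qed
    moreover have "k = \<rho> k \<otimes> m" unfolding m_def using rk k by simp
    ultimately show "k \<in> N <#> cent G N" unfolding set_mult_def using rk by blast
  qed
  then show ?thesis using Ks(2) fin_cover_mono by blast
qed

end

section \<open>Virtual retracts containing \<open>N\<close>, and the criterion for (LR)\<close>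

context normal_hnn
begin

lemma virtual_retract_containing:
  assumes fg: "finitely_generated_in (G\<lparr>carrier := A\<rparr>) A" and va: "virtually_abelian (G\<lparr>carrier := A\<rparr>)"
    and C: "fin_cover G (N <#> cent G N) (carrier G)"
    and H: "subgroup H G" "N \<subseteq> H" "finitely_generated_in G H"
  shows "virtual_retract G H"
proof -
  interpret H: subgroup H G by (rule H(1))
  obtain S where S: "finite S" "S \<subseteq> carrier G" "generate G S = H"
    using H(3) unfolding finitely_generated_in_def by blast
  obtain T where T: "finite T" "T \<subseteq> carrier G" "carrier G \<subseteq> N <#> cent G N <#> T"
    using C unfolding fin_cover_def by blast
  have "\<forall>s\<in>S. \<exists>Q. finite Q \<and> Q \<subseteq> carrier G \<and> \<one> \<in> Q \<and> s \<in> Q \<and> 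
    (\<forall>Y \<beta> pt. left_act G \<beta> Y \<longrightarrow> follows Y \<beta> pt Q \<longrightarrow> \<beta> s (pt \<one>) = pt s)"
    using path S(2) by blast
  then obtain q where q: "\<And>s. s \<in> S \<Longrightarrow> finite (q s)" "\<And>s. s \<in> S \<Longrightarrow> q s \<subseteq> carrier G"
    "\<And>s Y \<beta> pt. \<lbrakk>s \<in> S; left_act G \<beta> Y; follows Y \<beta> pt (q s)\<rbrakk> \<Longrightarrow> \<beta> s (pt \<one>) = pt s" by metis
  \<comment> \<open>\<open>T\<close> makes every type occur, \<open>\<one>\<close> carries the base
    point, and the sets \<open>q s\<close> hold the suffixes of words for the generators of
    \<open>H\<close>.\<close>
  define Q where "Q = insert \<one> (T \<union> (\<Union>s\<in>S. q s))"
  have Q: "finite Q" "Q \<subseteq> carrier G" "\<one> \<in> Q" unfolding Q_def using q(1,2) S(1) T(1,2) by auto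
  define L where "L g = {a \<in> A. inv g \<otimes> a \<otimes> g \<in> H}" for g
  have L: "subgroup (L g) G" "L g \<subseteq> A" if "g \<in> carrier G" for g
    unfolding L_def using conj_preimage_subgroup[OF H(1) that] by auto
  \<comment> \<open>The \<open>A\<close>-part of \<open>x\<close> with respect to \<open>g\<close>.
    It is determined only modulo \<open>L g\<close>; one value is fixed so that the set
    \<open>F g\<close> below is finite.\<close>
  define da where "da g x = (SOME a. a \<in> A \<and> (\<exists>h\<in>H. x = a \<otimes> g \<otimes> h))" for g x
  have da: "da g (a \<otimes> g \<otimes> h) \<in> A \<and> inv (da g (a \<otimes> g \<otimes> h)) \<otimes> a \<in> L g" 
    if gah: "g \<in> carrier G" "a \<in> A" "h \<in> H" for g a h
  proof -
    have "\<exists>b. b \<in> A \<and> (\<exists>k\<in>H. a \<otimes> g \<otimes> h = b \<otimes> g \<otimes> k)" using gah by blast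
    from someI_ex[OF this] obtain k where k: "da g (a \<otimes> g \<otimes> h) \<in> A" "k \<in> H" "a \<otimes> g \<otimes> h = da g (a \<otimes> g \<otimes> h) \<otimes> g \<otimes> k"
      unfolding da_def[symmetric] by blast
    define b where "b = da g (a \<otimes> g \<otimes> h)"
    have bA: "b \<in> A" and e: "a \<otimes> g \<otimes> h = b \<otimes> g \<otimes> k" using k unfolding b_def by auto
    have c: "a \<in> carrier G" "b \<in> carrier G" "h \<in> carrier G" "k \<in> carrier G" using gah bA k by auto
    have "inv g \<otimes> (inv b \<otimes> a) \<otimes> g = inv g \<otimes> (inv b \<otimes> (a \<otimes> g \<otimes> h)) \<otimes> inv h" using c gah(1) by (simp add: m_assoc)
    also have "\<dots> = k \<otimes> inv h" unfolding e using c gah(1) by (simp add: m_assoc)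
    finally have "inv b \<otimes> a \<in> L g" unfolding L_def using gah k bA by simp
    then show ?thesis using bA unfolding b_def by blast
  qed
  \<comment> \<open>The finite set that the collapse has to avoid. For \<open>x\<close> outside the
    double coset \<open>A g H\<close> the value \<open>da g x\<close> is arbitrary, which merely
    adds further elements to be avoided.\<close>
  define F where "F g = {inv (da g x) \<otimes> da g y | x y. x \<in> Q \<and> y \<in> Q} - L g" for g
  have F: "finite (F g)" "F g \<inter> L g = {}" for g
  proof -
    have "{inv (da g x) \<otimes> da g y | x y. x \<in> Q \<and> y \<in> Q} = (\<lambda>(x, y). inv (da g x) \<otimes> da g y) ` (Q \<times> Q)" by auto
    then show "finite (F g)" unfolding F_def using Q(1) by simp
    show "F g \<inter> L g = {}" unfolding F_def by blast
  qed
  have "\<forall>g\<in>carrier G. \<exists>M. subgroup M G \<and> M \<subseteq> A \<and> normalizes G (L g) M \<and> M \<inter> L g = {\<one>} \<and> 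
    fin_cover G (M <#> L g) A \<and> F g \<inter> (M <#> L g) = {}"
  proof
    fix g assume g: "g \<in> carrier G"
    obtain M where "subgroup M G" "M \<subseteq> A" "normalizes G (L g) M" "M \<inter> L g = {\<one>}"
      "fin_cover G (M <#> L g) A" "F g \<inter> (M <#> L g) = {}"
      using virtually_abelian_subgroup_separation[OF A fg va L[OF g] F] by blast
    then show "\<exists>M. subgroup M G \<and> M \<subseteq> A \<and> normalizes G (L g) M \<and> M \<inter> L g = {\<one>} \<and> 
      fin_cover G (M <#> L g) A \<and> F g \<inter> (M <#> L g) = {}" by blast
  qed
  from bchoice[OF this] obtain M where M': "\<forall>g\<in>carrier G. subgroup (M g) G \<and> M g \<subseteq> A \<and> 
    normalizes G (L g) (M g) \<and> M g \<inter> L g = {\<one>} \<and> fin_cover G (M g <#> L g) A \<and> F g \<inter> (M g <#> L g) = {}"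
    by (rule exE)
  have M: "subgroup (M g) G" "M g \<subseteq> A" "normalizes G (L g) (M g)" "M g \<inter> L g = {\<one>}"
    "fin_cover G (M g <#> L g) A" "F g \<inter> (M g <#> L g) = {}" if "g \<in> carrier G" for g
    using bspec[OF M' that] by simp_all
  interpret P: hnn_pieces G A N t H Q M
  proof (rule hnn_pieces.intro[OF normal_hnn_axioms], rule hnn_pieces_axioms.intro)
    show "subgroup H G" by (rule H(1))
    show "N \<subseteq> H" by (rule H(2))
    show "finite Q" "Q \<subseteq> carrier G" by (rule Q(1), rule Q(2))
    fix g assume g: "g \<in> carrier G"
    show "subgroup (M g) G" "M g \<subseteq> A" by (rule M(1)[OF g], rule M(2)[OF g])
    show "normalizes G {a \<in> A. inv g \<otimes> a \<otimes> g \<in> H} (M g)" "M g \<inter> {a \<in> A. inv g \<otimes> a \<otimes> g \<in> H} = {\<one>}"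
      "fin_cover G (M g <#> {a \<in> A. inv g \<otimes> a \<otimes> g \<in> H}) A" using M(3-5)[OF g] unfolding L_def by auto
    fix a b h k 
    assume ab: "a \<in> A" "b \<in> A" "h \<in> H" "k \<in> H" "a \<otimes> g \<otimes> h \<in> Q" "b \<otimes> g \<otimes> k \<in> Q" 
      and mem: "inv a \<otimes> b \<in> M g <#> {a \<in> A. inv g \<otimes> a \<otimes> g \<in> H}"
    interpret Lg: subgroup "L g" G by (rule L(1)[OF g])
    interpret MgL: subgroup "M g <#> L g" G by (rule subgroup_mult_normalizes[OF M(3)[OF g] L(1)[OF g] M(1)[OF g]])
    have Lsub: "L g \<subseteq> M g <#> L g"
    proof
      fix l assume l: "l \<in> L g"
      have "l = \<one> \<otimes> l" using l by simp
      then show "l \<in> M g <#> L g" unfolding set_mult_def using l subgroup.one_closed[OF M(1)[OF g]] by blast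
    qed
    have mem': "inv a \<otimes> b \<in> M g <#> L g" using mem by (simp add: L_def)
    define a' b' where "a' = da g (a \<otimes> g \<otimes> h)" and "b' = da g (b \<otimes> g \<otimes> k)"
    have a': "a' \<in> A" "inv a' \<otimes> a \<in> L g" and b': "b' \<in> A" "inv b' \<otimes> b \<in> L g"
      using da[OF g ab(1,3)] da[OF g ab(2,4)] unfolding a'_def b'_def by auto
    have c: "a \<in> carrier G" "b \<in> carrier G" "a' \<in> carrier G" "b' \<in> carrier G" using ab a' b' by auto
    \<comment> \<open>Replacing \<open>a\<close> and \<open>b\<close> by the fixed
      \<open>A\<close>-parts multiplies by elements of \<open>L g\<close>, so the quotient stays
      inside the subgroup \<open>M g <#> L g\<close> and the choice of \<open>M g\<close> applies to
      it.\<close>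
    have e: "inv a' \<otimes> b' = (inv a' \<otimes> a) \<otimes> (inv a \<otimes> b) \<otimes> inv (inv b' \<otimes> b)"
      using c by (simp add: m_assoc inv_mult_group)
    have "inv a' \<otimes> b' \<in> M g <#> L g" unfolding e
      by (intro MgL.m_closed MgL.m_inv_closed mem' subsetD[OF Lsub a'(2)] subsetD[OF Lsub b'(2)])
    moreover have "inv a' \<otimes> b' \<in> {inv (da g x) \<otimes> da g y | x y. x \<in> Q \<and> y \<in> Q}" 
      unfolding a'_def b'_def using ab(5,6) by blast
    ultimately have l: "inv a' \<otimes> b' \<in> L g" using M(6)[OF g] unfolding F_def by blast
    have "inv a \<otimes> b = inv (inv a' \<otimes> a) \<otimes> (inv a' \<otimes> b') \<otimes> (inv b' \<otimes> b)"
      using c by (simp add: m_assoc inv_mult_group)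
    also have "\<dots> \<in> L g" using l a'(2) b'(2) by blast
    finally show "inv g \<otimes> (inv a \<otimes> b) \<otimes> g \<in> H" unfolding L_def by blast
  qed
  show ?thesis
  proof (rule P.virtual_retract[OF Q(3) _ _ S(3)])
    show "\<exists>q\<in>Q. P.W x = P.W q" if x: "x \<in> carrier G" for x
    proof -
      have "x \<in> N <#> cent G N <#> T" using T(3) x by blast
      then obtain n c u where ncu: "n \<in> N" "c \<in> cent G N" "u \<in> T" "x = n \<otimes> c \<otimes> u"
        unfolding set_mult_def by blast
      have u: "u \<in> carrier G" using ncu T(2) by blast
      have nH: "inv u \<otimes> n \<otimes> u \<in> H" using N.inv_op_closed1[OF u ncu(1)] H(2) by blast
      have "x = c \<otimes> u \<otimes> (inv u \<otimes> n \<otimes> u)"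
        using ncu u centD[OF ncu(2,1), symmetric] by (simp add: m_assoc)
      then have "P.W x = P.W u" using P.W_mult[OF u ncu(2) nH] by simp
      moreover have "u \<in> Q" unfolding Q_def using ncu by simp
      ultimately show ?thesis by blast
    qed
    show "S \<subseteq> H" using S(3) generate.incl[of _ S G] by blast
    show "\<beta> s (pt \<one>) = pt s" if s: "s \<in> S" "left_act G \<beta> Y" "follows Y \<beta> pt Q" for s Y \<beta> pt
    proof (rule q(3)[OF s(1,2)])
      show "follows Y \<beta> pt (q s)" by (rule follows_mono[OF s(3)]) (use s in \<open>auto simp: Q_def\<close>)
    qed
  qed
qed

lemma finitely_generated_in_base:
  assumes fg: "finitely_generated_in (G\<lparr>carrier := A\<rparr>) A" and va: "virtually_abelian (G\<lparr>carrier := A\<rparr>)"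
    and P: "subgroup P G" "P \<subseteq> A"
  shows "finitely_generated_in G P"
proof -
  interpret GA: group "G\<lparr>carrier := A\<rparr>" by (rule subgroup.subgroup_is_group[OF A]) (rule is_group)
  have "finitely_generated_in (G\<lparr>carrier := A\<rparr>) P"
    using GA.finitely_generated_subgroup[OF _ va subgroup_incl[OF P(1) A P(2)]] fg by simp
  then show ?thesis by (rule finitely_generated_of_subgroup[OF A])
qed

text \<open>\<open>N\<close> is finitely generated because \<open>A\<close> is Noetherian, so (LR)
  applies to \<open>N\<close> itself. In the converse direction \<open>H\<close> is compared with
  \<open>P = N <#> H\<close>, which is finitely generated since \<open>N\<close> and
  \<open>H\<close> are.\<close>

theorem property_LR_iff:
  assumes fg: "finitely_generated_in (G\<lparr>carrier := A\<rparr>) A" and va: "virtually_abelian (G\<lparr>carrier := A\<rparr>)"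
  shows "property_LR G \<longleftrightarrow> fin_cover G (N <#> cent G N) (carrier G)"
proof
  assume "property_LR G"
  then have "virtual_retract G N" 
    using finitely_generated_in_base[OF fg va N.subgroup_axioms NA] N.subgroup_axioms unfolding property_LR_def by blast
  then show "fin_cover G (N <#> cent G N) (carrier G)" by (rule virtual_retract_normal_cover[OF N])
next
  assume C: "fin_cover G (N <#> cent G N) (carrier G)"
  interpret GA: group "G\<lparr>carrier := A\<rparr>" by (rule subgroup.subgroup_is_group[OF A]) (rule is_group)
  obtain B0 where B0: "abelian_sub (G\<lparr>carrier := A\<rparr>) B0" "fin_cover (G\<lparr>carrier := A\<rparr>) B0 (carrier (G\<lparr>carrier := A\<rparr>))"
    using GA.virtually_abelianE[OF va] .
  have B0s: "subgroup B0 G" "fin_cover G B0 A" "B0 \<subseteq> A"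
    using incl_subgroup[OF A] B0 fin_cover_of_subgroup[OF A] subgroup.subset unfolding abelian_sub_def by fastforce+
  have B0ab: "abelian_sub G B0" using B0(1) B0s(1) unfolding abelian_sub_def by simp
  define B where "B = B0 \<inter> N"
  have Bs: "subgroup B G" unfolding B_def by (rule subgroups_Inter_pair[OF B0s(1) N.subgroup_axioms])
  have B: "abelian_sub G B" "B \<subseteq> N" using abelian_sub_subset[OF B0ab Bs] unfolding B_def by auto
  have Bfg: "finitely_generated_in G B" using finitely_generated_in_base[OF fg va Bs] B(2) NA by blast
  have Bc: "fin_cover G B N" unfolding B_def
    by (rule fin_cover_Int[OF B0s(2,1) N.subgroup_axioms NA A.subset])
  have Nfg: "finitely_generated_in G N" by (rule finitely_generated_in_base[OF fg va N.subgroup_axioms NA])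
  show "property_LR G" unfolding property_LR_def
  proof (intro allI impI, elim conjE)
    fix H assume H: "subgroup H G" "finitely_generated_in G H"
    have nH: "normalizes G H N" unfolding normalizes_def using N.inv_op_closed2[OF subgroup.mem_carrier[OF H(1)]] by simp
    define P where "P = N <#> H"
    have P: "subgroup P G" unfolding P_def by (rule subgroup_mult_normalizes[OF nH H(1) N.subgroup_axioms])
    have NP: "N \<subseteq> P"
    proof
      fix n assume n: "n \<in> N"
      have "n = n \<otimes> \<one>" using n by simp
      then show "n \<in> P" unfolding P_def set_mult_def using n subgroup.one_closed[OF H(1)] by blast
    qed
    have HP: "H \<subseteq> P"
    proof
      fix h assume h: "h \<in> H"
      have "h = \<one> \<otimes> h" using h subgroup.mem_carrier[OF H(1)] by simp
      then show "h \<in> P" unfolding P_def set_mult_def using h N.one_closed by blast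
    qed
    have "finitely_generated_in G P"
    proof -
      obtain S T where S: "finite S" "S \<subseteq> carrier G" "generate G S = N" and T: "finite T" "T \<subseteq> carrier G" "generate G T = H"
        using Nfg H(2) unfolding finitely_generated_in_def by blast
      have "S \<subseteq> N" "T \<subseteq> H" using S(3) T(3) generate.incl[of _ S G] generate.incl[of _ T G] by blast+
      then have "generate G (S \<union> T) \<subseteq> P" using NP HP by (intro generate_subgroup_incl P) auto
      moreover have "P \<subseteq> generate G (S \<union> T)"
      proof
        fix x assume "x \<in> P"
        then obtain n h where "n \<in> N" "h \<in> H" "x = n \<otimes> h" unfolding P_def set_mult_def by blast
        moreover have "N \<subseteq> generate G (S \<union> T)" "H \<subseteq> generate G (S \<union> T)"
          using mono_generate[of S "S \<union> T"] mono_generate[of T "S \<union> T"] S(3) T(3) by auto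
        ultimately show "x \<in> generate G (S \<union> T)" by (auto intro: generate.eng)
      qed
      ultimately have "generate G (S \<union> T) = P" by blast
      moreover have "finite (S \<union> T)" "S \<union> T \<subseteq> carrier G" using S T by auto
      ultimately show ?thesis unfolding finitely_generated_in_def by blast
    qed
    then have VP: "virtual_retract G P" by (rule virtual_retract_containing[OF fg va C P NP])
    obtain M where M: "subgroup M G" "M \<subseteq> N" "normalizes G H M" "M \<inter> H = {\<one>}" "fin_cover G (M <#> H) P"
      using normal_complement[OF N B Bfg Bc C H(1)] unfolding P_def by blast
    have "M \<subseteq> P" using M(2) NP by blast
    then show "virtual_retract G H" by (rule virtual_retract_trans[OF VP H(1) HP M(1) _ M(3,4,5)])
  qed
qed

end

section \<open>Embedding the base group\<close>

lemma (in group_hom) finitely_generated_image: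
  assumes "finitely_generated_in G (carrier G)" "h ` carrier G = carrier H"
  shows "finitely_generated_in H (carrier H)"
proof -
  obtain S where S: "finite S" "S \<subseteq> carrier G" "generate G S = carrier G"
    using assms(1) unfolding finitely_generated_in_def by blast
  have "generate H (h ` S) = carrier H" using generate_img[OF S(2)] S(3) assms(2) by simp
  moreover have "finite (h ` S)" "h ` S \<subseteq> carrier H" using S by auto
  ultimately show ?thesis unfolding finitely_generated_in_def by blast
qed

lemma (in group_hom) virtually_abelian_image:
  assumes "virtually_abelian G" "h ` carrier G = carrier H"
  shows "virtually_abelian H"
proof -
  obtain B where B: "abelian_sub G B" "fin_cover G B (carrier G)" using G.virtually_abelianE[OF assms(1)] .
  note D = G.abelian_subD[OF B(1)]
  obtain T where T: "finite T" "T \<subseteq> carrier G" "carrier G \<subseteq> B <#>\<^bsub>G\<^esub> T"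
    using B(2) unfolding fin_cover_def by blast
  have hB: "subgroup (h ` B) H" using subgroup_img_is_subgroup[OF D(1)] .
  have "carrier H \<subseteq> h ` B <#>\<^bsub>H\<^esub> h ` T"
  proof
    fix y assume "y \<in> carrier H"
    then obtain x where x: "x \<in> carrier G" "y = h x" using assms(2) by blast
    then obtain b u where bu: "b \<in> B" "u \<in> T" "x = b \<otimes> u" using T(3) unfolding set_mult_def by blast
    then have "y = h b \<otimes>\<^bsub>H\<^esub> h u" using x D(2) T(2) by auto
    then show "y \<in> h ` B <#>\<^bsub>H\<^esub> h ` T" unfolding set_mult_def using bu by blast
  qed
  moreover have "finite (h ` T)" "h ` T \<subseteq> carrier H" using T by auto
  ultimately have "fin_cover H (h ` B) (carrier H)" unfolding fin_cover_def by blast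
  then have "finite_index H (h ` B)" using H.finite_index_iff hB by blast
  moreover have "comm_group (H\<lparr>carrier := h ` B\<rparr>)"
  proof (rule group.group_comm_groupI)
    show "group (H\<lparr>carrier := h ` B\<rparr>)" using hB subgroup.subgroup_is_group H.is_group by blast
    fix x y assume "x \<in> carrier (H\<lparr>carrier := h ` B\<rparr>)" "y \<in> carrier (H\<lparr>carrier := h ` B\<rparr>)"
    then obtain a b where ab: "a \<in> B" "b \<in> B" "x = h a" "y = h b" by auto
    then have "x \<otimes>\<^bsub>H\<^esub> y = h (a \<otimes> b)" using D(2) by simp
    also have "a \<otimes> b = b \<otimes> a" using D(3) ab by blast
    also have "h (b \<otimes> a) = y \<otimes>\<^bsub>H\<^esub> x" using ab D(2) by simp
    finally show "x \<otimes>\<^bsub>H\<lparr>carrier := h ` B\<rparr>\<^esub> y = y \<otimes>\<^bsub>H\<lparr>carrier := h ` B\<rparr>\<^esub> x" by simp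
  qed
  ultimately show ?thesis unfolding virtually_abelian_def by blast
qed

locale hnn_data = A: group A for A :: "('a, 'b) monoid_scheme" (structure) +
  fixes N :: "'a set" and \<xi> :: "'a \<Rightarrow> 'a"
  assumes N: "N \<lhd> A" and \<xi>: "\<xi> \<in> carrier (AutoGroup (A\<lparr>carrier := N\<rparr>))"
begin

sublocale N: normal N A by (rule N)

abbreviation HG :: "'a hnn_letter list set monoid" where
  "HG \<equiv> HNN A N \<xi>"

abbreviation cls :: "'a hnn_letter list \<Rightarrow> 'a hnn_letter list set" where
  "cls \<equiv> hnn_class A N \<xi>"

abbreviation hmult (infixl "\<star>" 70) where
  "x \<star> y \<equiv> x \<otimes>\<^bsub>HG\<^esub> y"

abbreviation hinv where
  "hinv x \<equiv> inv\<^bsub>HG\<^esub> x"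

sublocale HG: group HG
  by (rule HNN_group) (rule A.is_group)

definition e :: "'a \<Rightarrow> 'a hnn_letter list set" where
  "e a = cls [Base a]"

definition t :: "'a hnn_letter list set" where
  "t = cls [Stable]"

lemma \<xi>_bij: "bij_betw \<xi> N N" and \<xi>_ext: "\<xi> \<in> extensional N"
  using \<xi> by (auto simp: AutoGroup_def auto_def Bij_def)

lemma \<xi>_closed: "n \<in> N \<Longrightarrow> \<xi> n \<in> N"
  using \<xi>_bij by (auto simp: bij_betw_def)

lemma \<xi>_mult: "\<lbrakk>m \<in> N; n \<in> N\<rbrakk> \<Longrightarrow> \<xi> (m \<otimes> n) = \<xi> m \<otimes> \<xi> n"
  using \<xi> by (auto simp: AutoGroup_def auto_def hom_def)

lemma words: "[] \<in> hnn_words A" "Stable # w \<in> hnn_words A \<longleftrightarrow> w \<in> hnn_words A"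
  "Stable_inv # w \<in> hnn_words A \<longleftrightarrow> w \<in> hnn_words A"
  "Base a # w \<in> hnn_words A \<longleftrightarrow> a \<in> carrier A \<and> w \<in> hnn_words A"
  by (auto simp: hnn_words_def)

lemma carrier_HG: "carrier HG = cls ` hnn_words A"
  by (simp add: HNN_def)

lemma one_HG: "\<one>\<^bsub>HG\<^esub> = cls []"
  by (simp add: HNN_def)

lemma t_closed [simp]: "t \<in> carrier HG"
  unfolding t_def carrier_HG by (rule imageI) (simp add: words)

lemma e_closed: "a \<in> carrier A \<Longrightarrow> e a \<in> carrier HG"
  unfolding e_def carrier_HG by (rule imageI) (simp add: words)

lemma inv_t: "hinv t = cls [Stable_inv]"
proof (rule HG.inv_equality)
  show "cls [Stable_inv] \<star> t = \<one>\<^bsub>HG\<^esub>"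
    unfolding t_def one_HG using HNN_mult[of "[Stable_inv]" A "[Stable]"] hnn_eq.inv_stable[of A N \<xi>] words
    by (simp add: hnn_class_eq_iff)
  show "cls [Stable_inv] \<in> carrier HG" unfolding carrier_HG by (rule imageI) (simp add: words)
qed simp

lemma e_hom: "group_hom A HG e"
proof (unfold_locales, rule homI)
  fix a b assume a: "a \<in> carrier A"
  show "e a \<in> carrier HG" using a by (rule e_closed)
  assume b: "b \<in> carrier A"
  show "e (a \<otimes> b) = e a \<star> e b"
  proof -
    have "cls [Base a, Base b] = cls [Base (a \<otimes> b)]"
      using hnn_eq.base_mult[OF a b, of N \<xi>] a b words by (simp add: hnn_class_eq_iff)
    then show ?thesis
      unfolding e_def using HNN_mult[of "[Base a]" A "[Base b]"] a b words by simp
  qed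
qed

sublocale e: group_hom A HG e by (rule e_hom)

lemma word_induct:
  assumes g: "g \<in> carrier HG" and one: "P \<one>\<^bsub>HG\<^esub>"
    and base: "\<And>a g. \<lbrakk>a \<in> e ` carrier A; g \<in> carrier HG; P g\<rbrakk> \<Longrightarrow> P (a \<star> g)"
    and st: "\<And>g. \<lbrakk>g \<in> carrier HG; P g\<rbrakk> \<Longrightarrow> P (t \<star> g)"
    and st': "\<And>g. \<lbrakk>g \<in> carrier HG; P g\<rbrakk> \<Longrightarrow> P (hinv t \<star> g)"
  shows "P g"
proof -
  obtain w where w: "w \<in> hnn_words A" "g = cls w" using g unfolding carrier_HG by blast
  have "P (cls w)" using w(1)
  proof (induction w)
    case Nil
    then show ?case using one by (simp add: one_HG)
  next
    case (Cons x w)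
    have w: "w \<in> hnn_words A" "[x] \<in> hnn_words A" using Cons.prems by (auto simp: hnn_words_def)
    have c: "cls w \<in> carrier HG" unfolding carrier_HG using w by blast
    have eq: "cls (x # w) = cls [x] \<star> cls w" using HNN_mult[OF w(2,1), of N \<xi>] by simp
    show ?case
    proof (cases x)
      case (Base a)
      then have "a \<in> carrier A" using w words by simp
      then show ?thesis unfolding eq unfolding Base using base[of "e a" "cls w"] c Cons.IH[OF w(1)] by (simp add: e_def)
    next
      case Stable
      then show ?thesis unfolding eq using st[OF c Cons.IH[OF w(1)]] by (simp add: t_def)
    next
      case Stable_inv
      then show ?thesis unfolding eq using st'[OF c Cons.IH[OF w(1)]] by (simp add: inv_t)
    qed
  qed
  then show ?thesis using w by simp
qed

fun letter_act :: "('a \<Rightarrow> 'c \<Rightarrow> 'c) \<Rightarrow> ('c \<Rightarrow> 'c) \<Rightarrow> 'c set \<Rightarrow> 'a hnn_letter \<Rightarrow> 'c \<Rightarrow> 'c" where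
  "letter_act \<alpha> \<tau> Y (Base a) y = \<alpha> a y"
| "letter_act \<alpha> \<tau> Y Stable y = \<tau> y"
| "letter_act \<alpha> \<tau> Y Stable_inv y = inv_into Y \<tau> y"

text \<open>Letters act by permutations, \<open>Stable_inv\<close> by the inverse of \<tau>, and the
  defining congruence is respected. The type of points is kept arbitrary: \<open>Y\<close> is the
  carrier of \<open>A\<close> when \<open>A\<close> is embedded, and a set of numbered copies when
  the biset is built.\<close>

lemma universal:
  fixes Y :: "'c set"
  assumes \<alpha>: "\<And>a y. \<lbrakk>a \<in> carrier A; y \<in> Y\<rbrakk> \<Longrightarrow> \<alpha> a y \<in> Y" "\<And>y. y \<in> Y \<Longrightarrow> \<alpha> \<one> y = y"
      "\<And>a b y. \<lbrakk>a \<in> carrier A; b \<in> carrier A; y \<in> Y\<rbrakk> \<Longrightarrow> \<alpha> (a \<otimes> b) y = \<alpha> a (\<alpha> b y)"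
    and \<tau>: "bij_betw \<tau> Y Y" and rel: "\<And>n y. \<lbrakk>n \<in> N; y \<in> Y\<rbrakk> \<Longrightarrow> \<alpha> n (\<tau> y) = \<tau> (\<alpha> (\<xi> n) y)"
  obtains \<beta> where "left_act HG \<beta> Y" "\<And>a y. \<lbrakk>a \<in> carrier A; y \<in> Y\<rbrakk> \<Longrightarrow> \<beta> (e a) y = \<alpha> a y"
    "\<And>y. y \<in> Y \<Longrightarrow> \<beta> t y = \<tau> y"
proof -
  define act where "act w y = foldr (letter_act \<alpha> \<tau> Y) w y" for w y
  have act: "act [] y = y" "act (x # w) y = letter_act \<alpha> \<tau> Y x (act w y)" "act (u @ v) y = act u (act v y)" for x u v w y
    unfolding act_def by simp_all
  have \<tau>c: "\<tau> y \<in> Y" "inv_into Y \<tau> y \<in> Y" "inv_into Y \<tau> (\<tau> y) = y" "\<tau> (inv_into Y \<tau> y) = y" if "y \<in> Y" for y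
    using that \<tau> by (auto simp: bij_betw_def inv_into_into f_inv_into_f)
  have closed: "act w y \<in> Y" if "w \<in> hnn_words A" "y \<in> Y" for w y
    using that(1)
  proof (induction w)
    case Nil
    then show ?case using that act by simp
  next
    case (Cons x w)
    then have "act w y \<in> Y" by (auto simp: hnn_words_def)
    then show ?case using Cons.prems words by (cases x) (auto simp: act \<alpha> \<tau>c)
  qed
  \<comment> \<open>Membership in \<open>Y\<close> is part of the induction, because in a
    concatenation \<open>u\<close> is applied to the image under \<open>v\<close>.\<close>
  have eq: "\<forall>y\<in>Y. act u y = act v y \<and> act u y \<in> Y" if "hnn_eq A N \<xi> u v" for u v
    using that
  proof (induction rule: hnn_eq.induct)
    case (refl w)
    then show ?case using closed by blast
  next
    case (cong u u' v v')
    show ?case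
    proof
      fix y assume y: "y \<in> Y"
      then have v: "act v' y = act v y" "act v y \<in> Y" using cong.IH(2) by auto
      then have "act u (act v y) = act u' (act v y)" "act u (act v y) \<in> Y" using cong.IH(1) by auto
      then show "act (u @ v) y = act (u' @ v') y \<and> act (u @ v) y \<in> Y" using v by (simp add: act(3))
    qed
  next
    case (hnn_rel n)
    then have "n \<in> carrier A" "\<xi> n \<in> carrier A" using \<xi>_closed by auto
    then show ?case using hnn_rel by (simp add: act \<tau>c \<alpha> rel)
  qed (auto simp: act \<tau>c \<alpha>)
  define \<beta> where "\<beta> g y = act (SOME w. w \<in> g) y" for g y
  have \<beta>: "\<beta> (cls w) y = act w y" if w: "w \<in> hnn_words A" and y: "y \<in> Y" for w y
  proof -
    have "w \<in> cls w" unfolding hnn_class_def using hnn_eq.refl[OF w] by simp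
    then have "(SOME v. v \<in> cls w) \<in> cls w" by (rule someI[of "\<lambda>v. v \<in> cls w"])
    then have "hnn_eq A N \<xi> w (SOME v. v \<in> cls w)" unfolding hnn_class_def by simp
    then show ?thesis unfolding \<beta>_def using eq y by simp
  qed
  show thesis
  proof (rule that[of \<beta>])
    show "left_act HG \<beta> Y" unfolding left_act_def
    proof (intro conjI ballI)
      fix g y assume "g \<in> carrier HG" and y: "y \<in> Y"
      then obtain w where w: "w \<in> hnn_words A" "g = cls w" unfolding carrier_HG by blast
      show "\<beta> g y \<in> Y" using \<beta> closed w y by simp
      fix g' assume "g' \<in> carrier HG"
      then obtain w' where w': "w' \<in> hnn_words A" "g' = cls w'" unfolding carrier_HG by blast
      have "w @ w' \<in> hnn_words A" using w w' by (simp add: hnn_words_def)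
      then show "\<beta> (g \<star> g') y = \<beta> g (\<beta> g' y)"
        using w w' y \<beta> closed by (simp add: HNN_mult act)
    next
      fix y assume "y \<in> Y"
      then show "\<beta> \<one>\<^bsub>HG\<^esub> y = y" unfolding one_HG using \<beta> words act by simp
    qed
    show "\<beta> (e a) y = \<alpha> a y" if "a \<in> carrier A" "y \<in> Y" for a y
      unfolding e_def using \<beta> that words act by simp
    show "\<beta> t y = \<tau> y" if "y \<in> Y" for y
      unfolding t_def using \<beta> that words act by simp
  qed
qed

text \<open>\<open>A\<close> acts on itself from the left, and \<open>t\<close> acts by \<open>\<xi>\<inverse>\<close> on the \<open>N\<close>-part of an
  element with respect to a fixed transversal of \<open>N\<close>.\<close>

lemma e_inj: "inj_on e (carrier A)"
proof (rule inj_onI)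
  fix a b assume ab: "a \<in> carrier A" "b \<in> carrier A" "e a = e b"
  define s where "s x = (SOME y. y \<in> N #>\<^bsub>A\<^esub> x)" for x
  define \<zeta> where "\<zeta> = inv_into N \<xi>"
  have \<zeta>: "\<zeta> n \<in> N" "\<xi> (\<zeta> n) = n" "\<zeta> (\<xi> n) = n" if "n \<in> N" for n
    using that \<xi>_bij unfolding \<zeta>_def by (auto simp: bij_betw_def inv_into_into f_inv_into_f)
  have \<zeta>m: "\<zeta> (m \<otimes> n) = \<zeta> m \<otimes> \<zeta> n" if "m \<in> N" "n \<in> N" for m n
    using \<zeta>(3)[of "\<zeta> m \<otimes> \<zeta> n"] \<xi>_mult[of "\<zeta> m" "\<zeta> n"] \<zeta>(1,2) that by simp
  have s: "s x \<in> carrier A" "x \<otimes> inv s x \<in> N" if x: "x \<in> carrier A" for x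
  proof -
    have "x \<in> N #> x" using A.rcos_self[OF x N.subgroup_axioms] .
    then have "s x \<in> N #> x" unfolding s_def by (rule someI[of "\<lambda>y. y \<in> N #> x"])
    then obtain n where n: "n \<in> N" "s x = n \<otimes> x" unfolding r_coset_def by blast
    then show "s x \<in> carrier A" using x by simp
    have "x \<otimes> inv s x = inv n" using n x by (simp add: A.inv_mult_group)
    then show "x \<otimes> inv s x \<in> N" using n by simp
  qed
  have sn: "s (n \<otimes> x) = s x" if "n \<in> N" "x \<in> carrier A" for n x
  proof -
    have "n \<otimes> x \<in> N #> x" unfolding r_coset_def using that by blast
    then have "N #> (n \<otimes> x) = N #> x" using A.repr_independence[of "n \<otimes> x" N x] that N.subgroup_axioms by simp
    then show ?thesis unfolding s_def by simp
  qed
  have ss: "n \<otimes> s x = (n \<otimes> inv (x \<otimes> inv s x)) \<otimes> x" if "n \<in> N" "x \<in> carrier A" for n x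
    using that s[OF that(2)] by (simp add: A.m_assoc A.inv_mult_group)
  have sns: "s (n \<otimes> s x) = s x" if "n \<in> N" "x \<in> carrier A" for n x
    unfolding ss[OF that] using sn[of "n \<otimes> inv (x \<otimes> inv s x)" x] s that by simp
  define \<tau> where "\<tau> x = \<zeta> (x \<otimes> inv s x) \<otimes> s x" for x
  define \<tau>' where "\<tau>' x = \<xi> (x \<otimes> inv s x) \<otimes> s x" for x
  have bij: "bij_betw \<tau> (carrier A) (carrier A)"
  proof (rule bij_betw_byWitness[where f' = \<tau>'])
    show "\<forall>x\<in>carrier A. \<tau>' (\<tau> x) = x"
    proof
      fix x assume x: "x \<in> carrier A"
      note sx = s[OF x]
      have "s (\<tau> x) = s x" unfolding \<tau>_def by (rule sns[OF \<zeta>(1)[OF sx(2)] x])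
      then show "\<tau>' (\<tau> x) = x" unfolding \<tau>'_def using sx \<zeta>[OF sx(2)] x by (simp add: \<tau>_def A.m_assoc)
    qed
    show "\<forall>x\<in>carrier A. \<tau> (\<tau>' x) = x"
    proof
      fix x assume x: "x \<in> carrier A"
      note sx = s[OF x]
      have "s (\<tau>' x) = s x" unfolding \<tau>'_def by (rule sns[OF \<xi>_closed[OF sx(2)] x])
      then show "\<tau> (\<tau>' x) = x" unfolding \<tau>_def using sx \<zeta>[OF sx(2)] \<xi>_closed[OF sx(2)] x by (simp add: \<tau>'_def A.m_assoc)
    qed
    show "\<tau> ` carrier A \<subseteq> carrier A" "\<tau>' ` carrier A \<subseteq> carrier A"
      unfolding \<tau>_def \<tau>'_def using s \<zeta>(1) \<xi>_closed by auto
  qed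
  \<comment> \<open>Left multiplication by \<open>\<xi> n\<close> changes only the
    \<open>N\<close>-part of \<open>x\<close>, and there \<open>\<zeta>\<close> is multiplicative
    and inverts \<xi>.\<close>
  have rel: "n \<otimes> \<tau> x = \<tau> (\<xi> n \<otimes> x)" if n: "n \<in> N" and x: "x \<in> carrier A" for n x
  proof -
    note sx = s[OF x]
    have sc: "s (\<xi> n \<otimes> x) = s x" by (rule sn[OF \<xi>_closed[OF n] x])
    have "\<xi> n \<otimes> x \<otimes> inv s x = \<xi> n \<otimes> (x \<otimes> inv s x)" using \<xi>_closed[OF n] x sx by (simp add: A.m_assoc)
    then have "\<tau> (\<xi> n \<otimes> x) = (n \<otimes> \<zeta> (x \<otimes> inv s x)) \<otimes> s x"
      unfolding \<tau>_def sc using \<zeta>m[OF \<xi>_closed[OF n] sx(2)] \<zeta>(3)[OF n] by simp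
    then show ?thesis unfolding \<tau>_def using n sx \<zeta>(1)[OF sx(2)] by (simp add: A.m_assoc)
  qed
  obtain \<beta> where \<beta>: "\<And>a y. \<lbrakk>a \<in> carrier A; y \<in> carrier A\<rbrakk> \<Longrightarrow> \<beta> (e a) y = a \<otimes> y"
  proof (rule universal[of "carrier A" "\<lambda>a x. a \<otimes> x" \<tau>])
    show "n \<otimes> \<tau> x = \<tau> (\<xi> n \<otimes> x)" if "n \<in> N" "x \<in> carrier A" for n x by (rule rel[OF that])
  qed (use bij that in \<open>auto simp: A.m_assoc\<close>)
  have "a \<otimes> \<one> = b \<otimes> \<one>" using \<beta>[OF ab(1), of \<one>] \<beta>[OF ab(2), of \<one>] ab(3) by simp
  then show "a = b" using ab by simp
qed

lemma t_conj:
  assumes n: "n \<in> N"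
  shows "hinv t \<star> e n \<star> t = e (\<xi> n)"
  unfolding inv_t unfolding e_def t_def
  using HNN_mult[of "[Stable_inv]" A "[Base n]" N \<xi>] HNN_mult[of "[Stable_inv, Base n]" A "[Stable]" N \<xi>]
    hnn_eq.hnn_rel[OF n, of A \<xi>] n \<xi>_closed[OF n] words by (simp add: hnn_class_eq_iff)

text \<open>Checked letter by letter. For \<open>t\<close> it rests on \<xi> being onto
  \<open>N\<close>, for the inverse of \<open>t\<close> on \<xi> mapping \<open>N\<close> to
  itself.\<close>

lemma normal_image: "e ` N \<lhd> HG"
proof -
  have sub: "subgroup (e ` N) HG" using e.subgroup_img_is_subgroup[OF N.subgroup_axioms] .
  interpret eN: subgroup "e ` N" HG by (rule sub)
  have "\<forall>x\<in>e ` N. g \<star> x \<star> hinv g \<in> e ` N" if "g \<in> carrier HG" for g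
    using that
  proof (rule word_induct)
    show "\<forall>x\<in>e ` N. \<one>\<^bsub>HG\<^esub> \<star> x \<star> hinv \<one>\<^bsub>HG\<^esub> \<in> e ` N" using eN.mem_carrier by simp
    fix g assume g: "g \<in> carrier HG" and IH: "\<forall>x\<in>e ` N. g \<star> x \<star> hinv g \<in> e ` N"
    have step: "\<forall>x\<in>e ` N. (b \<star> g) \<star> x \<star> hinv (b \<star> g) \<in> e ` N"
      if b: "b \<in> carrier HG" "\<And>x. x \<in> e ` N \<Longrightarrow> b \<star> x \<star> hinv b \<in> e ` N" for b
    proof
      fix x assume x: "x \<in> e ` N"
      have "(b \<star> g) \<star> x \<star> hinv (b \<star> g) = 
          b \<star> (g \<star> x \<star> hinv g) \<star> hinv b"
        using b(1) g eN.mem_carrier[OF x] by (simp add: HG.m_assoc HG.inv_mult_group)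
      then show "(b \<star> g) \<star> x \<star> hinv (b \<star> g) \<in> e ` N"
        using b(2)[OF bspec[OF IH x]] by simp
    qed
    show "\<forall>x\<in>e ` N. t \<star> g \<star> x \<star> hinv (t \<star> g) \<in> e ` N"
    proof (rule step)
      fix x assume "x \<in> e ` N"
      then obtain n where n: "n \<in> N" "x = e n" by blast
      then obtain m where m: "m \<in> N" "n = \<xi> m" using \<xi>_bij by (auto simp: bij_betw_def)
      have "t \<star> x \<star> hinv t = t \<star> (hinv t \<star> e m \<star> t) \<star> hinv t"
        using t_conj[OF m(1)] n m by simp
      also have "\<dots> = e m" using m e_closed by (simp add: HG.m_assoc)
      finally show "t \<star> x \<star> hinv t \<in> e ` N" using m by simp
    qed simp
    show "\<forall>x\<in>e ` N. hinv t \<star> g \<star> x \<star> hinv (hinv t \<star> g) \<in> e ` N"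
    proof (rule step)
      fix x assume "x \<in> e ` N"
      then obtain n where n: "n \<in> N" "x = e n" by blast
      then show "hinv t \<star> x \<star> hinv (hinv t) \<in> e ` N"
        using t_conj[OF n(1)] \<xi>_closed by simp
    qed simp
    fix a assume "a \<in> e ` carrier A"
    then obtain b where b: "b \<in> carrier A" "a = e b" by blast
    show "\<forall>x\<in>e ` N. a \<star> g \<star> x \<star> hinv (a \<star> g) \<in> e ` N"
    proof (rule step)
      fix x assume "x \<in> e ` N"
      then obtain n where n: "n \<in> N" "x = e n" by blast
      have "a \<star> x \<star> hinv a = e (b \<otimes> n \<otimes> inv b)" using b n by simp
      then show "a \<star> x \<star> hinv a \<in> e ` N" using N.inv_op_closed2[OF b(1) n(1)] by simp
    qed (use b e_closed in simp)
  qed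
  then show ?thesis using HG.normal_inv_iff sub by blast
qed

sublocale hnn: normal_hnn HG "e ` carrier A" "e ` N" t
proof (rule normal_hnn.intro[OF HG.is_group], rule normal_hnn_axioms.intro)
  show "subgroup (e ` carrier A) HG" by (rule e.img_is_subgroup)
  show "e ` N \<lhd> HG" by (rule normal_image)
  show "e ` N \<subseteq> e ` carrier A" using N.subset by blast
  show "t \<in> carrier HG" by simp
next
  fix P :: "'a hnn_letter list set \<Rightarrow> bool" and g
  assume "g \<in> carrier HG" "P \<one>\<^bsub>HG\<^esub>" 
    "\<And>a g. \<lbrakk>a \<in> e ` carrier A; g \<in> carrier HG; P g\<rbrakk> \<Longrightarrow> P (a \<star> g)"
    "\<And>g. \<lbrakk>g \<in> carrier HG; P g\<rbrakk> \<Longrightarrow> P (t \<star> g)"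
    "\<And>g. \<lbrakk>g \<in> carrier HG; P g\<rbrakk> \<Longrightarrow> P (hinv t \<star> g)"
  then show "P g" by (rule word_induct)
next
  fix Y :: "(nat \<times> 'a hnn_letter list set set) set" and \<alpha> \<tau>
  assume \<alpha>: "\<And>a y. \<lbrakk>a \<in> e ` carrier A; y \<in> Y\<rbrakk> \<Longrightarrow> \<alpha> a y \<in> Y" "\<And>y. y \<in> Y \<Longrightarrow> \<alpha> \<one>\<^bsub>HG\<^esub> y = y"
    "\<And>a b y. \<lbrakk>a \<in> e ` carrier A; b \<in> e ` carrier A; y \<in> Y\<rbrakk> \<Longrightarrow> \<alpha> (a \<star> b) y = \<alpha> a (\<alpha> b y)"
    and \<tau>: "bij_betw \<tau> Y Y" 
    and rel: "\<And>n y. \<lbrakk>n \<in> e ` N; y \<in> Y\<rbrakk> \<Longrightarrow> \<alpha> n (\<tau> y) = \<tau> (\<alpha> (hinv t \<star> n \<star> t) y)"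
  obtain \<beta> where \<beta>: "left_act HG \<beta> Y" "\<And>a y. \<lbrakk>a \<in> carrier A; y \<in> Y\<rbrakk> \<Longrightarrow> \<beta> (e a) y = \<alpha> (e a) y"
    "\<And>y. y \<in> Y \<Longrightarrow> \<beta> t y = \<tau> y"
  proof (rule universal[of Y "\<lambda>a. \<alpha> (e a)" \<tau>])
    show "\<alpha> (e a) y \<in> Y" if "a \<in> carrier A" "y \<in> Y" for a y using \<alpha>(1) that by simp
    show "\<alpha> (e \<one>) y = y" if "y \<in> Y" for y using \<alpha>(2) that by simp
    show "\<alpha> (e (a \<otimes> b)) y = \<alpha> (e a) (\<alpha> (e b) y)" if "a \<in> carrier A" "b \<in> carrier A" "y \<in> Y" for a b y 
      using \<alpha>(3) that by simp
    show "\<alpha> (e n) (\<tau> y) = \<tau> (\<alpha> (e (\<xi> n)) y)" if "n \<in> N" "y \<in> Y" for n y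
      using rel[of "e n" y] t_conj[OF that(1)] that by simp
  qed (use \<tau> that in auto)
  then show "\<exists>\<beta>. left_act HG \<beta> Y \<and> (\<forall>a\<in>e ` carrier A. \<forall>y\<in>Y. \<beta> a y = \<alpha> a y) \<and> (\<forall>y\<in>Y. \<beta> t y = \<tau> y)"
    by blast
qed

lemma property_LR_iff_cover:
  assumes "finitely_generated_in A (carrier A)" "virtually_abelian A"
  shows "property_LR HG \<longleftrightarrow> fin_cover HG (e ` N <#>\<^bsub>HG\<^esub> cent HG (e ` N)) (carrier HG)"
proof -
  have sub: "subgroup (e ` carrier A) HG" by (rule e.img_is_subgroup)
  have grp: "group (HG\<lparr>carrier := e ` carrier A\<rparr>)" by (rule subgroup.subgroup_is_group[OF sub HG.is_group])
  interpret eA: group_hom A "HG\<lparr>carrier := e ` carrier A\<rparr>" e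
    by (intro group_hom.intro A.is_group grp group_hom_axioms.intro homI) auto
  show ?thesis
    using hnn.property_LR_iff eA.finitely_generated_image[OF assms(1)] eA.virtually_abelian_image[OF assms(2)] by simp
qed

end

section \<open>The image in the outer automorphism group\<close>

context hnn_data
begin

abbreviation NA :: "('a, 'b) monoid_scheme" where
  "NA \<equiv> A\<lparr>carrier := N\<rparr>"

abbreviation AG :: "('a \<Rightarrow> 'a) monoid" where
  "AG \<equiv> AutoGroup NA"

sublocale NG: group NA
  by (rule N.subgroup_is_group) (rule A.is_group)

sublocale AG: group AG
  by (rule NG.AutoGroup)

sublocale Inn: normal "Inn NA" AG
  by (rule NG.Inn_normal)

sublocale Out: group "Out NA"
  unfolding Out_def by (rule Inn.factorgroup_is_group)

lemma out_class_hom: "group_hom AG (Out NA) (out_class NA)"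
  unfolding Out_def out_class_def
  by (intro group_hom.intro group_hom_axioms.intro AG.is_group Inn.factorgroup_is_group Inn.r_coset_hom_Mod)

lemma AG_mult: "\<lbrakk>f \<in> carrier AG; g \<in> carrier AG\<rbrakk> \<Longrightarrow> f \<otimes>\<^bsub>AG\<^esub> g = compose N f g"
  by (simp add: AutoGroup_def BijGroup_def auto_def)

lemma AG_one: "\<one>\<^bsub>AG\<^esub> = (\<lambda>x\<in>N. x)"
  by (simp add: AutoGroup_def BijGroup_def)

lemma out_class_eq_one:
  assumes "f \<in> carrier AG"
  shows "out_class NA f = \<one>\<^bsub>Out NA\<^esub> \<longleftrightarrow> f \<in> Inn NA"
proof -
  have "\<one>\<^bsub>Out NA\<^esub> = Inn NA" by (simp add: Out_def FactGroup_def)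
  then show ?thesis unfolding out_class_def
    using AG.coset_join1[OF _ assms Inn.subgroup_axioms] AG.coset_join2[OF assms Inn.subgroup_axioms] by auto
qed

text \<open>Extends the conjugation action of \<open>A\<close> on \<open>N\<close> to the whole
  HNN-extension, which is possible because the image of \<open>N\<close> is normal there.\<close>

definition conj_N :: "'a hnn_letter list set \<Rightarrow> 'a \<Rightarrow> 'a" where
  "conj_N g = (\<lambda>x\<in>N. inv_into N e (g \<star> e x \<star> hinv g))"

lemma e_inj_N: "inj_on e N"
  by (rule inj_on_subset[OF e_inj N.subset])

lemma conj_N:
  assumes g: "g \<in> carrier HG" and x: "x \<in> N"
  shows "conj_N g x \<in> N" "e (conj_N g x) = g \<star> e x \<star> hinv g"
proof -
  have "g \<star> e x \<star> hinv g \<in> e ` N" using hnn.N.inv_op_closed2[OF g] x by blast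
  then show "conj_N g x \<in> N" "e (conj_N g x) = g \<star> e x \<star> hinv g"
    unfolding conj_N_def using x by (simp_all add: inv_into_into f_inv_into_f)
qed

lemma conj_N_eqI:
  assumes g: "g \<in> carrier HG" and f: "f \<in> extensional N" 
    and eq: "\<And>x. x \<in> N \<Longrightarrow> f x \<in> N" "\<And>x. x \<in> N \<Longrightarrow> e (f x) = g \<star> e x \<star> hinv g"
  shows "conj_N g = f"
proof (rule extensionalityI[of _ N])
  show "conj_N g \<in> extensional N" unfolding conj_N_def by simp
  fix x assume x: "x \<in> N"
  have "e (conj_N g x) = e (f x)" using conj_N(2)[OF g x] eq(2)[OF x] by simp
  then show "conj_N g x = f x" using e_inj_N conj_N(1)[OF g x] eq(1)[OF x] by (auto dest: inj_onD)
qed (rule f)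

lemma conj_N_mult:
  assumes g: "g \<in> carrier HG" and h: "h \<in> carrier HG" and x: "x \<in> N"
  shows "conj_N (g \<star> h) x = conj_N g (conj_N h x)"
proof -
  have "e (conj_N (g \<star> h) x) = e (conj_N g (conj_N h x))"
    using conj_N(2)[OF g conj_N(1)[OF h x]] conj_N(2)[OF h x] conj_N(2)[of "g \<star> h" x] g h x
    by (simp add: HG.m_assoc HG.inv_mult_group)
  then show ?thesis using e_inj_N conj_N(1)[OF g conj_N(1)[OF h x]] conj_N(1)[of "g \<star> h" x] g h x
    by (auto dest: inj_onD)
qed

lemma conj_N_one: 
  assumes x: "x \<in> N"
  shows "conj_N \<one>\<^bsub>HG\<^esub> x = x"
proof -
  have "e (conj_N \<one>\<^bsub>HG\<^esub> x) = e x" using conj_N(2)[of "\<one>\<^bsub>HG\<^esub>" x] x by simp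
  then show ?thesis using e_inj_N conj_N(1)[of "\<one>\<^bsub>HG\<^esub>" x] x by (auto dest: inj_onD)
qed

lemma conj_N_auto:
  assumes g: "g \<in> carrier HG"
  shows "conj_N g \<in> carrier AG"
proof -
  have ig: "hinv g \<in> carrier HG" using g by simp
  have "bij_betw (conj_N g) N N"
  proof (rule bij_betw_byWitness[where f' = "conj_N (hinv g)"])
    show "\<forall>x\<in>N. conj_N (hinv g) (conj_N g x) = x"
      using conj_N_mult[OF ig g, symmetric] conj_N_one g by simp
    show "\<forall>x\<in>N. conj_N g (conj_N (hinv g) x) = x"
      using conj_N_mult[OF g ig, symmetric] conj_N_one g by simp
  qed (use conj_N(1) g ig in auto)
  moreover have "conj_N g \<in> extensional N" unfolding conj_N_def by simp
  moreover have "conj_N g \<in> hom NA NA"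
  proof (rule homI)
    fix x y assume "x \<in> carrier NA" "y \<in> carrier NA"
    then have xy: "x \<in> N" "y \<in> N" by auto
    have c: "e x \<in> carrier HG" "e y \<in> carrier HG" using xy e_closed by auto
    have "e (conj_N g (x \<otimes> y)) = e (conj_N g x \<otimes> conj_N g y)"
      using conj_N[OF g xy(1)] conj_N[OF g xy(2)] conj_N(2)[OF g N.m_closed[OF xy]] xy g c
      by (simp add: HG.m_assoc)
    then have "conj_N g (x \<otimes> y) = conj_N g x \<otimes> conj_N g y"
      using inj_onD[OF e_inj_N] conj_N(1)[OF g N.m_closed[OF xy]] conj_N(1)[OF g xy(1)] conj_N(1)[OF g xy(2)] by blast
    then show "conj_N g (x \<otimes>\<^bsub>NA\<^esub> y) = conj_N g x \<otimes>\<^bsub>NA\<^esub> conj_N g y" by simp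
  qed (use conj_N(1)[OF g] in simp)
  ultimately show ?thesis by (simp add: AutoGroup_def auto_def Bij_def)
qed

lemma conj_N_hom: "group_hom HG AG conj_N"
proof (intro group_hom.intro group_hom_axioms.intro HG.is_group AG.is_group homI conj_N_auto)
  fix g h assume gh: "g \<in> carrier HG" "h \<in> carrier HG"
  show "conj_N (g \<star> h) = conj_N g \<otimes>\<^bsub>AG\<^esub> conj_N h"
    unfolding AG_mult[OF conj_N_auto[OF gh(1)] conj_N_auto[OF gh(2)]]
  proof (rule extensionalityI[of _ N])
    show "conj_N (g \<star> h) \<in> extensional N" unfolding conj_N_def by simp
  qed (use conj_N_mult[OF gh] in \<open>simp_all add: compose_def\<close>)
qed

lemma conj_N_e: "a \<in> carrier A \<Longrightarrow> conj_N (e a) = conj_map A N a"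
  by (rule conj_N_eqI) (auto simp: conj_map_def N.inv_op_closed2 e_closed)

text \<open>In the relation \<open>hinv t \<star> e a \<star> t = e (\<xi> a)\<close> the inverse
  stands on the left, whereas \<open>conj_N g\<close> conjugates with \<open>g\<close> on the left.
  So \<xi> belongs to \<open>hinv t\<close>, which is the generator used below in place of
  \<open>t\<close>.\<close>

lemma conj_N_inv_t: "conj_N (hinv t) = \<xi>"
  by (rule conj_N_eqI) (auto simp: \<xi>_ext \<xi>_closed t_conj)

text \<open>On the image of \<open>N\<close>, conjugation by \<open>g\<close> agrees with
  conjugation by \<open>e n\<close> precisely when \<open>hinv (e n) \<star> g\<close> centralizes
  this image.\<close>

lemma conj_N_Inn:
  assumes g: "g \<in> carrier HG"
  shows "conj_N g \<in> Inn NA \<longleftrightarrow> g \<in> e ` N <#>\<^bsub>HG\<^esub> cent HG (e ` N)"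
proof
  have cm: "conj_map NA N n = conj_N (e n)" if "n \<in> N" for n
    using that conj_N_e[of n] A.m_inv_consistent[OF N.subgroup_axioms that] by (auto simp: conj_map_def)
  {
    assume "conj_N g \<in> Inn NA"
    then obtain n where n: "n \<in> N" "conj_N g = conj_N (e n)" unfolding Inn_def using cm by auto
    define c where "c = hinv (e n) \<star> g"
    have nc: "e n \<in> carrier HG" using n e_closed by simp
    have "c \<in> cent HG (e ` N)" unfolding cent_def
    proof (intro CollectI conjI ballI)
      show cc: "c \<in> carrier HG" unfolding c_def using g nc by simp
      fix y assume "y \<in> e ` N"
      then obtain x where x: "x \<in> N" "y = e x" by blast
      have xc: "e x \<in> carrier HG" using x e_closed by simp
      have "g \<star> e x \<star> hinv g = e n \<star> e x \<star> hinv (e n)"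
        using conj_N(2)[OF g x(1)] conj_N(2)[OF nc x(1)] n(2) by simp
      then have "g \<star> e x \<star> hinv g \<star> g = e n \<star> e x \<star> hinv (e n) \<star> g" by simp
      then have "g \<star> e x = e n \<star> (e x \<star> c)"
        using g xc nc unfolding c_def by (simp add: HG.m_assoc)
      then have "hinv (e n) \<star> (g \<star> e x) = e x \<star> c" using nc xc cc by simp
      then show "c \<star> y = y \<star> c" unfolding x(2) c_def using g xc nc by (simp add: HG.m_assoc)
    qed
    moreover have "g = e n \<star> c" unfolding c_def using g nc by simp
    ultimately show "g \<in> e ` N <#>\<^bsub>HG\<^esub> cent HG (e ` N)" unfolding set_mult_def using n(1) by blast
  }
  assume "g \<in> e ` N <#>\<^bsub>HG\<^esub> cent HG (e ` N)"
  then obtain n c where nc: "n \<in> N" "c \<in> cent HG (e ` N)" "g = e n \<star> c" unfolding set_mult_def by blast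
  have c: "c \<in> carrier HG" "e n \<in> carrier HG" using nc e_closed unfolding cent_def by auto
  have "conj_N g = conj_N (e n)"
  proof (rule conj_N_eqI[OF g])
    show "conj_N (e n) \<in> extensional N" unfolding conj_N_def by simp
    fix x assume x: "x \<in> N"
    show "conj_N (e n) x \<in> N" by (rule conj_N(1)[OF c(2) x])
    have xc: "e x \<in> carrier HG" using x e_closed by simp
    have "c \<star> e x = e x \<star> c" using nc x unfolding cent_def by blast
    then have "g \<star> e x = e n \<star> (e x \<star> c)" unfolding nc(3) using c xc by (simp add: HG.m_assoc)
    then have "g \<star> e x \<star> hinv g = e n \<star> (e x \<star> c) \<star> hinv (e n \<star> c)" using nc(3) by simp
    also have "\<dots> = e n \<star> e x \<star> hinv (e n)" using c xc by (simp add: HG.m_assoc HG.inv_mult_group)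
    finally show "e (conj_N (e n) x) = g \<star> e x \<star> hinv g" using conj_N(2)[OF c(2) x] by simp
  qed
  then have "conj_N g = conj_map NA (carrier NA) n" using cm[OF nc(1)] by simp
  then show "conj_N g \<in> Inn NA" unfolding Inn_def using nc(1) by simp
qed

lemma generate_HG: "generate HG (e ` carrier A \<union> {hinv t}) = carrier HG"
proof
  let ?S = "e ` carrier A \<union> {hinv t}"
  have S: "?S \<subseteq> carrier HG" using e_closed by auto
  show "generate HG ?S \<subseteq> carrier HG" by (rule HG.generate_incl[OF S])
  have W: "subgroup (generate HG ?S) HG" by (rule HG.generate_is_subgroup[OF S])
  have it: "hinv t \<in> generate HG ?S" by (rule generate.incl) simp
  have tt: "t \<in> generate HG ?S" using subgroup.m_inv_closed[OF W it] by simp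
  show "carrier HG \<subseteq> generate HG ?S"
  proof
    fix g assume "g \<in> carrier HG"
    then show "g \<in> generate HG ?S"
    proof (rule word_induct)
      show "\<one>\<^bsub>HG\<^esub> \<in> generate HG ?S" by (rule generate.one)
      fix g assume g: "g \<in> generate HG ?S"
      show "t \<star> g \<in> generate HG ?S" using tt g by (rule generate.eng)
      show "hinv t \<star> g \<in> generate HG ?S" using it g by (rule generate.eng)
      fix a assume "a \<in> e ` carrier A"
      then have "a \<in> generate HG ?S" by (intro generate.incl) simp
      then show "a \<star> g \<in> generate HG ?S" using g by (rule generate.eng)
    qed
  qed
qed

text \<open>Conjugation induces a homomorphism \<open>\<Psi>\<close> from the HNN-extension to
  \<open>Out NA\<close>. Its image is the subgroup in question and its kernel is the product of the
  image of \<open>N\<close> with its centralizer, so the image is finite precisely when the kernel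
  has finite index.\<close>

lemma finite_Out_image_iff:
  "finite (generate (Out NA) (out_class NA ` (conj_map A N ` carrier A \<union> {\<xi>}))) \<longleftrightarrow>
    fin_cover HG (e ` N <#>\<^bsub>HG\<^esub> cent HG (e ` N)) (carrier HG)"
proof -
  interpret c: group_hom HG AG conj_N by (rule conj_N_hom)
  interpret o: group_hom AG "Out NA" "out_class NA" by (rule out_class_hom)
  define \<Psi> where "\<Psi> g = out_class NA (conj_N g)" for g
  have "group_hom HG (Out NA) \<Psi>"
    unfolding \<Psi>_def by (intro group_hom.intro group_hom_axioms.intro HG.is_group Out.is_group homI) auto
  then interpret \<Psi>: group_hom HG "Out NA" \<Psi> .
  let ?K = "e ` N <#>\<^bsub>HG\<^esub> cent HG (e ` N)"
  have "out_class NA ` (conj_map A N ` carrier A \<union> {\<xi>}) = \<Psi> ` (e ` carrier A \<union> {hinv t})"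
    unfolding \<Psi>_def image_Un by (simp add: image_image conj_N_e conj_N_inv_t)
  moreover have S: "e ` carrier A \<union> {hinv t} \<subseteq> carrier HG" using e_closed by auto
  have "generate (Out NA) (\<Psi> ` (e ` carrier A \<union> {hinv t})) = \<Psi> ` carrier HG"
    unfolding \<Psi>.generate_img[OF S] generate_HG ..
  ultimately have gen: "generate (Out NA) (out_class NA ` (conj_map A N ` carrier A \<union> {\<xi>})) = \<Psi> ` carrier HG"
    by simp
  have ker: "\<Psi> x = \<Psi> y \<longleftrightarrow> x \<star> hinv y \<in> ?K" if xy: "x \<in> carrier HG" "y \<in> carrier HG" for x y
  proof -
    have "\<Psi> x = \<Psi> y \<longleftrightarrow> \<Psi> (x \<star> hinv y) = \<one>\<^bsub>Out NA\<^esub>"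
      using xy Out.inv_solve_right'[of "\<one>\<^bsub>Out NA\<^esub>" "\<Psi> x" "\<Psi> y"] by auto
    also have "\<dots> \<longleftrightarrow> conj_N (x \<star> hinv y) \<in> Inn NA"
      unfolding \<Psi>_def by (rule out_class_eq_one[OF conj_N_auto]) (use xy in simp)
    also have "\<dots> \<longleftrightarrow> x \<star> hinv y \<in> ?K" by (rule conj_N_Inn) (use xy in simp)
    finally show ?thesis .
  qed
  show ?thesis unfolding gen
  proof
    assume "finite (\<Psi> ` carrier HG)"
    then show "fin_cover HG ?K (carrier HG)" by (rule HG.fin_coverI_map[OF subset_refl]) (use ker in blast)
  next
    assume fc: "fin_cover HG ?K (carrier HG)"
    have sub: "subgroup ?K HG"
    proof (rule HG.subgroup_mult_normalizes[OF _ hnn.cent_N_subgroup hnn.N.subgroup_axioms])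
      show "normalizes HG (cent HG (e ` N)) (e ` N)"
        unfolding normalizes_def by (intro ballI hnn.N.inv_op_closed2 hnn.Z.mem_carrier)
    qed
    from HG.fin_cover_rcosets[OF fc sub subset_refl] show "finite (\<Psi> ` carrier HG)"
    proof (rule finite_image_factor)
      fix x y assume xy: "x \<in> carrier HG" "y \<in> carrier HG" "?K #>\<^bsub>HG\<^esub> x = ?K #>\<^bsub>HG\<^esub> y"
      then have "x \<in> ?K #>\<^bsub>HG\<^esub> y" using HG.rcos_self[OF xy(1) sub] by simp
      then obtain k where k: "k \<in> ?K" "x = k \<star> y" unfolding r_coset_def by blast
      then have "x \<star> hinv y = k" using xy subgroup.mem_carrier[OF sub k(1)] by (simp add: HG.m_assoc)
      then show "\<Psi> x = \<Psi> y" using ker xy k by simp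
    qed
  qed
qed

text \<open>An abelian \<open>A\<close> acts trivially on \<open>N\<close> by conjugation, so the
  subgroup lies in the cyclic group generated by the class of \<xi>, and that class has finite
  order.\<close>

lemma finite_Out_image_abelian:
  assumes comm: "\<And>a b. \<lbrakk>a \<in> carrier A; b \<in> carrier A\<rbrakk> \<Longrightarrow> a \<otimes> b = b \<otimes> a"
    and n: "n > (0 :: nat)" "\<xi> [^]\<^bsub>AG\<^esub> n = \<one>\<^bsub>AG\<^esub>"
  shows "finite (generate (Out NA) (out_class NA ` (conj_map A N ` carrier A \<union> {\<xi>})))"
proof -
  interpret o: group_hom AG "Out NA" "out_class NA" by (rule out_class_hom)
  define z where "z = out_class NA \<xi>"
  have z: "z \<in> carrier (Out NA)" unfolding z_def using \<xi> by simp
  have zn: "z [^]\<^bsub>Out NA\<^esub> n = \<one>\<^bsub>Out NA\<^esub>" unfolding z_def using n(2) o.hom_nat_pow[OF \<xi>, of n] by simp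
  have "conj_map A N a = \<one>\<^bsub>AG\<^esub>" if a: "a \<in> carrier A" for a
  proof -
    have "a \<otimes> x \<otimes> inv a = x" if "x \<in> N" for x using comm[OF a, of x] that a by (simp add: A.m_assoc)
    then show ?thesis unfolding conj_map_def AG_one by (rule restrict_ext)
  qed
  then have "out_class NA ` (conj_map A N ` carrier A \<union> {\<xi>}) \<subseteq> generate (Out NA) {z}"
    using generate.one[of "Out NA" "{z}"] generate.incl[of z "{z}" "Out NA"] by (auto simp: z_def)
  then have 1: "generate (Out NA) (out_class NA ` (conj_map A N ` carrier A \<union> {\<xi>})) \<subseteq> generate (Out NA) {z}"
    by (rule Out.generate_subgroup_incl) (rule Out.generate_is_subgroup, use z in simp)
  have "generate (Out NA) {z} \<subseteq> (\<lambda>k. z [^]\<^bsub>Out NA\<^esub> k) ` {..<n}"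
  proof
    fix y assume "y \<in> generate (Out NA) {z}"
    then obtain k :: int where k: "y = z [^]\<^bsub>Out NA\<^esub> k" using Out.generate_pow[OF z] by blast
    define q r where "q = k div int n" and "r = nat (k mod int n)"
    have r: "k = int n * q + int r" "r < n" unfolding q_def r_def using n(1) by (auto simp: nat_less_iff)
    have "y = z [^]\<^bsub>Out NA\<^esub> (int n * q) \<otimes>\<^bsub>Out NA\<^esub> z [^]\<^bsub>Out NA\<^esub> r"
      unfolding k r(1) using z by (simp add: Out.int_pow_mult int_pow_int)
    also have "z [^]\<^bsub>Out NA\<^esub> (int n * q) = (z [^]\<^bsub>Out NA\<^esub> n) [^]\<^bsub>Out NA\<^esub> q"
      using z by (simp add: Out.int_pow_pow flip: int_pow_int)
    finally have "y = z [^]\<^bsub>Out NA\<^esub> r" using z zn by simp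
    then show "y \<in> (\<lambda>k. z [^]\<^bsub>Out NA\<^esub> k) ` {..<n}" using r(2) by blast
  qed
  then have "finite (generate (Out NA) {z})" by (rule finite_subset) simp
  with 1 show ?thesis by (rule finite_subset)
qed

end

theorem corollary5p5:
  fixes A :: "('a, 'b) monoid_scheme" and N :: "'a set" and \<xi> :: "'a \<Rightarrow> 'a"
  assumes "group A"
    and "finitely_generated_in A (carrier A)"
    and "virtually_abelian A"
    and "N \<lhd> A"
    and "\<xi> \<in> carrier (AutoGroup (A\<lparr>carrier := N\<rparr>))"
  shows "(property_LR (HNN A N \<xi>) \<longleftrightarrow>
            finite (generate (Out (A\<lparr>carrier := N\<rparr>))
              (out_class (A\<lparr>carrier := N\<rparr>) ` (conj_map A N ` carrier A \<union> {\<xi>}))))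
       \<and> (comm_group A \<and> (\<exists>n::nat. n > 0 \<and> \<xi> [^]\<^bsub>AutoGroup (A\<lparr>carrier := N\<rparr>)\<^esub> n = \<one>\<^bsub>AutoGroup (A\<lparr>carrier := N\<rparr>)\<^esub>)
            \<longrightarrow> property_LR (HNN A N \<xi>))"
proof -
  interpret hnn_data A N \<xi>
    by (intro hnn_data.intro hnn_data_axioms.intro assms)
  have iff: "property_LR (HNN A N \<xi>) \<longleftrightarrow>
            finite (generate (Out (A\<lparr>carrier := N\<rparr>))
              (out_class (A\<lparr>carrier := N\<rparr>) ` (conj_map A N ` carrier A \<union> {\<xi>})))"
    unfolding finite_Out_image_iff by (rule property_LR_iff_cover[OF assms(2,3)])
  moreover have "property_LR (HNN A N \<xi>)" 
    if "comm_group A" "n > 0" "\<xi> [^]\<^bsub>AutoGroup (A\<lparr>carrier := N\<rparr>)\<^esub> n = \<one>\<^bsub>AutoGroup (A\<lparr>carrier := N\<rparr>)\<^esub>" for n :: nat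
    unfolding iff using comm_monoid.m_comm[OF comm_group.axioms(1)[OF that(1)]] that(2,3)
    by (intro finite_Out_image_abelian) auto
  ultimately show ?thesis by blast
qed

end
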